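(* Let $k$ be a field with $\operatorname{char} k\neq 2$. Suppose that $r\geq 3$ is an odd integer, $d\geq 3$ is an integer, and $V$ is a $k$-vector space with $\dim V=rd$. Then $$\operatorname{Hom}_{\operatorname{GL}(V)}\left(\operatorname{Sym}^d\left(\bigwedge^r V\right),\ \operatorname{End}(V)\otimes\det(V)\right)=0 .$$
   Context: $\operatorname{GL}(V)$ denotes the general linear algebraic group scheme over $k$, and $\operatorname{Hom}_{\operatorname{GL}(V)}$ denotes $k$-linear maps that are equivariant for the algebraic group scheme, i.e. morphisms of rational representations (comodules over the coordinate Hopf algebra $k[\operatorname{GL}(V)]$; equivalently, equivariance holds after base change to every commutative $k$-algebra). Over finite fields this is stronger than equivariance for the abstract group of $k$-points. $\operatorname{Sym}^d(W)$ is the ordinary symmetric power, i.e. the coinvariants of the symmetric group $S_d$ on $W^{\otimes d}$ (not the divided power). $\det(V)=\bigwedge^{\dim V}V$. $\operatorname{GL}(V)$ acts on $\operatorname{End}(V)\otimes\det(V)$ by $g\cdot(X\otimes\eta)=gXg^{-1}\otimes\det(g)\,\eta$, and on $\operatorname{Sym}^d(\bigwedge^r V)$ by functoriality. *)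

theory Defs
  imports
    "HOL-Algebra.AbelCoset"
    "HOL-Combinatorics.Permutations"
    "Jordan_Normal_Form.Missing_VectorSpace"
begin

text \<open>
  Modules are the records of HOL-Algebra, with \<open>span\<close>, \<open>module_hom\<close> and \<open>dim\<close> taken from the
  vector space library.  The fields \<open>mult\<close> and \<open>one\<close> of a module record carry no meaning.
\<close>

definition ring_char :: "('a, 'e) ring_scheme \<Rightarrow> nat" where
  "ring_char R = Gcd {n. [n] \<cdot>\<^bsub>R\<^esub> \<one>\<^bsub>R\<^esub> = \<zero>\<^bsub>R\<^esub>}"


section \<open>Linear maps\<close>

text \<open>Maps are extensional (\<open>undefined\<close> off the carrier), so equality of maps is equality in HOL.\<close>

definition lin_maps ::
  "'a ring \<Rightarrow> ('a, 'b) module \<Rightarrow> ('a, 'c) module \<Rightarrow> ('b \<Rightarrow> 'c) set" where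
  "lin_maps R M N = module_hom R M N \<inter> extensional (carrier M)"

text \<open>
  The linear map with prescribed values on generators, \<open>G\<close> being a set of pairs (generator, value).
  It is only used where the first components generate \<open>M\<close> and the prescription respects the
  relations between them, so that there is exactly one such map.
\<close>

definition the_lin ::
  "'a ring \<Rightarrow> ('a, 'b) module \<Rightarrow> ('a, 'c) module \<Rightarrow> ('b \<times> 'c) set \<Rightarrow> 'b \<Rightarrow> 'c" where
  "the_lin R M N G = (THE h. h \<in> lin_maps R M N \<and> (\<forall>(x, y)\<in>G. h x = y))"

definition restrict_scalars :: "('a \<Rightarrow> 's) \<Rightarrow> ('s, 'b) module \<Rightarrow> ('a, 'b) module" where
  "restrict_scalars \<phi> N =
     \<lparr>carrier = carrier N, mult = mult N, one = one N, zero = zero N, add = add N,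
      smult = (\<lambda>a x. \<phi> a \<odot>\<^bsub>N\<^esub> x)\<rparr>"

definition end_mod :: "'a ring \<Rightarrow> ('a, 'b) module \<Rightarrow> ('a, 'b \<Rightarrow> 'b) module" where
  "end_mod R M =
     \<lparr>carrier = lin_maps R M M,
      mult = (\<lambda>X Y. compose (carrier M) X Y),
      one = (\<lambda>x\<in>carrier M. x),
      zero = (\<lambda>x\<in>carrier M. \<zero>\<^bsub>M\<^esub>),
      add = (\<lambda>X Y. \<lambda>x\<in>carrier M. X x \<oplus>\<^bsub>M\<^esub> Y x),
      smult = (\<lambda>a X. \<lambda>x\<in>carrier M. a \<odot>\<^bsub>M\<^esub> X x)\<rparr>"


section \<open>Quotient modules and modules given by generators and relations\<close>

definition quot_mod :: "('a, 'b) module \<Rightarrow> 'b set \<Rightarrow> ('a, 'b set) module" where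
  "quot_mod M N =
     \<lparr>carrier = a_rcosets\<^bsub>M\<^esub> N, mult = (\<lambda>_ _. N), one = N, zero = N, add = set_add M,
      smult = (\<lambda>a A. \<Union>x\<in>A. N +>\<^bsub>M\<^esub> (a \<odot>\<^bsub>M\<^esub> x))\<rparr>"

definition free_mod :: "'a ring \<Rightarrow> 'x set \<Rightarrow> ('a, 'x \<Rightarrow> 'a) module" where
  "free_mod R X = (ring.func_space R X)
     \<lparr>carrier := {f \<in> X \<rightarrow>\<^sub>E carrier R. finite {x \<in> X. f x \<noteq> \<zero>\<^bsub>R\<^esub>}}\<rparr>"

definition free_gen :: "'a ring \<Rightarrow> 'x set \<Rightarrow> 'x \<Rightarrow> 'x \<Rightarrow> 'a" where
  "free_gen R X x = (\<lambda>y\<in>X. if y = x then \<one>\<^bsub>R\<^esub> else \<zero>\<^bsub>R\<^esub>)"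

definition pres_mod :: "'a ring \<Rightarrow> 'x set \<Rightarrow> ('x \<Rightarrow> 'a) set \<Rightarrow> ('a, ('x \<Rightarrow> 'a) set) module" where
  "pres_mod R X Q = quot_mod (free_mod R X) (module.span R (free_mod R X) Q)"

definition pres_gen :: "'a ring \<Rightarrow> 'x set \<Rightarrow> ('x \<Rightarrow> 'a) set \<Rightarrow> 'x \<Rightarrow> ('x \<Rightarrow> 'a) set" where
  "pres_gen R X Q x = module.span R (free_mod R X) Q +>\<^bsub>free_mod R X\<^esub> free_gen R X x"


section \<open>Tensor products and extension of scalars\<close>

definition tensor_rels ::
  "'a ring \<Rightarrow> ('a, 'b) module \<Rightarrow> ('a, 'c) module \<Rightarrow> ('b \<times> 'c \<Rightarrow> 'a) set" where
  "tensor_rels R M N =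
     (let F = free_mod R (carrier M \<times> carrier N); \<delta> = free_gen R (carrier M \<times> carrier N) in
       {\<delta> (x \<oplus>\<^bsub>M\<^esub> x', y) \<ominus>\<^bsub>F\<^esub> (\<delta> (x, y) \<oplus>\<^bsub>F\<^esub> \<delta> (x', y)) | x x' y.
          x \<in> carrier M \<and> x' \<in> carrier M \<and> y \<in> carrier N} \<union>
       {\<delta> (x, y \<oplus>\<^bsub>N\<^esub> y') \<ominus>\<^bsub>F\<^esub> (\<delta> (x, y) \<oplus>\<^bsub>F\<^esub> \<delta> (x, y')) | x y y'.
          x \<in> carrier M \<and> y \<in> carrier N \<and> y' \<in> carrier N} \<union>
       {\<delta> (a \<odot>\<^bsub>M\<^esub> x, y) \<ominus>\<^bsub>F\<^esub> a \<odot>\<^bsub>F\<^esub> \<delta> (x, y) | a x y.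
          a \<in> carrier R \<and> x \<in> carrier M \<and> y \<in> carrier N} \<union>
       {\<delta> (x, a \<odot>\<^bsub>N\<^esub> y) \<ominus>\<^bsub>F\<^esub> a \<odot>\<^bsub>F\<^esub> \<delta> (x, y) | a x y.
          a \<in> carrier R \<and> x \<in> carrier M \<and> y \<in> carrier N})"

definition tensor_mod ::
  "'a ring \<Rightarrow> ('a, 'b) module \<Rightarrow> ('a, 'c) module \<Rightarrow> ('a, ('b \<times> 'c \<Rightarrow> 'a) set) module" where
  "tensor_mod R M N = pres_mod R (carrier M \<times> carrier N) (tensor_rels R M N)"

definition tensor_elt ::
  "'a ring \<Rightarrow> ('a, 'b) module \<Rightarrow> ('a, 'c) module \<Rightarrow> 'b \<Rightarrow> 'c \<Rightarrow> ('b \<times> 'c \<Rightarrow> 'a) set" where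
  "tensor_elt R M N x y = pres_gen R (carrier M \<times> carrier N) (tensor_rels R M N) (x, y)"

definition words :: "('a, 'b) module \<Rightarrow> nat \<Rightarrow> 'b list set" where
  "words M n = {xs. length xs = n \<and> set xs \<subseteq> carrier M}"

definition power_rels :: "'a ring \<Rightarrow> nat \<Rightarrow> ('a, 'b) module \<Rightarrow> ('b list \<Rightarrow> 'a) set" where
  "power_rels R n M =
     (let F = free_mod R (words M n); \<delta> = free_gen R (words M n) in
       {\<delta> (xs[i := x \<oplus>\<^bsub>M\<^esub> y]) \<ominus>\<^bsub>F\<^esub> (\<delta> (xs[i := x]) \<oplus>\<^bsub>F\<^esub> \<delta> (xs[i := y])) | xs i x y.
          xs \<in> words M n \<and> i < n \<and> x \<in> carrier M \<and> y \<in> carrier M} \<union>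
       {\<delta> (xs[i := a \<odot>\<^bsub>M\<^esub> x]) \<ominus>\<^bsub>F\<^esub> a \<odot>\<^bsub>F\<^esub> \<delta> (xs[i := x]) | xs i a x.
          xs \<in> words M n \<and> i < n \<and> a \<in> carrier R \<and> x \<in> carrier M})"

definition tensor_power ::
  "'a ring \<Rightarrow> nat \<Rightarrow> ('a, 'b) module \<Rightarrow> ('a, ('b list \<Rightarrow> 'a) set) module" where
  "tensor_power R n M = pres_mod R (words M n) (power_rels R n M)"

definition pure_tensor ::
  "'a ring \<Rightarrow> nat \<Rightarrow> ('a, 'b) module \<Rightarrow> 'b list \<Rightarrow> ('b list \<Rightarrow> 'a) set" where
  "pure_tensor R n M xs = pres_gen R (words M n) (power_rels R n M) xs"

text \<open>
  \<open>R \<otimes>\<^sub>k M\<close> for a commutative \<open>k\<close>-algebra \<open>\<phi> : k \<rightarrow> R\<close>: the \<open>R\<close>-module generated by the symbols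
  \<open>1 \<otimes> x\<close>, subject to additivity in \<open>x\<close> and \<open>1 \<otimes> c x = \<phi> c (1 \<otimes> x)\<close> for \<open>c \<in> k\<close>.
\<close>

definition ext_scalars_rels ::
  "'a ring \<Rightarrow> 't ring \<Rightarrow> ('a \<Rightarrow> 't) \<Rightarrow> ('a, 'b) module \<Rightarrow> ('b \<Rightarrow> 't) set" where
  "ext_scalars_rels k R \<phi> M =
     (let F = free_mod R (carrier M); \<delta> = free_gen R (carrier M) in
       {\<delta> (x \<oplus>\<^bsub>M\<^esub> y) \<ominus>\<^bsub>F\<^esub> (\<delta> x \<oplus>\<^bsub>F\<^esub> \<delta> y) | x y. x \<in> carrier M \<and> y \<in> carrier M} \<union>
       {\<delta> (c \<odot>\<^bsub>M\<^esub> x) \<ominus>\<^bsub>F\<^esub> \<phi> c \<odot>\<^bsub>F\<^esub> \<delta> x | c x. c \<in> carrier k \<and> x \<in> carrier M})"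

definition ext_scalars ::
  "'a ring \<Rightarrow> 't ring \<Rightarrow> ('a \<Rightarrow> 't) \<Rightarrow> ('a, 'b) module \<Rightarrow> ('t, ('b \<Rightarrow> 't) set) module" where
  "ext_scalars k R \<phi> M = pres_mod R (carrier M) (ext_scalars_rels k R \<phi> M)"

definition ext_scalars_elt ::
  "'a ring \<Rightarrow> 't ring \<Rightarrow> ('a \<Rightarrow> 't) \<Rightarrow> ('a, 'b) module \<Rightarrow> 'b \<Rightarrow> ('b \<Rightarrow> 't) set" where
  "ext_scalars_elt k R \<phi> M x = pres_gen R (carrier M) (ext_scalars_rels k R \<phi> M) x"


section \<open>Exterior and symmetric powers\<close>

definition ext_kernel :: "'a ring \<Rightarrow> nat \<Rightarrow> ('a, 'b) module \<Rightarrow> ('b list \<Rightarrow> 'a) set set" where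
  "ext_kernel R n M = module.span R (tensor_power R n M)
     {pure_tensor R n M xs | xs. xs \<in> words M n \<and> \<not> distinct xs}"

definition ext_power ::
  "'a ring \<Rightarrow> nat \<Rightarrow> ('a, 'b) module \<Rightarrow> ('a, ('b list \<Rightarrow> 'a) set set) module" where
  "ext_power R n M = quot_mod (tensor_power R n M) (ext_kernel R n M)"

definition wedge ::
  "'a ring \<Rightarrow> nat \<Rightarrow> ('a, 'b) module \<Rightarrow> 'b list \<Rightarrow> ('b list \<Rightarrow> 'a) set set" where
  "wedge R n M xs = ext_kernel R n M +>\<^bsub>tensor_power R n M\<^esub> pure_tensor R n M xs"

text \<open>
  The coinvariants of the symmetric group on the tensor power.  As pure tensors generate it, the
  differences \<open>\<sigma> t - t\<close> for pure \<open>t\<close> span the same submodule as those for all \<open>t\<close>.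
\<close>

definition sym_kernel :: "'a ring \<Rightarrow> nat \<Rightarrow> ('a, 'b) module \<Rightarrow> ('b list \<Rightarrow> 'a) set set" where
  "sym_kernel R n M = module.span R (tensor_power R n M)
     {pure_tensor R n M (permute_list \<sigma> xs) \<ominus>\<^bsub>tensor_power R n M\<^esub> pure_tensor R n M xs | \<sigma> xs.
        xs \<in> words M n \<and> \<sigma> permutes {..<n}}"

definition sym_power ::
  "'a ring \<Rightarrow> nat \<Rightarrow> ('a, 'b) module \<Rightarrow> ('a, ('b list \<Rightarrow> 'a) set set) module" where
  "sym_power R n M = quot_mod (tensor_power R n M) (sym_kernel R n M)"

definition sym_prod ::
  "'a ring \<Rightarrow> nat \<Rightarrow> ('a, 'b) module \<Rightarrow> 'b list \<Rightarrow> ('b list \<Rightarrow> 'a) set set" where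
  "sym_prod R n M xs = sym_kernel R n M +>\<^bsub>tensor_power R n M\<^esub> pure_tensor R n M xs"

text \<open>
  Functoriality, for maps \<open>h : M \<rightarrow> N\<close> that are semilinear over \<open>\<phi> : R \<rightarrow> S\<close>.  Both the
  \<open>R\<close>-linear case (\<open>S = R\<close>, \<open>\<phi> = id\<close>) and the maps \<open>M \<rightarrow> R \<otimes>\<^sub>k M\<close> are needed.
\<close>

definition tensor_map ::
  "'a ring \<Rightarrow> 's ring \<Rightarrow> ('a \<Rightarrow> 's) \<Rightarrow> ('a, 'b) module \<Rightarrow> ('a, 'c) module \<Rightarrow>
   ('s, 'b1) module \<Rightarrow> ('s, 'c1) module \<Rightarrow> ('b \<Rightarrow> 'b1) \<Rightarrow> ('c \<Rightarrow> 'c1) \<Rightarrow>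
   ('b \<times> 'c \<Rightarrow> 'a) set \<Rightarrow> ('b1 \<times> 'c1 \<Rightarrow> 's) set" where
  "tensor_map R S \<phi> M N M' N' h h' =
     the_lin R (tensor_mod R M N) (restrict_scalars \<phi> (tensor_mod S M' N'))
       {(tensor_elt R M N x y, tensor_elt S M' N' (h x) (h' y)) | x y.
          x \<in> carrier M \<and> y \<in> carrier N}"

definition ext_power_map ::
  "'a ring \<Rightarrow> 's ring \<Rightarrow> ('a \<Rightarrow> 's) \<Rightarrow> nat \<Rightarrow> ('a, 'b) module \<Rightarrow> ('s, 'c) module \<Rightarrow> ('b \<Rightarrow> 'c) \<Rightarrow>
   ('b list \<Rightarrow> 'a) set set \<Rightarrow> ('c list \<Rightarrow> 's) set set" where
  "ext_power_map R S \<phi> n M N h =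
     the_lin R (ext_power R n M) (restrict_scalars \<phi> (ext_power S n N))
       {(wedge R n M xs, wedge S n N (map h xs)) | xs. xs \<in> words M n}"

definition sym_power_map ::
  "'a ring \<Rightarrow> 's ring \<Rightarrow> ('a \<Rightarrow> 's) \<Rightarrow> nat \<Rightarrow> ('a, 'b) module \<Rightarrow> ('s, 'c) module \<Rightarrow> ('b \<Rightarrow> 'c) \<Rightarrow>
   ('b list \<Rightarrow> 'a) set set \<Rightarrow> ('c list \<Rightarrow> 's) set set" where
  "sym_power_map R S \<phi> n M N h =
     the_lin R (sym_power R n M) (restrict_scalars \<phi> (sym_power S n N))
       {(sym_prod R n M xs, sym_prod S n N (map h xs)) | xs. xs \<in> words M n}"


section \<open>Representations of the group scheme \<open>GL(V)\<close>\<close>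

text \<open>
  \<open>GL(V)(R)\<close> is the group of automorphisms of the \<open>R\<close>-module \<open>R \<otimes>\<^sub>k V\<close>.
\<close>

definition GL_points :: "'t ring \<Rightarrow> ('t, 'w) module \<Rightarrow> ('w \<Rightarrow> 'w) set" where
  "GL_points R W = {g \<in> lin_maps R W W. bij_betw g (carrier W) (carrier W)}"

text \<open>
  A representation of the group scheme \<open>GL(V)\<close> on a \<open>k\<close>-module \<open>M\<close> is an \<open>R\<close>-linear action of
  \<open>GL(V)(R)\<close> on \<open>R \<otimes>\<^sub>k M\<close> for each commutative \<open>k\<close>-algebra \<open>\<phi> : k \<rightarrow> R\<close>, natural in \<open>R\<close>.  The record
  holds \<open>M\<close> and, for each \<open>(R, \<phi>)\<close>, an \<open>R\<close>-module \<open>rep_ext R \<phi>\<close> that is a copy of \<open>R \<otimes>\<^sub>k M\<close> by way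
  of the map \<open>rep_can R \<phi>\<close> from \<open>M\<close> (which plays the role of \<open>x \<mapsto> 1 \<otimes> x\<close>), and the action on it.
  This lets \<open>R \<otimes>\<^sub>k Sym\<^sup>d(M)\<close> be taken to be \<open>Sym\<^sup>d\<close> over \<open>R\<close> of \<open>R \<otimes>\<^sub>k M\<close>, and likewise for
  exterior powers, tensor products and (as \<open>V\<close> is finite-dimensional) endomorphisms.
\<close>

record ('a, 't, 'w, 'b, 'c) gl_rep =
  rep_mod :: "('a, 'b) module"
  rep_ext :: "'t ring \<Rightarrow> ('a \<Rightarrow> 't) \<Rightarrow> ('t, 'c) module"
  rep_can :: "'t ring \<Rightarrow> ('a \<Rightarrow> 't) \<Rightarrow> 'b \<Rightarrow> 'c"
  rep_act :: "'t ring \<Rightarrow> ('a \<Rightarrow> 't) \<Rightarrow> ('w \<Rightarrow> 'w) \<Rightarrow> 'c \<Rightarrow> 'c"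

definition std_rep ::
  "'a ring \<Rightarrow> ('a, 'v) module \<Rightarrow> ('a, 't, ('v \<Rightarrow> 't) set, 'v, ('v \<Rightarrow> 't) set) gl_rep" where
  "std_rep k V =
     \<lparr>rep_mod = V,
      rep_ext = (\<lambda>R \<phi>. ext_scalars k R \<phi> V),
      rep_can = (\<lambda>R \<phi>. ext_scalars_elt k R \<phi> V),
      rep_act = (\<lambda>R \<phi> g. g)\<rparr>"

definition ext_rep ::
  "'a ring \<Rightarrow> nat \<Rightarrow> ('a, 't, 'w, 'b, 'c) gl_rep \<Rightarrow>
   ('a, 't, 'w, ('b list \<Rightarrow> 'a) set set, ('c list \<Rightarrow> 't) set set) gl_rep" where
  "ext_rep k n \<rho> =
     \<lparr>rep_mod = ext_power k n (rep_mod \<rho>),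
      rep_ext = (\<lambda>R \<phi>. ext_power R n (rep_ext \<rho> R \<phi>)),
      rep_can = (\<lambda>R \<phi>. ext_power_map k R \<phi> n (rep_mod \<rho>) (rep_ext \<rho> R \<phi>) (rep_can \<rho> R \<phi>)),
      rep_act = (\<lambda>R \<phi> g. ext_power_map R R id n (rep_ext \<rho> R \<phi>) (rep_ext \<rho> R \<phi>) (rep_act \<rho> R \<phi> g))\<rparr>"

definition sym_rep ::
  "'a ring \<Rightarrow> nat \<Rightarrow> ('a, 't, 'w, 'b, 'c) gl_rep \<Rightarrow>
   ('a, 't, 'w, ('b list \<Rightarrow> 'a) set set, ('c list \<Rightarrow> 't) set set) gl_rep" where
  "sym_rep k n \<rho> =
     \<lparr>rep_mod = sym_power k n (rep_mod \<rho>),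
      rep_ext = (\<lambda>R \<phi>. sym_power R n (rep_ext \<rho> R \<phi>)),
      rep_can = (\<lambda>R \<phi>. sym_power_map k R \<phi> n (rep_mod \<rho>) (rep_ext \<rho> R \<phi>) (rep_can \<rho> R \<phi>)),
      rep_act = (\<lambda>R \<phi> g. sym_power_map R R id n (rep_ext \<rho> R \<phi>) (rep_ext \<rho> R \<phi>) (rep_act \<rho> R \<phi> g))\<rparr>"

definition tensor_rep ::
  "'a ring \<Rightarrow> ('a, 't, 'w, 'b, 'c) gl_rep \<Rightarrow> ('a, 't, 'w, 'b1, 'c1) gl_rep \<Rightarrow>
   ('a, 't, 'w, ('b \<times> 'b1 \<Rightarrow> 'a) set, ('c \<times> 'c1 \<Rightarrow> 't) set) gl_rep" where
  "tensor_rep k \<rho> \<sigma> =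
     \<lparr>rep_mod = tensor_mod k (rep_mod \<rho>) (rep_mod \<sigma>),
      rep_ext = (\<lambda>R \<phi>. tensor_mod R (rep_ext \<rho> R \<phi>) (rep_ext \<sigma> R \<phi>)),
      rep_can = (\<lambda>R \<phi>. tensor_map k R \<phi> (rep_mod \<rho>) (rep_mod \<sigma>)
        (rep_ext \<rho> R \<phi>) (rep_ext \<sigma> R \<phi>) (rep_can \<rho> R \<phi>) (rep_can \<sigma> R \<phi>)),
      rep_act = (\<lambda>R \<phi> g. tensor_map R R id (rep_ext \<rho> R \<phi>) (rep_ext \<sigma> R \<phi>)
        (rep_ext \<rho> R \<phi>) (rep_ext \<sigma> R \<phi>) (rep_act \<rho> R \<phi> g) (rep_act \<sigma> R \<phi> g))\<rparr>"

text \<open>The action on endomorphisms is \<open>X \<mapsto> g X g\<^sup>-\<^sup>1\<close>.\<close>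

definition end_rep ::
  "'a ring \<Rightarrow> ('a, 't, 'w, 'b, 'c) gl_rep \<Rightarrow> ('a, 't, 'w, 'b \<Rightarrow> 'b, 'c \<Rightarrow> 'c) gl_rep" where
  "end_rep k \<rho> =
     \<lparr>rep_mod = end_mod k (rep_mod \<rho>),
      rep_ext = (\<lambda>R \<phi>. end_mod R (rep_ext \<rho> R \<phi>)),
      rep_can = (\<lambda>R \<phi> X. the_lin R (rep_ext \<rho> R \<phi>) (rep_ext \<rho> R \<phi>)
        {(rep_can \<rho> R \<phi> x, rep_can \<rho> R \<phi> (X x)) | x. x \<in> carrier (rep_mod \<rho>)}),
      rep_act = (\<lambda>R \<phi> g X. \<lambda>y\<in>carrier (rep_ext \<rho> R \<phi>).
        rep_act \<rho> R \<phi> g (X (inv_into (carrier (rep_ext \<rho> R \<phi>)) (rep_act \<rho> R \<phi> g) y)))\<rparr>"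

definition det_rep ::
  "'a ring \<Rightarrow> ('a, 'v) module \<Rightarrow>
   ('a, 't, ('v \<Rightarrow> 't) set, ('v list \<Rightarrow> 'a) set set, (('v \<Rightarrow> 't) set list \<Rightarrow> 't) set set) gl_rep" where
  "det_rep k V = ext_rep k (vectorspace.dim k V) (std_rep k V)"

text \<open>
  HOL cannot quantify over all commutative \<open>k\<close>-algebras at once, so they are taken with carrier in a
  fixed type.  A quotient of the polynomial ring over \<open>k\<close> in variables indexed by \<open>nat\<close> has elements
  that are sets of functions from monomials to \<open>k\<close>, so every countably generated commutative
  \<open>k\<close>-algebra has an isomorphic copy here.  In particular so does \<open>k[GL(V)]\<close>, and equivariance
  at the universal point of \<open>GL(V)(k[GL(V)])\<close> is compatibility with the \<open>k[GL(V)]\<close>-comodule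
  structures and implies equivariance over every commutative \<open>k\<close>-algebra.
\<close>

type_synonym 'a test_alg = "(nat multiset \<Rightarrow> 'a) set"

text \<open>
  In the definition below, \<open>F\<close> is the base change of \<open>f\<close> to \<open>R\<close>; it is determined by \<open>f\<close> because the
  image of \<open>rep_can \<rho> R \<phi>\<close> generates \<open>rep_ext \<rho> R \<phi>\<close>.
\<close>

definition Hom_GL ::
  "'a ring \<Rightarrow> ('a, 'v) module \<Rightarrow>
   ('a, 'a test_alg, ('v \<Rightarrow> 'a test_alg) set, 'b, 'c) gl_rep \<Rightarrow>
   ('a, 'a test_alg, ('v \<Rightarrow> 'a test_alg) set, 'b1, 'c1) gl_rep \<Rightarrow> ('b \<Rightarrow> 'b1) set" where
  "Hom_GL k V \<rho> \<sigma> =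
     {f \<in> lin_maps k (rep_mod \<rho>) (rep_mod \<sigma>).
        \<forall>R \<phi>. cring R \<and> \<phi> \<in> ring_hom k R \<longrightarrow>
          (\<exists>F \<in> lin_maps R (rep_ext \<rho> R \<phi>) (rep_ext \<sigma> R \<phi>).
             (\<forall>x \<in> carrier (rep_mod \<rho>). F (rep_can \<rho> R \<phi> x) = rep_can \<sigma> R \<phi> (f x)) \<and>
             (\<forall>g \<in> GL_points R (ext_scalars k R \<phi> V). \<forall>y \<in> carrier (rep_ext \<rho> R \<phi>).
                F (rep_act \<rho> R \<phi> g y) = rep_act \<sigma> R \<phi> g (F y)))}"

end

theory Submission
  imports Defs "HOL-Algebra.Weak_Morphisms"
begin

text \<open>
  Equivariance under \<open>k\<close>-points suffices; these become points over a test algebra by transporting the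
  ring structure of \<open>k\<close>.  Let \<open>e\<^sub>1, \<dots>, e\<^sub>n\<close> be a basis of \<open>V\<close> and \<open>\<omega> = e\<^sub>1 \<and> \<dots> \<and> e\<^sub>n\<close>, so that each
  element of \<open>End(V) \<otimes> det(V)\<close> is \<open>X \<otimes> \<omega>\<close> for exactly one \<open>X\<close>.  Let \<open>f\<close> be equivariant, let
  \<open>y = e\<^sub>I\<^sub>1 \<cdots> e\<^sub>I\<^sub>d\<close> be a product of wedges of basis vectors, and write \<open>f(y) = X \<otimes> \<omega>\<close>.

  All diagonal entries of \<open>X\<close> vanish.  If \<open>e\<^sub>b\<close> does not occur in \<open>y\<close>, the reflection \<open>e\<^sub>b \<mapsto> -e\<^sub>b\<close> fixes
  \<open>y\<close> and the diagonal of \<open>X\<close> but negates \<open>\<omega>\<close>.  Otherwise the blocks \<open>I\<^sub>j\<close> partition the basis, and since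
  \<open>d \<ge> 3\<close> there are two blocks not containing a given index \<open>a\<close>; exchanging them fixes \<open>y\<close> and
  \<open>X\<^sub>a\<^sub>a\<close>, but is a product of \<open>r\<close> transpositions and so multiplies \<open>\<omega>\<close> by \<open>(-1)\<^sup>r = -1\<close>.
  Hence \<open>f\<close> takes values with zero diagonal.  Conjugation by the transvection \<open>e\<^sub>a \<mapsto> e\<^sub>a + e\<^sub>b\<close> turns
  the diagonal entry \<open>X\<^sub>b\<^sub>b\<close> into \<open>X\<^sub>b\<^sub>b + X\<^sub>a\<^sub>b\<close>, so the other entries vanish too.
\<close>


section \<open>Linear maps and generators\<close>

text \<open>Reflections, transpositions and the transvection with coefficient one exist over every
  commutative ring, so even the field with three elements has enough points. Torus weights are
  avoided: the points of a small field do not separate characters. The obstacle is the type of test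
  algebras. \<open>Hom_GL\<close> gives actions on \<open>rep_ext\<close> over rings with elements
  in \<open>'a test_alg\<close>, not on \<open>rep_mod\<close> over \<open>k\<close>. The core
  argument is therefore stated for a module with a finite basis over an arbitrary commutative ring
  (\<open>based_module\<close>) and applied to the base change of V; the result descends because
  coordinates of base-changed elements are images under an injective map. All modules are quotients
  and all functorial maps are \<open>THE\<close> linear maps, so everything is reached through
  universal properties and generators. Apart from the basis of V, independence is needed only for
  the line det(V), where the Leibniz determinant supplies a functional with value one on \<omega>.
  No basis of \<open>Sym\<close> or of the exterior power is chosen: indices in a monomial may be
  repeated and unordered.\<close>

lemma mod_hom_lin_maps:
  assumes "module R M" "module R N" "h \<in> lin_maps R M N"
  shows "mod_hom R M N h"
  using assms unfolding mod_hom_def mod_hom_axioms_def lin_maps_def by auto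

lemma lin_mapsI:
  assumes "\<And>x. x \<in> carrier M \<Longrightarrow> h x \<in> carrier N"
    and "\<And>x y. x \<in> carrier M \<Longrightarrow> y \<in> carrier M \<Longrightarrow> h (x \<oplus>\<^bsub>M\<^esub> y) = h x \<oplus>\<^bsub>N\<^esub> h y"
    and "\<And>a x. a \<in> carrier R \<Longrightarrow> x \<in> carrier M \<Longrightarrow> h (a \<odot>\<^bsub>M\<^esub> x) = a \<odot>\<^bsub>N\<^esub> h x"
    and "h \<in> extensional (carrier M)"
  shows "h \<in> lin_maps R M N"
  using assms unfolding lin_maps_def module_hom_def by auto

lemma restrict_lin_mapsI:
  assumes "module R M"
    and "\<And>x. x \<in> carrier M \<Longrightarrow> h x \<in> carrier N"
    and "\<And>x y. x \<in> carrier M \<Longrightarrow> y \<in> carrier M \<Longrightarrow> h (x \<oplus>\<^bsub>M\<^esub> y) = h x \<oplus>\<^bsub>N\<^esub> h y"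
    and "\<And>a x. a \<in> carrier R \<Longrightarrow> x \<in> carrier M \<Longrightarrow> h (a \<odot>\<^bsub>M\<^esub> x) = a \<odot>\<^bsub>N\<^esub> h x"
  shows "restrict h (carrier M) \<in> lin_maps R M N"
proof -
  interpret module R M by fact
  show ?thesis by (rule lin_mapsI) (use assms in auto)
qed

lemma lin_maps_closed: "h \<in> lin_maps R M N \<Longrightarrow> x \<in> carrier M \<Longrightarrow> h x \<in> carrier N"
  unfolding lin_maps_def module_hom_def by auto

lemma lin_maps_add:
  "h \<in> lin_maps R M N \<Longrightarrow> x \<in> carrier M \<Longrightarrow> y \<in> carrier M \<Longrightarrow> h (x \<oplus>\<^bsub>M\<^esub> y) = h x \<oplus>\<^bsub>N\<^esub> h y"
  unfolding lin_maps_def module_hom_def by auto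

lemma lin_maps_smult:
  "h \<in> lin_maps R M N \<Longrightarrow> a \<in> carrier R \<Longrightarrow> x \<in> carrier M \<Longrightarrow> h (a \<odot>\<^bsub>M\<^esub> x) = a \<odot>\<^bsub>N\<^esub> h x"
  unfolding lin_maps_def module_hom_def by auto

lemma lin_maps_zero:
  assumes "module R M" "module R N" "h \<in> lin_maps R M N"
  shows "h \<zero>\<^bsub>M\<^esub> = \<zero>\<^bsub>N\<^esub>"
  using mod_hom.f0_is_0[OF mod_hom_lin_maps[OF assms]] .

lemma lin_maps_minus:
  assumes "module R M" "module R N" "h \<in> lin_maps R M N" "x \<in> carrier M" "y \<in> carrier M"
  shows "h (x \<ominus>\<^bsub>M\<^esub> y) = h x \<ominus>\<^bsub>N\<^esub> h y"
  using mod_hom.f_minus[OF mod_hom_lin_maps[OF assms(1-3)] assms(4,5)] .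

lemma lin_maps_eqI:
  assumes "h \<in> lin_maps R M N" "h' \<in> lin_maps R M N'" "\<And>x. x \<in> carrier M \<Longrightarrow> h x = h' x"
  shows "h = h'"
  using assms unfolding lin_maps_def by (auto intro: extensionalityI)

lemma lin_maps_compose:
  assumes "module R L" "g \<in> lin_maps R L M" "h \<in> lin_maps R M N"
  shows "compose (carrier L) h g \<in> lin_maps R L N"
proof -
  interpret module R L by fact
  show ?thesis
    by (rule lin_mapsI)
      (auto simp: compose_eq lin_maps_closed[OF assms(2)] lin_maps_closed[OF assms(3)]
        lin_maps_add[OF assms(2)] lin_maps_add[OF assms(3)]
        lin_maps_smult[OF assms(2)] lin_maps_smult[OF assms(3)])
qed

lemma zero_lin_maps:
  assumes "module R M" "module R N"
  shows "(\<lambda>x\<in>carrier M. \<zero>\<^bsub>N\<^esub>) \<in> lin_maps R M N"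
proof -
  interpret N: module R N by fact
  show ?thesis by (rule restrict_lin_mapsI[OF assms(1)]) auto
qed

lemma (in module) minus_eq_zero_iff:
  assumes "x \<in> carrier M" "y \<in> carrier M"
  shows "x \<ominus>\<^bsub>M\<^esub> y = \<zero>\<^bsub>M\<^esub> \<longleftrightarrow> x = y"
proof
  assume "x \<ominus>\<^bsub>M\<^esub> y = \<zero>\<^bsub>M\<^esub>"
  then have "(x \<oplus>\<^bsub>M\<^esub> \<ominus>\<^bsub>M\<^esub> y) \<oplus>\<^bsub>M\<^esub> y = \<zero>\<^bsub>M\<^esub> \<oplus>\<^bsub>M\<^esub> y" by (simp add: a_minus_def)
  then show "x = y" using assms by (simp add: M.a_assoc M.l_neg)
qed (use assms in \<open>simp add: a_minus_def M.r_neg\<close>)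

text \<open>Minimality among submodules replaces linear combinations. It makes structural induction
  immediate and treats infinite generating sets, such as all pure tensors, like finite ones.\<close>

definition generates :: "'a ring \<Rightarrow> ('a, 'b) module \<Rightarrow> 'b set \<Rightarrow> bool" where
  "generates R M S \<longleftrightarrow> S \<subseteq> carrier M \<and>
     (\<forall>N. LinearCombinations.submodule R N M \<longrightarrow> S \<subseteq> N \<longrightarrow> carrier M \<subseteq> N)"

lemma generates_sub: "generates R M S \<Longrightarrow> S \<subseteq> carrier M"
  by (simp add: generates_def)

text \<open>The elements of the carrier with property \<open>P\<close> form a submodule containing
  \<open>S\<close>.\<close>

lemma generates_induct [consumes 3, case_names zero add smult gen]:
  assumes "module R M" "generates R M S" "x \<in> carrier M"
    and "P \<zero>\<^bsub>M\<^esub>"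
    and "\<And>x y. x \<in> carrier M \<Longrightarrow> y \<in> carrier M \<Longrightarrow> P x \<Longrightarrow> P y \<Longrightarrow> P (x \<oplus>\<^bsub>M\<^esub> y)"
    and "\<And>a x. a \<in> carrier R \<Longrightarrow> x \<in> carrier M \<Longrightarrow> P x \<Longrightarrow> P (a \<odot>\<^bsub>M\<^esub> x)"
    and "\<And>x. x \<in> S \<Longrightarrow> P x"
  shows "P x"
proof -
  interpret module R M by fact
  have "LinearCombinations.submodule R {x \<in> carrier M. P x} M"
    using assms by unfold_locales auto
  moreover have "S \<subseteq> {x \<in> carrier M. P x}"
    using assms(7) generates_sub[OF assms(2)] by auto
  ultimately show ?thesis
    using assms(2,3) unfolding generates_def by blast
qed

lemma generatesI:
  assumes "module R M" "S \<subseteq> carrier M"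
    and "\<And>N. \<lbrakk>N \<subseteq> carrier M; \<zero>\<^bsub>M\<^esub> \<in> N; \<And>x y. x \<in> N \<Longrightarrow> y \<in> N \<Longrightarrow> x \<oplus>\<^bsub>M\<^esub> y \<in> N;
      \<And>a x. a \<in> carrier R \<Longrightarrow> x \<in> N \<Longrightarrow> a \<odot>\<^bsub>M\<^esub> x \<in> N; S \<subseteq> N\<rbrakk> \<Longrightarrow> carrier M \<subseteq> N"
  shows "generates R M S"
  unfolding generates_def
proof (intro conjI allI impI)
  fix N assume N: "LinearCombinations.submodule R N M" "S \<subseteq> N"
  then interpret LinearCombinations.submodule R N M by simp
  show "carrier M \<subseteq> N" using assms(3)[of N] subset N(2) by auto
qed (use assms in auto)

lemma lin_maps_eq_on_generators:
  assumes "module R M" "module R N" "generates R M S"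
    and "h \<in> lin_maps R M N" "h' \<in> lin_maps R M N" "\<And>x. x \<in> S \<Longrightarrow> h x = h' x"
  shows "h = h'"
proof (rule lin_maps_eqI[OF assms(4,5)])
  fix x assume "x \<in> carrier M"
  with assms(1,3) show "h x = h' x"
    by (induct rule: generates_induct)
      (use assms in \<open>auto simp: lin_maps_add lin_maps_smult lin_maps_zero\<close>)
qed

text \<open>The only access to the description operator in \<open>the_lin\<close>: \<open>h\<close>
  provides existence, generation provides uniqueness. Every functorial map is identified with a lift
  from a universal property in this way.\<close>

lemma the_lin_eq:
  assumes "module R M" "module R N" "h \<in> lin_maps R M N" "\<And>x y. (x, y) \<in> G \<Longrightarrow> h x = y"
    and "generates R M (fst ` G)"
  shows "the_lin R M N G = h"
  unfolding the_lin_def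
proof (rule the_equality)
  fix h' assume h': "h' \<in> lin_maps R M N \<and> (\<forall>(x, y)\<in>G. h' x = y)"
  show "h' = h"
    by (rule lin_maps_eq_on_generators[OF assms(1,2,5)]) (use h' assms(3,4) in auto)
qed (use assms(3,4) in auto)

lemma generates_image:
  assumes "module R M" "module R N" "p \<in> lin_maps R M N" "p ` carrier M = carrier N"
    and "generates R M S"
  shows "generates R N (p ` S)"
proof (rule generatesI[OF assms(2)])
  show "p ` S \<subseteq> carrier N" using generates_sub[OF assms(5)] assms(4) by auto
next
  fix K
  assume K: "K \<subseteq> carrier N" "\<zero>\<^bsub>N\<^esub> \<in> K" "\<And>x y. x \<in> K \<Longrightarrow> y \<in> K \<Longrightarrow> x \<oplus>\<^bsub>N\<^esub> y \<in> K"
    "\<And>a x. a \<in> carrier R \<Longrightarrow> x \<in> K \<Longrightarrow> a \<odot>\<^bsub>N\<^esub> x \<in> K" "p ` S \<subseteq> K"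
  have "p x \<in> K" if "x \<in> carrier M" for x
    using assms(1,5) that
    by (induct rule: generates_induct)
      (use K lin_maps_zero[OF assms(1-3)] in
        \<open>auto simp: lin_maps_add[OF assms(3)] lin_maps_smult[OF assms(3)]\<close>)
  then show "carrier N \<subseteq> K" unfolding assms(4)[symmetric] by auto
qed

lemma generates_trans:
  assumes "module R M" "generates R M S" "T \<subseteq> carrier M"
    and "\<And>N. \<lbrakk>LinearCombinations.submodule R N M; T \<subseteq> N\<rbrakk> \<Longrightarrow> S \<subseteq> N"
  shows "generates R M T"
  using assms unfolding generates_def by blast


section \<open>Free modules\<close>

lemma free_mod_simps:
  assumes "ring R"
  shows "carrier (free_mod R X) = {f \<in> X \<rightarrow>\<^sub>E carrier R. finite {x \<in> X. f x \<noteq> \<zero>\<^bsub>R\<^esub>}}"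
    "\<zero>\<^bsub>free_mod R X\<^esub> = (\<lambda>x\<in>X. \<zero>\<^bsub>R\<^esub>)"
    "f \<oplus>\<^bsub>free_mod R X\<^esub> g = (\<lambda>x\<in>X. f x \<oplus>\<^bsub>R\<^esub> g x)"
    "a \<odot>\<^bsub>free_mod R X\<^esub> f = (\<lambda>x\<in>X. a \<otimes>\<^bsub>R\<^esub> f x)"
  using assms by (simp_all add: free_mod_def ring.func_space_def)

lemma free_mod_module:
  assumes "cring R"
  shows "module R (free_mod R X)"
proof -
  interpret cring R by fact
  interpret F: module R "func_space X" by (rule func_space_is_module)
  have fin: "finite {x \<in> X. (f x \<oplus>\<^bsub>R\<^esub> g x) \<noteq> \<zero>\<^bsub>R\<^esub>}"
    if "finite {x \<in> X. f x \<noteq> \<zero>\<^bsub>R\<^esub>}" "finite {x \<in> X. g x \<noteq> \<zero>\<^bsub>R\<^esub>}" for f g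
    by (rule finite_subset[of _ "{x \<in> X. f x \<noteq> \<zero>\<^bsub>R\<^esub>} \<union> {x \<in> X. g x \<noteq> \<zero>\<^bsub>R\<^esub>}"]) (use that in auto)
  have fin2: "finite {x \<in> X. a \<otimes>\<^bsub>R\<^esub> f x \<noteq> \<zero>\<^bsub>R\<^esub>}"
    if "finite {x \<in> X. f x \<noteq> \<zero>\<^bsub>R\<^esub>}" "a \<in> carrier R" for f a
    by (rule finite_subset[of _ "{x \<in> X. f x \<noteq> \<zero>\<^bsub>R\<^esub>}"]) (use that in auto)
  have "LinearCombinations.submodule R (carrier (free_mod R X)) (func_space X)"
    by unfold_locales
      (auto simp: free_mod_def func_space_def fin fin2 PiE_mem simp del: neq0_conv cong: conj_cong)
  then show ?thesis
    using F.submodule_is_module unfolding free_mod_def by simp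
qed

lemma free_gen_closed:
  assumes "ring R" "x \<in> X"
  shows "free_gen R X x \<in> carrier (free_mod R X)"
proof -
  interpret ring R by fact
  have "finite {y \<in> X. free_gen R X x y \<noteq> \<zero>\<^bsub>R\<^esub>}"
    by (rule finite_subset[of _ "{x}"]) (auto simp: free_gen_def)
  then show ?thesis by (auto simp: free_mod_simps[OF assms(1)] free_gen_def)
qed

lemma free_gen_generates:
  assumes "cring R"
  shows "generates R (free_mod R X) (free_gen R X ` X)"
proof (rule generatesI[OF free_mod_module[OF assms]])
  interpret cring R by fact
  let ?F = "free_mod R X"
  interpret F: module R ?F by (rule free_mod_module[OF assms])
  note S = free_mod_simps[OF ring_axioms]
  show "free_gen R X ` X \<subseteq> carrier ?F" by (auto intro: free_gen_closed ring_axioms)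
  fix N
  assume N: "N \<subseteq> carrier ?F" "\<zero>\<^bsub>?F\<^esub> \<in> N" "\<And>x y. x \<in> N \<Longrightarrow> y \<in> N \<Longrightarrow> x \<oplus>\<^bsub>?F\<^esub> y \<in> N"
    "\<And>a x. a \<in> carrier R \<Longrightarrow> x \<in> N \<Longrightarrow> a \<odot>\<^bsub>?F\<^esub> x \<in> N" "free_gen R X ` X \<subseteq> N"
  have "f \<in> N" if "finite A" "A \<subseteq> X" "f \<in> X \<rightarrow>\<^sub>E carrier R" "{x \<in> X. f x \<noteq> \<zero>\<^bsub>R\<^esub>} \<subseteq> A" for A f
    using that
  proof (induct A arbitrary: f)
    case empty
    then have "f = (\<lambda>x\<in>X. \<zero>\<^bsub>R\<^esub>)" by (auto simp: PiE_def extensional_def fun_eq_iff)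
    then show ?case using N(2) unfolding S by (simp only:)
  next
    case (insert a A)
    \<comment> \<open>Clearing the coordinate at \<open>a\<close> leaves a function supported in
      \<open>A\<close>; what was cleared is a multiple of one generator.\<close>
    let ?g = "\<lambda>x\<in>X. if x = a then \<zero>\<^bsub>R\<^esub> else f x"
    have "?g \<in> N" by (rule insert(3)) (use insert in \<open>auto split: if_splits\<close>)
    moreover have "f a \<odot>\<^bsub>?F\<^esub> free_gen R X a \<in> N"
      using insert(4,5) N(5) by (intro N(4)) (auto simp: PiE_mem)
    moreover have "f = ?g \<oplus>\<^bsub>?F\<^esub> f a \<odot>\<^bsub>?F\<^esub> free_gen R X a"
    proof (rule extensionalityI[of _ X])
      fix x assume x: "x \<in> X"
      have c: "f x \<in> carrier R" "f a \<in> carrier R" "a \<in> X" using insert x by (auto simp: PiE_mem)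
      show "f x = (?g \<oplus>\<^bsub>?F\<^esub> f a \<odot>\<^bsub>?F\<^esub> free_gen R X a) x"
        unfolding S free_gen_def using c x by simp
    qed (use insert in \<open>auto simp: S PiE_def\<close>)
    ultimately show ?case using N(3) by metis
  qed
  then show "carrier ?F \<subseteq> N" by (auto simp: S)
qed

lemma free_mod_lift:
  assumes "module R N" "v \<in> X \<rightarrow> carrier N"
  shows "\<exists>h \<in> lin_maps R (free_mod R X) N. \<forall>x \<in> X. h (free_gen R X x) = v x"
proof -
  interpret N: module R N by fact
  let ?F = "free_mod R X"
  interpret F: module R ?F by (rule free_mod_module[OF N.R.cring_axioms])
  note S = free_mod_simps[OF N.R.ring_axioms]
  define h where "h f = (\<Oplus>\<^bsub>N\<^esub>x\<in>{x \<in> X. f x \<noteq> \<zero>\<^bsub>R\<^esub>}. f x \<odot>\<^bsub>N\<^esub> v x)" for f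
  have vc: "x \<in> X \<Longrightarrow> v x \<in> carrier N" for x using assms(2) by auto
  \<comment> \<open>The sum may be taken over any finite set containing the support. This lets
    \<open>f\<close>, \<open>g\<close> and their sum be compared over one index set although their
    supports differ.\<close>
  have h_eq: "h f = (\<Oplus>\<^bsub>N\<^esub>x\<in>A. f x \<odot>\<^bsub>N\<^esub> v x)"
    if "finite A" "A \<subseteq> X" "{x \<in> X. f x \<noteq> \<zero>\<^bsub>R\<^esub>} \<subseteq> A" "f \<in> X \<rightarrow> carrier R" for f A
    unfolding h_def
    by (rule N.add.finprod_mono_neutral_cong_left) (use that vc in \<open>auto simp: Pi_def\<close>)
  have "restrict h (carrier ?F) \<in> lin_maps R ?F N"
  proof (rule restrict_lin_mapsI[OF F.module_axioms])
    fix f assume "f \<in> carrier ?F"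
    then show "h f \<in> carrier N" unfolding h_def S
      by (intro N.M.finsum_closed) (auto intro!: vc simp: PiE_mem)
  next
    fix f g assume fg: "f \<in> carrier ?F" "g \<in> carrier ?F"
    let ?A = "{x \<in> X. f x \<noteq> \<zero>\<^bsub>R\<^esub>} \<union> {x \<in> X. g x \<noteq> \<zero>\<^bsub>R\<^esub>}"
    have A: "finite ?A" "?A \<subseteq> X" using fg by (auto simp: S)
    have fgc: "f \<in> X \<rightarrow> carrier R" "g \<in> X \<rightarrow> carrier R" using fg by (auto simp: S)
    have "h (f \<oplus>\<^bsub>?F\<^esub> g) = (\<Oplus>\<^bsub>N\<^esub>x\<in>?A. (f \<oplus>\<^bsub>?F\<^esub> g) x \<odot>\<^bsub>N\<^esub> v x)"
    proof (rule h_eq[OF A])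
      show "{x \<in> X. (f \<oplus>\<^bsub>?F\<^esub> g) x \<noteq> \<zero>\<^bsub>R\<^esub>} \<subseteq> ?A" unfolding S by (rule subsetI) force
      show "f \<oplus>\<^bsub>?F\<^esub> g \<in> X \<rightarrow> carrier R" unfolding S using fgc by (auto simp: Pi_iff)
    qed
    also have "\<dots> = (\<Oplus>\<^bsub>N\<^esub>x\<in>?A. f x \<odot>\<^bsub>N\<^esub> v x \<oplus>\<^bsub>N\<^esub> g x \<odot>\<^bsub>N\<^esub> v x)"
      by (rule N.M.finsum_cong'[OF refl]) (use fgc vc in \<open>auto simp: S N.smult_l_distr Pi_iff\<close>)
    also have "\<dots> = (\<Oplus>\<^bsub>N\<^esub>x\<in>?A. f x \<odot>\<^bsub>N\<^esub> v x) \<oplus>\<^bsub>N\<^esub> (\<Oplus>\<^bsub>N\<^esub>x\<in>?A. g x \<odot>\<^bsub>N\<^esub> v x)"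
      by (rule N.M.finsum_addf) (use fgc vc in \<open>auto simp: Pi_def\<close>)
    also have "\<dots> = h f \<oplus>\<^bsub>N\<^esub> h g"
      using h_eq[OF A _ fgc(1)] h_eq[OF A _ fgc(2)] by auto
    finally show "h (f \<oplus>\<^bsub>?F\<^esub> g) = h f \<oplus>\<^bsub>N\<^esub> h g" .
  next
    fix a f assume f: "a \<in> carrier R" "f \<in> carrier ?F"
    let ?A = "{x \<in> X. f x \<noteq> \<zero>\<^bsub>R\<^esub>}"
    have A: "finite ?A" "?A \<subseteq> X" using f by (auto simp: S)
    have fc: "f \<in> X \<rightarrow> carrier R" using f by (auto simp: S)
    have "h (a \<odot>\<^bsub>?F\<^esub> f) = (\<Oplus>\<^bsub>N\<^esub>x\<in>?A. (a \<odot>\<^bsub>?F\<^esub> f) x \<odot>\<^bsub>N\<^esub> v x)"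
    proof (rule h_eq[OF A])
      show "{x \<in> X. (a \<odot>\<^bsub>?F\<^esub> f) x \<noteq> \<zero>\<^bsub>R\<^esub>} \<subseteq> ?A" unfolding S by (rule subsetI) (use f(1) in force)
      show "a \<odot>\<^bsub>?F\<^esub> f \<in> X \<rightarrow> carrier R" unfolding S using f(1) fc by (auto simp: Pi_iff)
    qed
    also have "\<dots> = (\<Oplus>\<^bsub>N\<^esub>x\<in>?A. a \<odot>\<^bsub>N\<^esub> (f x \<odot>\<^bsub>N\<^esub> v x))"
      by (rule N.M.finsum_cong'[OF refl]) (use f(1) fc vc in \<open>auto simp: S N.smult_assoc1 Pi_iff\<close>)
    also have "\<dots> = a \<odot>\<^bsub>N\<^esub> h f"
      unfolding h_def
      by (rule N.finsum_smult_ldistr[symmetric]) (use f A fc vc in \<open>auto simp: Pi_def\<close>)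
    finally show "h (a \<odot>\<^bsub>?F\<^esub> f) = a \<odot>\<^bsub>N\<^esub> h f" .
  qed
  moreover have "h (free_gen R X x) = v x" if "x \<in> X" for x
  proof -
    have "h (free_gen R X x) = (\<Oplus>\<^bsub>N\<^esub>y\<in>{x}. free_gen R X x y \<odot>\<^bsub>N\<^esub> v y)"
      by (rule h_eq) (use that in \<open>auto simp: free_gen_def\<close>)
    then show ?thesis using that vc by (simp add: free_gen_def)
  qed
  ultimately show ?thesis
    by (intro bexI[of _ "restrict h (carrier ?F)"])
      (simp_all add: free_gen_closed[OF N.R.ring_axioms])
qed


section \<open>Quotient modules\<close>

lemma quot_mod_simps:
  "carrier (quot_mod M N) = (\<lambda>x. N +>\<^bsub>M\<^esub> x) ` carrier M"
  "\<zero>\<^bsub>quot_mod M N\<^esub> = N" "add (quot_mod M N) = set_add M"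
  "a \<odot>\<^bsub>quot_mod M N\<^esub> A = (\<Union>x\<in>A. N +>\<^bsub>M\<^esub> (a \<odot>\<^bsub>M\<^esub> x))"
  by (auto simp: quot_mod_def A_RCOSETS_def')

context
  fixes R :: "'a ring" and M :: "('a, 'b) module" and N
  assumes N: "LinearCombinations.submodule R N M"
begin

interpretation N: LinearCombinations.submodule R N M by (rule N)
interpretation M: module R M by (rule N.module)

lemma submodule_abelian_subgroup: "abelian_subgroup N M"
proof -
  have "\<ominus>\<^bsub>M\<^esub> x \<in> N" if "x \<in> N" for x
  proof -
    \<comment> \<open>Closure under negation is closure under the scalar minus one.\<close>
    have "\<ominus>\<^bsub>M\<^esub> x = (\<ominus>\<^bsub>R\<^esub> \<one>\<^bsub>R\<^esub>) \<odot>\<^bsub>M\<^esub> x" using that N.subset by (auto simp: M.smult_minus_1)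
    then show ?thesis using that by auto
  qed
  then have "additive_subgroup N M"
    by (intro additive_subgroupI subgroup.intro) (use N.subset in \<open>auto simp: a_inv_def\<close>)
  then show ?thesis by (intro abelian_subgroupI3) (auto intro: M.abelian_group_axioms)
qed

interpretation A: abelian_subgroup N M by (rule submodule_abelian_subgroup)

lemma coset_eq_iff:
  assumes "x \<in> carrier M" "y \<in> carrier M"
  shows "N +>\<^bsub>M\<^esub> x = N +>\<^bsub>M\<^esub> y \<longleftrightarrow> x \<ominus>\<^bsub>M\<^esub> y \<in> N"
proof -
  have "N +>\<^bsub>M\<^esub> x = N +>\<^bsub>M\<^esub> y \<longleftrightarrow> x \<in> N +>\<^bsub>M\<^esub> y"
    using assms A.a_repr_independence'[of x y] A.a_rcos_self[of x] by auto
  then show ?thesis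
    using A.a_rcos_module[OF assms(2,1)] by (simp add: a_minus_def)
qed

lemma quot_add:
  assumes "x \<in> carrier M" "y \<in> carrier M"
  shows "(N +>\<^bsub>M\<^esub> x) \<oplus>\<^bsub>quot_mod M N\<^esub> (N +>\<^bsub>M\<^esub> y) = N +>\<^bsub>M\<^esub> (x \<oplus>\<^bsub>M\<^esub> y)"
  using A.a_rcos_sum[OF assms] by (simp add: quot_mod_simps)

lemma quot_smult:
  assumes "a \<in> carrier R" "x \<in> carrier M"
  shows "a \<odot>\<^bsub>quot_mod M N\<^esub> (N +>\<^bsub>M\<^esub> x) = N +>\<^bsub>M\<^esub> (a \<odot>\<^bsub>M\<^esub> x)"
proof -
  \<comment> \<open>All representatives of a coset give the same image coset, so the union that
    defines scalar multiplication on the quotient runs over a constant family.\<close>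
  have *: "N +>\<^bsub>M\<^esub> (a \<odot>\<^bsub>M\<^esub> y) = N +>\<^bsub>M\<^esub> (a \<odot>\<^bsub>M\<^esub> x)" if y: "y \<in> N +>\<^bsub>M\<^esub> x" for y
  proof -
    have yc: "y \<in> carrier M" using y assms A.a_elemrcos_carrier by blast
    have "a \<odot>\<^bsub>M\<^esub> (y \<ominus>\<^bsub>M\<^esub> x) \<in> N"
      using A.a_rcos_module[OF assms(2) yc] y assms(1)
      by (simp add: a_minus_def)
    then show ?thesis
      using yc assms
      by (subst coset_eq_iff) (auto simp: a_minus_def M.smult_r_distr M.smult_r_minus)
  qed
  have "x \<in> N +>\<^bsub>M\<^esub> x" using A.a_rcos_self assms by blast
  then show ?thesis
    unfolding quot_mod_simps by (rule UN_constant_eq) (use * in blast)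
qed

lemma quot_zero: "\<zero>\<^bsub>quot_mod M N\<^esub> = N +>\<^bsub>M\<^esub> \<zero>\<^bsub>M\<^esub>"
  using N.subset by (simp add: quot_mod_simps)

lemma quot_mod_module: "module R (quot_mod M N)"
proof -
  have neg: "\<exists>w\<in>carrier (quot_mod M N). v \<oplus>\<^bsub>quot_mod M N\<^esub> w = \<zero>\<^bsub>quot_mod M N\<^esub>"
    if v: "v \<in> carrier (quot_mod M N)" for v
  proof -
    obtain x where x: "x \<in> carrier M" "v = N +>\<^bsub>M\<^esub> x" using v by (auto simp: quot_mod_simps(1))
    then show ?thesis
      by (intro bexI[of _ "N +>\<^bsub>M\<^esub> (\<ominus>\<^bsub>M\<^esub> x)"]) (auto simp: quot_add quot_zero M.r_neg quot_mod_simps(1))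
  qed
  note C = quot_mod_simps(1)
  show ?thesis
    apply (rule module_criteria)
    apply (rule M.cring_axioms)
    using neg
    apply (auto simp: C quot_add quot_zero quot_smult M.a_ac M.smult_assoc1 M.smult_l_distr
        M.smult_r_distr)
    done
qed

lemma quot_proj_lin: "(\<lambda>x\<in>carrier M. N +>\<^bsub>M\<^esub> x) \<in> lin_maps R M (quot_mod M N)"
  by (rule restrict_lin_mapsI[OF M.module_axioms]) (auto simp: quot_mod_simps(1) quot_add quot_smult)

lemma quot_eq_zero: "x \<in> N \<Longrightarrow> N +>\<^bsub>M\<^esub> x = \<zero>\<^bsub>quot_mod M N\<^esub>"
  using N.subset by (subst quot_zero, subst coset_eq_iff) (auto simp: a_minus_def)

lemma quot_generates:
  assumes "generates R M S"
  shows "generates R (quot_mod M N) ((\<lambda>x. N +>\<^bsub>M\<^esub> x) ` S)"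
proof -
  have "generates R (quot_mod M N) ((\<lambda>x\<in>carrier M. N +>\<^bsub>M\<^esub> x) ` S)"
    by (rule generates_image[OF M.module_axioms quot_mod_module quot_proj_lin _ assms])
      (auto simp: quot_mod_simps(1))
  also have "(\<lambda>x\<in>carrier M. N +>\<^bsub>M\<^esub> x) ` S = (\<lambda>x. N +>\<^bsub>M\<^esub> x) ` S"
    using generates_sub[OF assms] by (intro image_cong) auto
  finally show ?thesis .
qed

lemma quot_lift:
  assumes "module R P" "h \<in> lin_maps R M P" "\<And>x. x \<in> N \<Longrightarrow> h x = \<zero>\<^bsub>P\<^esub>"
  shows "\<exists>h' \<in> lin_maps R (quot_mod M N) P. \<forall>x \<in> carrier M. h' (N +>\<^bsub>M\<^esub> x) = h x"
proof -
  interpret P: module R P by fact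
  interpret Q: module R "quot_mod M N" by (rule quot_mod_module)
  \<comment> \<open>An arbitrary representative is chosen; two of them differ by an element of
    \<open>N\<close>, which \<open>h\<close> kills.\<close>
  define h' where "h' A = h (SOME x. x \<in> carrier M \<and> A = N +>\<^bsub>M\<^esub> x)" for A
  have h': "h' (N +>\<^bsub>M\<^esub> x) = h x" if x: "x \<in> carrier M" for x
  proof -
    let ?y = "SOME y. y \<in> carrier M \<and> N +>\<^bsub>M\<^esub> x = N +>\<^bsub>M\<^esub> y"
    have y: "?y \<in> carrier M \<and> N +>\<^bsub>M\<^esub> x = N +>\<^bsub>M\<^esub> ?y"
      by (rule someI[of _ x]) (use x in auto)
    then have "h (x \<ominus>\<^bsub>M\<^esub> ?y) = \<zero>\<^bsub>P\<^esub>" using coset_eq_iff[of x ?y] x assms(3) by auto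
    then have "h x \<ominus>\<^bsub>P\<^esub> h ?y = \<zero>\<^bsub>P\<^esub>"
      using lin_maps_minus[OF M.module_axioms assms(1,2)] x y by auto
    then have "h x = h ?y"
      using P.minus_eq_zero_iff[of "h x" "h ?y"] x y lin_maps_closed[OF assms(2)] by simp
    then show ?thesis unfolding h'_def by simp
  qed
  have "restrict h' (carrier (quot_mod M N)) \<in> lin_maps R (quot_mod M N) P"
    by (rule restrict_lin_mapsI[OF quot_mod_module])
      (auto simp: quot_mod_simps(1) h' quot_add quot_smult lin_maps_closed[OF assms(2)]
        lin_maps_add[OF assms(2)] lin_maps_smult[OF assms(2)])
  moreover have "\<forall>x \<in> carrier M. restrict h' (carrier (quot_mod M N)) (N +>\<^bsub>M\<^esub> x) = h x"
    using h' by (auto simp: quot_mod_simps(1))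
  ultimately show ?thesis by blast
qed

end

section \<open>Modules given by generators and relations\<close>

context
  fixes R :: "'a ring" and X :: "'x set" and Q
  assumes R: "cring R" and Q: "Q \<subseteq> carrier (free_mod R X)"
begin

interpretation F: module R "free_mod R X" by (rule free_mod_module[OF R])

lemma pres_submodule:
  "LinearCombinations.submodule R (module.span R (free_mod R X) Q) (free_mod R X)"
  by (rule F.span_is_submodule[OF Q])

lemma pres_mod_module: "module R (pres_mod R X Q)"
  unfolding pres_mod_def by (rule quot_mod_module[OF pres_submodule])

lemma pres_gen_generates: "generates R (pres_mod R X Q) (pres_gen R X Q ` X)"
proof -
  have "pres_gen R X Q ` X = (\<lambda>f. module.span R (free_mod R X) Q +>\<^bsub>free_mod R X\<^esub> f) ` free_gen R X ` X"
    by (simp add: pres_gen_def image_image)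
  then show ?thesis
    using quot_generates[OF pres_submodule free_gen_generates[OF R]] by (simp add: pres_mod_def)
qed

lemma pres_proj:
  "\<exists>p \<in> lin_maps R (free_mod R X) (pres_mod R X Q).
     (\<forall>x \<in> X. p (free_gen R X x) = pres_gen R X Q x) \<and> (\<forall>q \<in> Q. p q = \<zero>\<^bsub>pres_mod R X Q\<^esub>)"
proof (intro bexI conjI ballI)
  let ?S = "module.span R (free_mod R X) Q"
  let ?p = "\<lambda>f\<in>carrier (free_mod R X). ?S +>\<^bsub>free_mod R X\<^esub> f"
  show "?p \<in> lin_maps R (free_mod R X) (pres_mod R X Q)"
    unfolding pres_mod_def by (rule quot_proj_lin[OF pres_submodule])
  show "?p (free_gen R X x) = pres_gen R X Q x" if "x \<in> X" for x
    using free_gen_closed[OF F.R.ring_axioms that] by (simp add: pres_gen_def)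
  show "?p q = \<zero>\<^bsub>pres_mod R X Q\<^esub>" if "q \<in> Q" for q
    using that Q quot_eq_zero[OF pres_submodule, of q] F.in_own_span[OF Q]
    by (auto simp: pres_mod_def)
qed

text \<open>The relations are tested against every linear \<open>L\<close> with values
  \<open>v\<close> on the free generators. There is just one such \<open>L\<close>, but quantifying
  over it spares the callers from naming it: they only use linearity and the values on
  generators.\<close>

lemma pres_mod_lift:
  assumes "module R N" "v \<in> X \<rightarrow> carrier N"
    and "\<And>L q. L \<in> lin_maps R (free_mod R X) N \<Longrightarrow> (\<And>x. x \<in> X \<Longrightarrow> L (free_gen R X x) = v x) \<Longrightarrow>
      q \<in> Q \<Longrightarrow> L q = \<zero>\<^bsub>N\<^esub>"
  shows "\<exists>h \<in> lin_maps R (pres_mod R X Q) N. \<forall>x \<in> X. h (pres_gen R X Q x) = v x"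
proof -
  interpret N: module R N by fact
  obtain L where L: "L \<in> lin_maps R (free_mod R X) N" "\<And>x. x \<in> X \<Longrightarrow> L (free_gen R X x) = v x"
    using free_mod_lift[OF assms(1,2)] by blast
  interpret L: mod_hom R "free_mod R X" N L
    by (rule mod_hom_lin_maps[OF F.module_axioms assms(1) L(1)])
  have "Q \<subseteq> L.ker" using assms(3)[OF L] Q by (auto simp: L.ker_def)
  then have "module.span R (free_mod R X) Q \<subseteq> L.ker"
    by (rule F.span_is_subset[OF _ L.ker_is_submodule])
  then have "\<And>f. f \<in> module.span R (free_mod R X) Q \<Longrightarrow> L f = \<zero>\<^bsub>N\<^esub>" by (auto simp: L.ker_def)
  from quot_lift[OF pres_submodule assms(1) L(1) this]
  obtain h where h: "h \<in> lin_maps R (pres_mod R X Q) N"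
    "\<forall>f\<in>carrier (free_mod R X). h (module.span R (free_mod R X) Q +>\<^bsub>free_mod R X\<^esub> f) = L f"
    unfolding pres_mod_def by blast
  have "h (pres_gen R X Q x) = v x" if "x \<in> X" for x
    unfolding pres_gen_def
    using h(2)[rule_format, OF free_gen_closed[OF F.R.ring_axioms that]] L(2)[OF that] by (rule trans)
  then show ?thesis using h(1) by blast
qed

end


section \<open>Tensor powers\<close>

definition multilinear ::
  "'a ring \<Rightarrow> nat \<Rightarrow> ('a, 'b) module \<Rightarrow> ('a, 'c) module \<Rightarrow> ('b list \<Rightarrow> 'c) \<Rightarrow> bool" where
  "multilinear R n M N v \<longleftrightarrow> v \<in> words M n \<rightarrow> carrier N \<and>
    (\<forall>xs \<in> words M n. \<forall>i<n. \<forall>x \<in> carrier M. \<forall>y \<in> carrier M.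
       v (xs[i := x \<oplus>\<^bsub>M\<^esub> y]) = v (xs[i := x]) \<oplus>\<^bsub>N\<^esub> v (xs[i := y])) \<and>
    (\<forall>xs \<in> words M n. \<forall>i<n. \<forall>a \<in> carrier R. \<forall>x \<in> carrier M.
       v (xs[i := a \<odot>\<^bsub>M\<^esub> x]) = a \<odot>\<^bsub>N\<^esub> v (xs[i := x]))"

lemma multilinearI:
  assumes "\<And>xs. xs \<in> words M n \<Longrightarrow> v xs \<in> carrier N"
    and "\<And>xs i x y. xs \<in> words M n \<Longrightarrow> i < n \<Longrightarrow> x \<in> carrier M \<Longrightarrow> y \<in> carrier M \<Longrightarrow>
      v (xs[i := x \<oplus>\<^bsub>M\<^esub> y]) = v (xs[i := x]) \<oplus>\<^bsub>N\<^esub> v (xs[i := y])"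
    and "\<And>xs i a x. xs \<in> words M n \<Longrightarrow> i < n \<Longrightarrow> a \<in> carrier R \<Longrightarrow> x \<in> carrier M \<Longrightarrow>
      v (xs[i := a \<odot>\<^bsub>M\<^esub> x]) = a \<odot>\<^bsub>N\<^esub> v (xs[i := x])"
  shows "multilinear R n M N v"
  using assms unfolding multilinear_def by auto

lemma multilinear_closed: "multilinear R n M N v \<Longrightarrow> xs \<in> words M n \<Longrightarrow> v xs \<in> carrier N"
  unfolding multilinear_def by auto

lemma multilinear_add:
  "multilinear R n M N v \<Longrightarrow> xs \<in> words M n \<Longrightarrow> i < n \<Longrightarrow> x \<in> carrier M \<Longrightarrow> y \<in> carrier M \<Longrightarrow>
    v (xs[i := x \<oplus>\<^bsub>M\<^esub> y]) = v (xs[i := x]) \<oplus>\<^bsub>N\<^esub> v (xs[i := y])"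
  unfolding multilinear_def by blast

lemma multilinear_smult:
  "multilinear R n M N v \<Longrightarrow> xs \<in> words M n \<Longrightarrow> i < n \<Longrightarrow> a \<in> carrier R \<Longrightarrow> x \<in> carrier M \<Longrightarrow>
    v (xs[i := a \<odot>\<^bsub>M\<^esub> x]) = a \<odot>\<^bsub>N\<^esub> v (xs[i := x])"
  unfolding multilinear_def by blast

lemma words_update: "xs \<in> words M n \<Longrightarrow> x \<in> carrier M \<Longrightarrow> xs[i := x] \<in> words M n"
  using set_update_subset_insert[of xs i x] by (auto simp: words_def)

lemma words_nth: "xs \<in> words M n \<Longrightarrow> i < n \<Longrightarrow> xs ! i \<in> carrier M"
  by (auto simp: words_def)

lemma words_map: "xs \<in> words M n \<Longrightarrow> (\<And>x. x \<in> carrier M \<Longrightarrow> h x \<in> carrier N) \<Longrightarrow> map h xs \<in> words N n"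
  by (auto simp: words_def)

lemma multilinear_zero:
  assumes "module R M" "module R N" "multilinear R n M N v" "xs \<in> words M n" "i < n"
  shows "v (xs[i := \<zero>\<^bsub>M\<^esub>]) = \<zero>\<^bsub>N\<^esub>"
proof -
  interpret M: module R M by fact
  interpret N: module R N by fact
  have "v (xs[i := \<zero>\<^bsub>R\<^esub> \<odot>\<^bsub>M\<^esub> \<zero>\<^bsub>M\<^esub>]) = \<zero>\<^bsub>R\<^esub> \<odot>\<^bsub>N\<^esub> v (xs[i := \<zero>\<^bsub>M\<^esub>])"
    using assms(4,5) by (intro multilinear_smult[OF assms(3)]) auto
  then show ?thesis
    using N.smult_l_null[OF multilinear_closed[OF assms(3) words_update[OF assms(4) M.zero_closed]]]
    by simp
qed

lemma multilinear_compose: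
  assumes "multilinear R n M N v" "h \<in> lin_maps R N P"
  shows "multilinear R n M P (\<lambda>xs. h (v xs))"
  by (rule multilinearI)
    (simp_all add: multilinear_closed[OF assms(1)] multilinear_add[OF assms(1)] words_update
      multilinear_smult[OF assms(1)] lin_maps_closed[OF assms(2)] lin_maps_add[OF assms(2)]
      lin_maps_smult[OF assms(2)])

lemma (in module) minus_add_eq_zero_iff:
  assumes "x \<in> carrier M" "y \<in> carrier M" "z \<in> carrier M"
  shows "x \<ominus>\<^bsub>M\<^esub> (y \<oplus>\<^bsub>M\<^esub> z) = \<zero>\<^bsub>M\<^esub> \<longleftrightarrow> x = y \<oplus>\<^bsub>M\<^esub> z"
  using assms by (intro minus_eq_zero_iff) auto

context
  fixes R :: "'a ring" and M :: "('a, 'b) module" and n :: nat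
  assumes M: "module R M"
begin

interpretation M: module R M by (rule M)
interpretation F: module R "free_mod R (words M n)" by (rule free_mod_module[OF M.cring_axioms])

lemma power_rels_closed: "power_rels R n M \<subseteq> carrier (free_mod R (words M n))"
  unfolding power_rels_def Let_def
  by (auto intro!: F.M.minus_closed F.M.add.m_closed F.smult_closed
      free_gen_closed[OF M.R.ring_axioms] words_update)

lemma tensor_power_module: "module R (tensor_power R n M)"
  unfolding tensor_power_def by (rule pres_mod_module[OF M.cring_axioms power_rels_closed])

interpretation T: module R "tensor_power R n M" by (rule tensor_power_module)

lemma pure_tensor_generates: "generates R (tensor_power R n M) (pure_tensor R n M ` words M n)"
  unfolding tensor_power_def pure_tensor_def
  by (rule pres_gen_generates[OF M.cring_axioms power_rels_closed])

text \<open>Each relation is the difference of the two sides of one multilinearity identity, and the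
  projection \<open>p\<close> from the free module sends it to zero. The same pattern serves for
  \<open>tensor_elt_bilinear\<close> and \<open>ext_scalars_elt_semilinear\<close>.\<close>

lemma pure_tensor_multilinear: "multilinear R n M (tensor_power R n M) (pure_tensor R n M)"
proof -
  let ?F = "free_mod R (words M n)" and ?T = "tensor_power R n M"
  let ?d = "free_gen R (words M n)"
  obtain p where p: "p \<in> lin_maps R ?F ?T"
    "\<And>xs. xs \<in> words M n \<Longrightarrow> p (?d xs) = pure_tensor R n M xs"
    "\<And>q. q \<in> power_rels R n M \<Longrightarrow> p q = \<zero>\<^bsub>?T\<^esub>"
    using pres_proj[OF M.cring_axioms power_rels_closed]
    unfolding tensor_power_def pure_tensor_def by blast
  note pm = lin_maps_minus[OF F.module_axioms T.module_axioms p(1)]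
  note d = free_gen_closed[OF M.R.ring_axioms]
  have cl: "pure_tensor R n M xs \<in> carrier ?T" if "xs \<in> words M n" for xs
    using generates_sub[OF pure_tensor_generates] that by auto
  show ?thesis
  proof (rule multilinearI)
    fix xs i x y assume A: "xs \<in> words M n" "i < n" "x \<in> carrier M" "y \<in> carrier M"
    note w = words_update[OF A(1)]
    have "p (?d (xs[i := x \<oplus>\<^bsub>M\<^esub> y]) \<ominus>\<^bsub>?F\<^esub> (?d (xs[i := x]) \<oplus>\<^bsub>?F\<^esub> ?d (xs[i := y]))) = \<zero>\<^bsub>?T\<^esub>"
      by (rule p(3)) (use A in \<open>auto simp: power_rels_def Let_def\<close>)
    then show "pure_tensor R n M (xs[i := x \<oplus>\<^bsub>M\<^esub> y]) =
        pure_tensor R n M (xs[i := x]) \<oplus>\<^bsub>?T\<^esub> pure_tensor R n M (xs[i := y])"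
      using A by (subst (asm) pm) (auto simp: w d lin_maps_add[OF p(1)] p(2) T.minus_add_eq_zero_iff cl)
  next
    fix xs i a x assume A: "xs \<in> words M n" "i < n" "a \<in> carrier R" "x \<in> carrier M"
    note w = words_update[OF A(1)]
    have "p (?d (xs[i := a \<odot>\<^bsub>M\<^esub> x]) \<ominus>\<^bsub>?F\<^esub> a \<odot>\<^bsub>?F\<^esub> ?d (xs[i := x])) = \<zero>\<^bsub>?T\<^esub>"
      by (rule p(3)) (use A in \<open>unfold power_rels_def Let_def, blast\<close>)
    then show "pure_tensor R n M (xs[i := a \<odot>\<^bsub>M\<^esub> x]) = a \<odot>\<^bsub>?T\<^esub> pure_tensor R n M (xs[i := x])"
      using A by (subst (asm) pm) (auto simp: w d lin_maps_smult[OF p(1)] p(2) T.minus_eq_zero_iff cl)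
  qed (rule cl)
qed

lemma tensor_power_lift:
  assumes "module R N" "multilinear R n M N v"
  shows "\<exists>h \<in> lin_maps R (tensor_power R n M) N. \<forall>xs \<in> words M n. h (pure_tensor R n M xs) = v xs"
  unfolding tensor_power_def pure_tensor_def
proof (rule pres_mod_lift[OF M.cring_axioms power_rels_closed assms(1)])
  interpret N: module R N by fact
  show "v \<in> words M n \<rightarrow> carrier N" using multilinear_closed[OF assms(2)] by auto
  fix L q
  assume L: "L \<in> lin_maps R (free_mod R (words M n)) N"
    "\<And>xs. xs \<in> words M n \<Longrightarrow> L (free_gen R (words M n) xs) = v xs" and q: "q \<in> power_rels R n M"
  note Lm = lin_maps_minus[OF F.module_axioms assms(1) L(1)]
  note d = free_gen_closed[OF M.R.ring_axioms]
  note vc = multilinear_closed[OF assms(2)]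
  from q show "L q = \<zero>\<^bsub>N\<^esub>"
    unfolding power_rels_def Let_def
    by (elim UnE CollectE exE conjE)
      (simp_all add: Lm d words_update lin_maps_add[OF L(1)] lin_maps_smult[OF L(1)] L(2) vc
        multilinear_add[OF assms(2)] multilinear_smult[OF assms(2)] N.minus_eq_zero_iff)
qed

text \<open>Arbitrary entries are traded for generators one slot at a time, by induction over the
  module in that slot. Stated for any multilinear \<open>v\<close> whose values generate, it applies
  to wedges and to symmetric products alike.\<close>

lemma multilinear_generates:
  assumes T: "module R T" and v: "multilinear R n M T v" and g: "generates R T (v ` words M n)"
    and S: "generates R M S"
  shows "generates R T (v ` {xs. length xs = n \<and> set xs \<subseteq> S})"
proof (rule generates_trans[OF T g])
  interpret U: module R T by fact
  have SW: "{xs. length xs = n \<and> set xs \<subseteq> S} \<subseteq> words M n"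
    using generates_sub[OF S] by (auto simp: words_def)
  then show "v ` {xs. length xs = n \<and> set xs \<subseteq> S} \<subseteq> carrier T"
    using multilinear_closed[OF v] by auto
  fix N assume N: "LinearCombinations.submodule R N T" "v ` {xs. length xs = n \<and> set xs \<subseteq> S} \<subseteq> N"
  interpret N: LinearCombinations.submodule R N T by (rule N(1))
  \<comment> \<open>The first \<open>i\<close> entries are arbitrary and those from position
    \<open>i\<close> on lie in \<open>S\<close>. For \<open>i = n\<close> nothing is required, which
    is the claim for all words.\<close>
  have "v xs \<in> N" if "i \<le> n" "xs \<in> words M n" "\<And>j. i \<le> j \<Longrightarrow> j < n \<Longrightarrow> xs ! j \<in> S" for i xs
    using that
  proof (induct i arbitrary: xs)
    case 0
    then have "xs \<in> {xs. length xs = n \<and> set xs \<subseteq> S}" by (auto simp: words_def in_set_conv_nth)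
    then show ?case using N(2) by auto
  next
    case (Suc i)
    have "v (xs[i := x]) \<in> N" if "x \<in> carrier M" for x
      using M S that
    proof (induct rule: generates_induct)
      case zero
      show ?case using Suc.prems by (simp add: multilinear_zero[OF M T v])
    next
      case (add x y)
      then show ?case using Suc.prems by (simp add: multilinear_add[OF v])
    next
      case (smult a x)
      then show ?case using Suc.prems by (simp add: multilinear_smult[OF v])
    next
      case (gen x)
      show ?case
      proof (rule Suc.hyps)
        have xM: "x \<in> carrier M" using gen generates_sub[OF S] by auto
        show "xs[i := x] \<in> words M n" by (rule words_update[OF Suc.prems(2) xM])
        show "xs[i := x] ! j \<in> S" if "i \<le> j" "j < n" for j
          using that gen Suc.prems by (cases "i = j") (auto simp: words_def)
      qed (use Suc.prems in auto)
    qed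
    from this[of "xs ! i"] show ?case using Suc.prems words_nth by fastforce
  qed
  from this[of n] show "v ` words M n \<subseteq> N" by auto
qed

end

section \<open>Exterior powers\<close>

definition alternating :: "nat \<Rightarrow> ('a, 'b) module \<Rightarrow> ('a, 'c) module \<Rightarrow> ('b list \<Rightarrow> 'c) \<Rightarrow> bool" where
  "alternating n M N v \<longleftrightarrow> (\<forall>xs \<in> words M n. \<not> distinct xs \<longrightarrow> v xs = \<zero>\<^bsub>N\<^esub>)"

text \<open>Polarization: with the sum of the two entries in both places the value is zero, and of
  the four terms of its expansion the two with equal entries vanish.\<close>

lemma alternating_swap:
  assumes "module R M" "module R N" "multilinear R n M N v" "alternating n M N v"
    and xs: "xs \<in> words M n" and ij: "i < n" "j < n" "i \<noteq> j"
  shows "v (xs[i := xs ! j, j := xs ! i]) = \<ominus>\<^bsub>N\<^esub> v xs"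
proof -
  interpret M: module R M by fact
  interpret N: module R N by fact
  let ?a = "xs ! i" and ?b = "xs ! j"
  have c: "?a \<in> carrier M" "?b \<in> carrier M" using words_nth[OF xs] ij by auto
  have len: "length xs = n" using xs by (simp add: words_def)
  have w: "xs[i := x, j := y] \<in> words M n" if "x \<in> carrier M" "y \<in> carrier M" for x y
    using words_update xs that by metis
  have vc: "v (xs[i := x, j := y]) \<in> carrier N" if "x \<in> carrier M" "y \<in> carrier M" for x y
    using multilinear_closed[OF assms(3) w[OF that]] .
  have nd: "v (xs[i := x, j := x]) = \<zero>\<^bsub>N\<^esub>" if x: "x \<in> carrier M" for x
  proof -
    have "xs[i := x, j := x] ! i = xs[i := x, j := x] ! j" using ij len by simp
    then have "\<not> distinct (xs[i := x, j := x])"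
      using nth_eq_iff_index_eq[of "xs[i := x, j := x]" i j] ij len by auto
    then show ?thesis using assms(4) w[OF x x] unfolding alternating_def by blast
  qed
  have add1: "v (xs[i := x \<oplus>\<^bsub>M\<^esub> x', j := y]) = v (xs[i := x, j := y]) \<oplus>\<^bsub>N\<^esub> v (xs[i := x', j := y])"
    if "x \<in> carrier M" "x' \<in> carrier M" "y \<in> carrier M" for x x' y
    using multilinear_add[OF assms(3) words_update[OF xs that(3), of j] ij(1) that(1,2)] ij(3)
    by (simp add: list_update_swap)
  have add2: "v (xs[i := y, j := x \<oplus>\<^bsub>M\<^esub> x']) = v (xs[i := y, j := x]) \<oplus>\<^bsub>N\<^esub> v (xs[i := y, j := x'])"
    if "x \<in> carrier M" "x' \<in> carrier M" "y \<in> carrier M" for x x' y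
    using multilinear_add[OF assms(3) words_update[OF xs that(3), of i] ij(2) that(1,2)] .
  have ab: "?a \<oplus>\<^bsub>M\<^esub> ?b \<in> carrier M" using c by simp
  have "\<zero>\<^bsub>N\<^esub> = v (xs[i := ?a, j := ?a \<oplus>\<^bsub>M\<^esub> ?b]) \<oplus>\<^bsub>N\<^esub> v (xs[i := ?b, j := ?a \<oplus>\<^bsub>M\<^esub> ?b])"
    using add1[OF c ab] nd[OF ab] by simp
  also have "\<dots> = v (xs[i := ?a, j := ?b]) \<oplus>\<^bsub>N\<^esub> v (xs[i := ?b, j := ?a])"
    unfolding add2[OF c c(1)] add2[OF c c(2)] nd[OF c(1)] nd[OF c(2)]
    using N.M.l_zero[OF vc[OF c]] N.M.r_zero[OF vc[OF c(2) c(1)]] by simp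
  finally have "v (xs[i := ?b, j := ?a]) \<oplus>\<^bsub>N\<^esub> v (xs[i := ?a, j := ?b]) = \<zero>\<^bsub>N\<^esub>"
    using N.M.a_comm[OF vc[OF c] vc[OF c(2) c(1)]] by simp
  then have "\<ominus>\<^bsub>N\<^esub> v (xs[i := ?a, j := ?b]) = v (xs[i := ?b, j := ?a])"
    by (rule N.minus_equality) (use c vc multilinear_closed[OF assms(3) xs] in auto)
  then show ?thesis by simp
qed

context
  fixes R :: "'a ring" and M :: "('a, 'b) module" and n :: nat
  assumes M: "module R M"
begin

interpretation M: module R M by (rule M)
interpretation T: module R "tensor_power R n M" by (rule tensor_power_module[OF M])

lemma pure_tensor_closed: "xs \<in> words M n \<Longrightarrow> pure_tensor R n M xs \<in> carrier (tensor_power R n M)"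
  by (rule multilinear_closed[OF pure_tensor_multilinear[OF M]])

lemma ext_kernel_submodule: "LinearCombinations.submodule R (ext_kernel R n M) (tensor_power R n M)"
  unfolding ext_kernel_def by (rule T.span_is_submodule) (auto intro: pure_tensor_closed)

lemma ext_power_module: "module R (ext_power R n M)"
  unfolding ext_power_def by (rule quot_mod_module[OF ext_kernel_submodule])

lemma wedge_multilinear: "multilinear R n M (ext_power R n M) (wedge R n M)"
proof -
  have "multilinear R n M (ext_power R n M) (\<lambda>xs. (\<lambda>x\<in>carrier (tensor_power R n M).
      ext_kernel R n M +>\<^bsub>tensor_power R n M\<^esub> x) (pure_tensor R n M xs))"
    unfolding ext_power_def
    by (rule multilinear_compose[OF pure_tensor_multilinear[OF M] quot_proj_lin[OF ext_kernel_submodule]])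
  then show ?thesis
    by (simp add: multilinear_def wedge_def pure_tensor_closed words_update cong: conj_cong Pi_cong)
qed

lemma wedge_alternating: "alternating n M (ext_power R n M) (wedge R n M)"
  unfolding alternating_def
proof (intro ballI impI)
  fix xs assume "xs \<in> words M n" "\<not> distinct xs"
  then have "pure_tensor R n M xs \<in> ext_kernel R n M"
    unfolding ext_kernel_def by (intro subsetD[OF T.in_own_span]) (auto intro: pure_tensor_closed)
  then show "wedge R n M xs = \<zero>\<^bsub>ext_power R n M\<^esub>"
    using quot_eq_zero[OF ext_kernel_submodule] by (simp add: wedge_def ext_power_def)
qed

lemma wedge_generates: "generates R (ext_power R n M) (wedge R n M ` words M n)"
  using quot_generates[OF ext_kernel_submodule pure_tensor_generates[OF M]]
  by (simp add: ext_power_def image_image wedge_def)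

lemma ext_power_lift:
  assumes "module R N" "multilinear R n M N v" "alternating n M N v"
  shows "\<exists>h \<in> lin_maps R (ext_power R n M) N. \<forall>xs \<in> words M n. h (wedge R n M xs) = v xs"
proof -
  interpret N: module R N by fact
  obtain L where L: "L \<in> lin_maps R (tensor_power R n M) N"
    "\<And>xs. xs \<in> words M n \<Longrightarrow> L (pure_tensor R n M xs) = v xs"
    using tensor_power_lift[OF M assms(1,2)] by blast
  interpret L: mod_hom R "tensor_power R n M" N L
    by (rule mod_hom_lin_maps[OF T.module_axioms assms(1) L(1)])
  have "ext_kernel R n M \<subseteq> L.ker"
    unfolding ext_kernel_def
    by (rule T.span_is_subset[OF _ L.ker_is_submodule])
      (use L(2) assms(3) pure_tensor_closed in \<open>auto simp: L.ker_def alternating_def\<close>)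
  then have "\<And>f. f \<in> ext_kernel R n M \<Longrightarrow> L f = \<zero>\<^bsub>N\<^esub>" by (auto simp: L.ker_def)
  from quot_lift[OF ext_kernel_submodule assms(1) L(1) this]
  obtain h where h: "h \<in> lin_maps R (ext_power R n M) N"
    "\<forall>x\<in>carrier (tensor_power R n M). h (ext_kernel R n M +>\<^bsub>tensor_power R n M\<^esub> x) = L x"
    unfolding ext_power_def by blast
  have "h (wedge R n M xs) = v xs" if "xs \<in> words M n" for xs
    unfolding wedge_def using h(2)[rule_format, OF pure_tensor_closed[OF that]] L(2)[OF that] by (rule trans)
  then show ?thesis using h(1) by blast
qed


section \<open>Symmetric powers\<close>

lemma words_permute: "xs \<in> words M n \<Longrightarrow> \<sigma> permutes {..<n} \<Longrightarrow> permute_list \<sigma> xs \<in> words M n"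
  by (auto simp: words_def)

lemma sym_kernel_gens_closed:
  "{pure_tensor R n M (permute_list \<sigma> xs) \<ominus>\<^bsub>tensor_power R n M\<^esub> pure_tensor R n M xs | \<sigma> xs.
     xs \<in> words M n \<and> \<sigma> permutes {..<n}} \<subseteq> carrier (tensor_power R n M)"
  by (auto intro!: T.M.minus_closed pure_tensor_closed words_permute)

lemma sym_kernel_submodule: "LinearCombinations.submodule R (sym_kernel R n M) (tensor_power R n M)"
  unfolding sym_kernel_def by (rule T.span_is_submodule[OF sym_kernel_gens_closed])

lemma sym_power_module: "module R (sym_power R n M)"
  unfolding sym_power_def by (rule quot_mod_module[OF sym_kernel_submodule])

lemma sym_prod_multilinear: "multilinear R n M (sym_power R n M) (sym_prod R n M)"
proof -
  have "multilinear R n M (sym_power R n M) (\<lambda>xs. (\<lambda>x\<in>carrier (tensor_power R n M).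
      sym_kernel R n M +>\<^bsub>tensor_power R n M\<^esub> x) (pure_tensor R n M xs))"
    unfolding sym_power_def
    by (rule multilinear_compose[OF pure_tensor_multilinear[OF M] quot_proj_lin[OF sym_kernel_submodule]])
  then show ?thesis
    by (simp add: multilinear_def sym_prod_def pure_tensor_closed words_update cong: conj_cong Pi_cong)
qed

lemma sym_prod_permute:
  assumes "xs \<in> words M n" "\<sigma> permutes {..<n}"
  shows "sym_prod R n M (permute_list \<sigma> xs) = sym_prod R n M xs"
proof -
  have "pure_tensor R n M (permute_list \<sigma> xs) \<ominus>\<^bsub>tensor_power R n M\<^esub> pure_tensor R n M xs \<in> sym_kernel R n M"
    unfolding sym_kernel_def
    by (intro subsetD[OF T.in_own_span[OF sym_kernel_gens_closed]]) (use assms in auto)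
  then show ?thesis
    using coset_eq_iff[OF sym_kernel_submodule] pure_tensor_closed words_permute assms
    by (simp add: sym_prod_def)
qed

lemma sym_prod_generates: "generates R (sym_power R n M) (sym_prod R n M ` words M n)"
  using quot_generates[OF sym_kernel_submodule pure_tensor_generates[OF M]]
  by (simp add: sym_power_def image_image sym_prod_def)

lemma sym_power_lift:
  assumes "module R N" "multilinear R n M N v"
    "\<And>\<sigma> xs. xs \<in> words M n \<Longrightarrow> \<sigma> permutes {..<n} \<Longrightarrow> v (permute_list \<sigma> xs) = v xs"
  shows "\<exists>h \<in> lin_maps R (sym_power R n M) N. \<forall>xs \<in> words M n. h (sym_prod R n M xs) = v xs"
proof -
  interpret N: module R N by fact
  obtain L where L: "L \<in> lin_maps R (tensor_power R n M) N"
    "\<And>xs. xs \<in> words M n \<Longrightarrow> L (pure_tensor R n M xs) = v xs"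
    using tensor_power_lift[OF M assms(1,2)] by blast
  interpret L: mod_hom R "tensor_power R n M" N L
    by (rule mod_hom_lin_maps[OF T.module_axioms assms(1) L(1)])
  have "L (pure_tensor R n M (permute_list \<sigma> xs) \<ominus>\<^bsub>tensor_power R n M\<^esub> pure_tensor R n M xs) = \<zero>\<^bsub>N\<^esub>"
    if "xs \<in> words M n" "\<sigma> permutes {..<n}" for xs \<sigma>
    using that L(2) assms(3) multilinear_closed[OF assms(2)] words_permute pure_tensor_closed
    by (simp add: N.minus_eq_zero_iff)
  then have "{pure_tensor R n M (permute_list \<sigma> xs) \<ominus>\<^bsub>tensor_power R n M\<^esub> pure_tensor R n M xs | \<sigma> xs.
     xs \<in> words M n \<and> \<sigma> permutes {..<n}} \<subseteq> L.ker"
    using sym_kernel_gens_closed unfolding L.ker_def by blast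
  then have "sym_kernel R n M \<subseteq> L.ker"
    unfolding sym_kernel_def by (rule T.span_is_subset[OF _ L.ker_is_submodule])
  then have "\<And>f. f \<in> sym_kernel R n M \<Longrightarrow> L f = \<zero>\<^bsub>N\<^esub>" by (auto simp: L.ker_def)
  from quot_lift[OF sym_kernel_submodule assms(1) L(1) this]
  obtain h where h: "h \<in> lin_maps R (sym_power R n M) N"
    "\<forall>x\<in>carrier (tensor_power R n M). h (sym_kernel R n M +>\<^bsub>tensor_power R n M\<^esub> x) = L x"
    unfolding sym_power_def by blast
  have "h (sym_prod R n M xs) = v xs" if "xs \<in> words M n" for xs
    unfolding sym_prod_def using h(2)[rule_format, OF pure_tensor_closed[OF that]] L(2)[OF that] by (rule trans)
  then show ?thesis using h(1) by blast
qed

end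

section \<open>Tensor products\<close>

definition bilinear ::
  "'a ring \<Rightarrow> ('a, 'b) module \<Rightarrow> ('a, 'c) module \<Rightarrow> ('a, 'd) module \<Rightarrow> ('b \<Rightarrow> 'c \<Rightarrow> 'd) \<Rightarrow> bool" where
  "bilinear R M N P v \<longleftrightarrow>
    (\<forall>x \<in> carrier M. \<forall>y \<in> carrier N. v x y \<in> carrier P) \<and>
    (\<forall>x \<in> carrier M. \<forall>x' \<in> carrier M. \<forall>y \<in> carrier N. v (x \<oplus>\<^bsub>M\<^esub> x') y = v x y \<oplus>\<^bsub>P\<^esub> v x' y) \<and>
    (\<forall>x \<in> carrier M. \<forall>y \<in> carrier N. \<forall>y' \<in> carrier N. v x (y \<oplus>\<^bsub>N\<^esub> y') = v x y \<oplus>\<^bsub>P\<^esub> v x y') \<and>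
    (\<forall>a \<in> carrier R. \<forall>x \<in> carrier M. \<forall>y \<in> carrier N. v (a \<odot>\<^bsub>M\<^esub> x) y = a \<odot>\<^bsub>P\<^esub> v x y) \<and>
    (\<forall>a \<in> carrier R. \<forall>x \<in> carrier M. \<forall>y \<in> carrier N. v x (a \<odot>\<^bsub>N\<^esub> y) = a \<odot>\<^bsub>P\<^esub> v x y)"

lemma bilinearD:
  assumes "bilinear R M N P v"
  shows "\<And>x y. x \<in> carrier M \<Longrightarrow> y \<in> carrier N \<Longrightarrow> v x y \<in> carrier P"
    "\<And>x x' y. x \<in> carrier M \<Longrightarrow> x' \<in> carrier M \<Longrightarrow> y \<in> carrier N \<Longrightarrow> v (x \<oplus>\<^bsub>M\<^esub> x') y = v x y \<oplus>\<^bsub>P\<^esub> v x' y"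
    "\<And>x y y'. x \<in> carrier M \<Longrightarrow> y \<in> carrier N \<Longrightarrow> y' \<in> carrier N \<Longrightarrow> v x (y \<oplus>\<^bsub>N\<^esub> y') = v x y \<oplus>\<^bsub>P\<^esub> v x y'"
    "\<And>a x y. a \<in> carrier R \<Longrightarrow> x \<in> carrier M \<Longrightarrow> y \<in> carrier N \<Longrightarrow> v (a \<odot>\<^bsub>M\<^esub> x) y = a \<odot>\<^bsub>P\<^esub> v x y"
    "\<And>a x y. a \<in> carrier R \<Longrightarrow> x \<in> carrier M \<Longrightarrow> y \<in> carrier N \<Longrightarrow> v x (a \<odot>\<^bsub>N\<^esub> y) = a \<odot>\<^bsub>P\<^esub> v x y"
  using assms unfolding bilinear_def by blast+

context
  fixes R :: "'a ring" and M :: "('a, 'b) module" and N :: "('a, 'c) module"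
  assumes M: "module R M" and N: "module R N"
begin

interpretation M: module R M by (rule M)
interpretation N: module R N by (rule N)
interpretation F: module R "free_mod R (carrier M \<times> carrier N)" by (rule free_mod_module[OF M.cring_axioms])

lemma tensor_rels_closed: "tensor_rels R M N \<subseteq> carrier (free_mod R (carrier M \<times> carrier N))"
  unfolding tensor_rels_def Let_def
  by (auto intro!: F.M.minus_closed F.M.add.m_closed F.smult_closed
      free_gen_closed[OF M.R.ring_axioms])

lemma tensor_mod_module: "module R (tensor_mod R M N)"
  unfolding tensor_mod_def by (rule pres_mod_module[OF M.cring_axioms tensor_rels_closed])

interpretation T: module R "tensor_mod R M N" by (rule tensor_mod_module)

lemma tensor_elt_generates:
  "generates R (tensor_mod R M N) ((\<lambda>(x, y). tensor_elt R M N x y) ` (carrier M \<times> carrier N))"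
  using pres_gen_generates[OF M.cring_axioms tensor_rels_closed]
  unfolding tensor_mod_def tensor_elt_def by (simp add: case_prod_beta)

lemma tensor_elt_bilinear: "bilinear R M N (tensor_mod R M N) (tensor_elt R M N)"
proof -
  let ?F = "free_mod R (carrier M \<times> carrier N)" and ?T = "tensor_mod R M N"
  let ?d = "free_gen R (carrier M \<times> carrier N)"
  obtain p where p: "p \<in> lin_maps R ?F ?T"
    "\<And>x y. x \<in> carrier M \<Longrightarrow> y \<in> carrier N \<Longrightarrow> p (?d (x, y)) = tensor_elt R M N x y"
    "\<And>q. q \<in> tensor_rels R M N \<Longrightarrow> p q = \<zero>\<^bsub>?T\<^esub>"
    using pres_proj[OF M.cring_axioms tensor_rels_closed]
    unfolding tensor_mod_def tensor_elt_def by blast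
  note pm = lin_maps_minus[OF F.module_axioms T.module_axioms p(1)]
  note d = free_gen_closed[OF M.R.ring_axioms]
  have cl: "tensor_elt R M N x y \<in> carrier ?T" if "x \<in> carrier M" "y \<in> carrier N" for x y
    using generates_sub[OF tensor_elt_generates] that by auto
  show ?thesis
    unfolding bilinear_def
  proof (intro conjI ballI)
    fix x x' y assume A: "x \<in> carrier M" "x' \<in> carrier M" "y \<in> carrier N"
    have "p (?d (x \<oplus>\<^bsub>M\<^esub> x', y) \<ominus>\<^bsub>?F\<^esub> (?d (x, y) \<oplus>\<^bsub>?F\<^esub> ?d (x', y))) = \<zero>\<^bsub>?T\<^esub>"
      by (rule p(3)) (use A in \<open>unfold tensor_rels_def Let_def, blast\<close>)
    then show "tensor_elt R M N (x \<oplus>\<^bsub>M\<^esub> x') y = tensor_elt R M N x y \<oplus>\<^bsub>?T\<^esub> tensor_elt R M N x' y"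
      using A by (subst (asm) pm) (auto simp: d lin_maps_add[OF p(1)] p(2) T.minus_add_eq_zero_iff cl)
  next
    fix x y y' assume A: "x \<in> carrier M" "y \<in> carrier N" "y' \<in> carrier N"
    have "p (?d (x, y \<oplus>\<^bsub>N\<^esub> y') \<ominus>\<^bsub>?F\<^esub> (?d (x, y) \<oplus>\<^bsub>?F\<^esub> ?d (x, y'))) = \<zero>\<^bsub>?T\<^esub>"
      by (rule p(3)) (use A in \<open>unfold tensor_rels_def Let_def, blast\<close>)
    then show "tensor_elt R M N x (y \<oplus>\<^bsub>N\<^esub> y') = tensor_elt R M N x y \<oplus>\<^bsub>?T\<^esub> tensor_elt R M N x y'"
      using A by (subst (asm) pm) (auto simp: d lin_maps_add[OF p(1)] p(2) T.minus_add_eq_zero_iff cl)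
  next
    fix a x y assume A: "a \<in> carrier R" "x \<in> carrier M" "y \<in> carrier N"
    have "p (?d (a \<odot>\<^bsub>M\<^esub> x, y) \<ominus>\<^bsub>?F\<^esub> a \<odot>\<^bsub>?F\<^esub> ?d (x, y)) = \<zero>\<^bsub>?T\<^esub>"
      by (rule p(3)) (use A in \<open>unfold tensor_rels_def Let_def, blast\<close>)
    then show "tensor_elt R M N (a \<odot>\<^bsub>M\<^esub> x) y = a \<odot>\<^bsub>?T\<^esub> tensor_elt R M N x y"
      using A by (subst (asm) pm) (auto simp: d lin_maps_smult[OF p(1)] p(2) T.minus_eq_zero_iff cl)
    have "p (?d (x, a \<odot>\<^bsub>N\<^esub> y) \<ominus>\<^bsub>?F\<^esub> a \<odot>\<^bsub>?F\<^esub> ?d (x, y)) = \<zero>\<^bsub>?T\<^esub>"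
      by (rule p(3)) (use A in \<open>unfold tensor_rels_def Let_def, blast\<close>)
    then show "tensor_elt R M N x (a \<odot>\<^bsub>N\<^esub> y) = a \<odot>\<^bsub>?T\<^esub> tensor_elt R M N x y"
      using A by (subst (asm) pm) (auto simp: d lin_maps_smult[OF p(1)] p(2) T.minus_eq_zero_iff cl)
  qed (rule cl)
qed

lemma tensor_mod_lift:
  assumes "module R P" "bilinear R M N P v"
  shows "\<exists>h \<in> lin_maps R (tensor_mod R M N) P.
    \<forall>x \<in> carrier M. \<forall>y \<in> carrier N. h (tensor_elt R M N x y) = v x y"
proof -
  interpret P: module R P by fact
  note d = free_gen_closed[OF M.R.ring_axioms]
  note b = bilinearD[OF assms(2)]
  have "\<exists>h \<in> lin_maps R (pres_mod R (carrier M \<times> carrier N) (tensor_rels R M N)) P.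
    \<forall>z \<in> carrier M \<times> carrier N. h (pres_gen R (carrier M \<times> carrier N) (tensor_rels R M N) z) =
      (case z of (x, y) \<Rightarrow> v x y)"
  proof (rule pres_mod_lift[OF M.cring_axioms tensor_rels_closed assms(1)])
    show "(\<lambda>(x, y). v x y) \<in> carrier M \<times> carrier N \<rightarrow> carrier P" using b(1) by auto
    fix L q
    assume L: "L \<in> lin_maps R (free_mod R (carrier M \<times> carrier N)) P"
      "\<And>z. z \<in> carrier M \<times> carrier N \<Longrightarrow> L (free_gen R (carrier M \<times> carrier N) z) = (case z of (x, y) \<Rightarrow> v x y)"
      and q: "q \<in> tensor_rels R M N"
    note Lm = lin_maps_minus[OF F.module_axioms assms(1) L(1)]
    from q show "L q = \<zero>\<^bsub>P\<^esub>"
      unfolding tensor_rels_def Let_def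
      by (elim UnE CollectE exE conjE)
        (simp_all add: Lm d lin_maps_add[OF L(1)] lin_maps_smult[OF L(1)] L(2) b P.minus_eq_zero_iff)
  qed
  then show ?thesis unfolding tensor_mod_def tensor_elt_def by auto
qed

end

section \<open>Semilinear maps and functoriality\<close>

text \<open>One notion for linear maps (\<phi> the identity) and for maps into a base change. Unlike
  \<open>lin_maps\<close> it does not ask for extensionality, so it can be stated for
  \<open>conj_act\<close> and \<open>end_can\<close>, which are not defined as restrictions to the
  carrier of the endomorphism module.\<close>

definition semilinear ::
  "'a ring \<Rightarrow> ('a \<Rightarrow> 's) \<Rightarrow> ('a, 'b) module \<Rightarrow> ('s, 'c) module \<Rightarrow> ('b \<Rightarrow> 'c) \<Rightarrow> bool" where
  "semilinear R \<phi> M N h \<longleftrightarrow>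
    (\<forall>x \<in> carrier M. h x \<in> carrier N) \<and>
    (\<forall>x \<in> carrier M. \<forall>y \<in> carrier M. h (x \<oplus>\<^bsub>M\<^esub> y) = h x \<oplus>\<^bsub>N\<^esub> h y) \<and>
    (\<forall>a \<in> carrier R. \<forall>x \<in> carrier M. h (a \<odot>\<^bsub>M\<^esub> x) = \<phi> a \<odot>\<^bsub>N\<^esub> h x)"

lemma semilinearD:
  assumes "semilinear R \<phi> M N h"
  shows "\<And>x. x \<in> carrier M \<Longrightarrow> h x \<in> carrier N"
    "\<And>x y. x \<in> carrier M \<Longrightarrow> y \<in> carrier M \<Longrightarrow> h (x \<oplus>\<^bsub>M\<^esub> y) = h x \<oplus>\<^bsub>N\<^esub> h y"
    "\<And>a x. a \<in> carrier R \<Longrightarrow> x \<in> carrier M \<Longrightarrow> h (a \<odot>\<^bsub>M\<^esub> x) = \<phi> a \<odot>\<^bsub>N\<^esub> h x"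
  using assms unfolding semilinear_def by blast+

lemma restrict_scalars_simps [simp]:
  "carrier (restrict_scalars \<phi> N) = carrier N" "\<zero>\<^bsub>restrict_scalars \<phi> N\<^esub> = \<zero>\<^bsub>N\<^esub>"
  "add (restrict_scalars \<phi> N) = add N" "a \<odot>\<^bsub>restrict_scalars \<phi> N\<^esub> x = \<phi> a \<odot>\<^bsub>N\<^esub> x"
  by (simp_all add: restrict_scalars_def)

lemma restrict_scalars_id: "restrict_scalars id N = N"
  by (simp add: restrict_scalars_def)

lemma lin_maps_semilinear:
  "h \<in> lin_maps R M (restrict_scalars \<phi> N) \<Longrightarrow> semilinear R \<phi> M N h"
  unfolding semilinear_def lin_maps_def module_hom_def by auto

lemma lin_maps_semilinear_id: "h \<in> lin_maps R M N \<Longrightarrow> semilinear R id M N h"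
  using lin_maps_semilinear[of h R M id N] by (simp add: restrict_scalars_id)

lemma restrict_scalars_module:
  assumes "module S N" "cring R" "\<phi> \<in> ring_hom R S"
  shows "module R (restrict_scalars \<phi> N)"
proof -
  interpret N: module S N by fact
  interpret R: cring R by fact
  have "\<exists>w\<in>carrier N. v \<oplus>\<^bsub>N\<^esub> w = \<zero>\<^bsub>N\<^esub>" if "v \<in> carrier N" for v
    using that N.M.r_neg by (intro bexI[of _ "\<ominus>\<^bsub>N\<^esub> v"]) auto
  then show ?thesis
    by (intro module_criteria)
      (auto simp: N.M.a_ac R.cring_axioms ring_hom_closed[OF assms(3)] ring_hom_mult[OF assms(3)]
        ring_hom_add[OF assms(3)] ring_hom_one[OF assms(3)] N.smult_assoc1 N.smult_l_distr N.smult_r_distr)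
qed

lemma semilinear_zero:
  assumes "module R M" "module S N" "\<phi> \<in> ring_hom R S" "semilinear R \<phi> M N h"
  shows "h \<zero>\<^bsub>M\<^esub> = \<zero>\<^bsub>N\<^esub>"
proof -
  interpret M: module R M by fact
  interpret N: module S N by fact
  have "h \<zero>\<^bsub>M\<^esub> \<oplus>\<^bsub>N\<^esub> h \<zero>\<^bsub>M\<^esub> = h \<zero>\<^bsub>M\<^esub>"
    using semilinearD(2)[OF assms(4), of "\<zero>\<^bsub>M\<^esub>" "\<zero>\<^bsub>M\<^esub>"] by simp
  then show ?thesis using semilinearD(1)[OF assms(4), of "\<zero>\<^bsub>M\<^esub>"] by simp
qed

context
  fixes R :: "'a ring" and S :: "'s ring" and \<phi> :: "'a \<Rightarrow> 's"
    and M :: "('a, 'b) module" and N :: "('s, 'c) module" and h :: "'b \<Rightarrow> 'c"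
  assumes M: "module R M" and N: "module S N" and \<phi>: "\<phi> \<in> ring_hom R S"
    and h: "semilinear R \<phi> M N h"
begin

interpretation M: module R M by (rule M)
interpretation N: module S N by (rule N)

lemma multilinear_map:
  assumes "multilinear S n N P v"
  shows "multilinear R n M (restrict_scalars \<phi> P) (\<lambda>xs. v (map h xs))"
  by (rule multilinearI)
    (simp_all add: multilinear_closed[OF assms] words_map map_update semilinearD[OF h]
      multilinear_add[OF assms] multilinear_smult[OF assms] ring_hom_closed[OF \<phi>])

text \<open>A repeated entry stays repeated under \<open>map h\<close>, so the wedge of the images
  is alternating and factors through the exterior power.\<close>

lemma ext_power_map:
  shows "semilinear R \<phi> (ext_power R n M) (ext_power S n N) (ext_power_map R S \<phi> n M N h)" (is ?A)
    and "xs \<in> words M n \<Longrightarrow> ext_power_map R S \<phi> n M N h (wedge R n M xs) = wedge S n N (map h xs)"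
      (is "_ \<Longrightarrow> ?B xs")
proof -
  note E = ext_power_module[OF M]
  note E' = restrict_scalars_module[OF ext_power_module[OF N] M.cring_axioms \<phi>]
  have "alternating n M (restrict_scalars \<phi> (ext_power S n N)) (\<lambda>xs. wedge S n N (map h xs))"
    using wedge_alternating[OF N] words_map[of _ M n h N] semilinearD(1)[OF h]
    unfolding alternating_def by (auto simp: distinct_map)
  from ext_power_lift[OF M E' multilinear_map[OF wedge_multilinear[OF N]] this]
  obtain g where g: "g \<in> lin_maps R (ext_power R n M) (restrict_scalars \<phi> (ext_power S n N))"
    "\<And>xs. xs \<in> words M n \<Longrightarrow> g (wedge R n M xs) = wedge S n N (map h xs)" by blast
  have "ext_power_map R S \<phi> n M N h = g"
    unfolding ext_power_map_def
  proof (rule the_lin_eq[OF E E' g(1)])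
    have "fst ` {(wedge R n M xs, wedge S n N (map h xs)) |xs. xs \<in> words M n} = wedge R n M ` words M n"
      by force
    then show "generates R (ext_power R n M)
        (fst ` {(wedge R n M xs, wedge S n N (map h xs)) |xs. xs \<in> words M n})"
      using wedge_generates[OF M] by simp
  qed (use g(2) in auto)
  then show ?A "xs \<in> words M n \<Longrightarrow> ?B xs" using g lin_maps_semilinear by auto
qed

text \<open>Applying \<open>h\<close> entrywise commutes with permuting the positions, so the
  product of the images is symmetric and factors through the coinvariants.\<close>

lemma sym_power_map:
  shows "semilinear R \<phi> (sym_power R n M) (sym_power S n N) (sym_power_map R S \<phi> n M N h)" (is ?A)
    and "xs \<in> words M n \<Longrightarrow> sym_power_map R S \<phi> n M N h (sym_prod R n M xs) = sym_prod S n N (map h xs)"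
      (is "_ \<Longrightarrow> ?B xs")
proof -
  note E = sym_power_module[OF M]
  note E' = restrict_scalars_module[OF sym_power_module[OF N] M.cring_axioms \<phi>]
  have "sym_prod S n N (map h (permute_list \<sigma> xs)) = sym_prod S n N (map h xs)"
    if "xs \<in> words M n" "\<sigma> permutes {..<n}" for \<sigma> xs
  proof -
    have "map h (permute_list \<sigma> xs) = permute_list \<sigma> (map h xs)"
      using that by (subst permute_list_map) (auto simp: words_def)
    then show ?thesis
      using sym_prod_permute[OF N words_map[OF that(1)] that(2)] semilinearD(1)[OF h] by simp
  qed
  from sym_power_lift[OF M E' multilinear_map[OF sym_prod_multilinear[OF N]] this]
  obtain g where g: "g \<in> lin_maps R (sym_power R n M) (restrict_scalars \<phi> (sym_power S n N))"
    "\<And>xs. xs \<in> words M n \<Longrightarrow> g (sym_prod R n M xs) = sym_prod S n N (map h xs)" by blast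
  have "sym_power_map R S \<phi> n M N h = g"
    unfolding sym_power_map_def
  proof (rule the_lin_eq[OF E E' g(1)])
    have "fst ` {(sym_prod R n M xs, sym_prod S n N (map h xs)) |xs. xs \<in> words M n} = sym_prod R n M ` words M n"
      by force
    then show "generates R (sym_power R n M)
        (fst ` {(sym_prod R n M xs, sym_prod S n N (map h xs)) |xs. xs \<in> words M n})"
      using sym_prod_generates[OF M] by simp
  qed (use g(2) in auto)
  then show ?A "xs \<in> words M n \<Longrightarrow> ?B xs" using g lin_maps_semilinear by auto
qed

end

lemma tensor_map:
  assumes M: "module R M" and N: "module R N" and M': "module S M'" and N': "module S N'"
    and \<phi>: "\<phi> \<in> ring_hom R S" and h: "semilinear R \<phi> M M' h" and h': "semilinear R \<phi> N N' h'"
  shows "semilinear R \<phi> (tensor_mod R M N) (tensor_mod S M' N') (tensor_map R S \<phi> M N M' N' h h')" (is ?A)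
    and "x \<in> carrier M \<Longrightarrow> y \<in> carrier N \<Longrightarrow>
      tensor_map R S \<phi> M N M' N' h h' (tensor_elt R M N x y) = tensor_elt S M' N' (h x) (h' y)"
      (is "_ \<Longrightarrow> _ \<Longrightarrow> ?B x y")
proof -
  interpret M: module R M by (rule M)
  note E = tensor_mod_module[OF M N]
  note E' = restrict_scalars_module[OF tensor_mod_module[OF M' N'] M.cring_axioms \<phi>]
  note b = bilinearD[OF tensor_elt_bilinear[OF M' N']]
  have "bilinear R M N (restrict_scalars \<phi> (tensor_mod S M' N')) (\<lambda>x y. tensor_elt S M' N' (h x) (h' y))"
    unfolding bilinear_def
    by (simp add: b semilinearD[OF h] semilinearD[OF h'] ring_hom_closed[OF \<phi>])
  from tensor_mod_lift[OF M N E' this]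
  obtain g where g: "g \<in> lin_maps R (tensor_mod R M N) (restrict_scalars \<phi> (tensor_mod S M' N'))"
    "\<And>x y. x \<in> carrier M \<Longrightarrow> y \<in> carrier N \<Longrightarrow> g (tensor_elt R M N x y) = tensor_elt S M' N' (h x) (h' y)"
    by blast
  have "tensor_map R S \<phi> M N M' N' h h' = g"
    unfolding tensor_map_def
  proof (rule the_lin_eq[OF E E' g(1)])
    have "fst ` {(tensor_elt R M N x y, tensor_elt S M' N' (h x) (h' y)) |x y. x \<in> carrier M \<and> y \<in> carrier N}
        = (\<lambda>(x, y). tensor_elt R M N x y) ` (carrier M \<times> carrier N)"
      by force
    then show "generates R (tensor_mod R M N)
      (fst ` {(tensor_elt R M N x y, tensor_elt S M' N' (h x) (h' y)) |x y. x \<in> carrier M \<and> y \<in> carrier N})"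
      using tensor_elt_generates[OF M N] by simp
  qed (use g(2) in auto)
  then show ?A "x \<in> carrier M \<Longrightarrow> y \<in> carrier N \<Longrightarrow> ?B x y" using g lin_maps_semilinear by auto
qed


section \<open>Extension of scalars\<close>

context
  fixes k :: "'a ring" and R :: "'t ring" and \<phi> :: "'a \<Rightarrow> 't" and M :: "('a, 'b) module"
  assumes M: "module k M" and R: "cring R" and \<phi>: "\<phi> \<in> ring_hom k R"
begin

interpretation M: module k M by (rule M)
interpretation R: cring R by (rule R)
interpretation F: module R "free_mod R (carrier M)" by (rule free_mod_module[OF R])

lemma ext_scalars_rels_closed: "ext_scalars_rels k R \<phi> M \<subseteq> carrier (free_mod R (carrier M))"
  unfolding ext_scalars_rels_def Let_def
  by (auto intro!: F.M.minus_closed F.M.add.m_closed F.smult_closed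
      free_gen_closed[OF R.ring_axioms] ring_hom_closed[OF \<phi>])

lemma ext_scalars_module: "module R (ext_scalars k R \<phi> M)"
  unfolding ext_scalars_def by (rule pres_mod_module[OF R ext_scalars_rels_closed])

interpretation T: module R "ext_scalars k R \<phi> M" by (rule ext_scalars_module)

lemma ext_scalars_generates:
  "generates R (ext_scalars k R \<phi> M) (ext_scalars_elt k R \<phi> M ` carrier M)"
  using pres_gen_generates[OF R ext_scalars_rels_closed]
  unfolding ext_scalars_def ext_scalars_elt_def by simp

lemma ext_scalars_elt_semilinear:
  "semilinear k \<phi> M (ext_scalars k R \<phi> M) (ext_scalars_elt k R \<phi> M)"
proof -
  let ?F = "free_mod R (carrier M)" and ?T = "ext_scalars k R \<phi> M"
  let ?d = "free_gen R (carrier M)" and ?e = "ext_scalars_elt k R \<phi> M"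
  obtain p where p: "p \<in> lin_maps R ?F ?T"
    "\<And>x. x \<in> carrier M \<Longrightarrow> p (?d x) = ?e x"
    "\<And>q. q \<in> ext_scalars_rels k R \<phi> M \<Longrightarrow> p q = \<zero>\<^bsub>?T\<^esub>"
    using pres_proj[OF R ext_scalars_rels_closed]
    unfolding ext_scalars_def ext_scalars_elt_def by blast
  note pm = lin_maps_minus[OF F.module_axioms T.module_axioms p(1)]
  note d = free_gen_closed[OF R.ring_axioms]
  have cl: "?e x \<in> carrier ?T" if "x \<in> carrier M" for x
    using generates_sub[OF ext_scalars_generates] that by auto
  show ?thesis
    unfolding semilinear_def
  proof (intro conjI ballI)
    fix x y assume A: "x \<in> carrier M" "y \<in> carrier M"
    have "p (?d (x \<oplus>\<^bsub>M\<^esub> y) \<ominus>\<^bsub>?F\<^esub> (?d x \<oplus>\<^bsub>?F\<^esub> ?d y)) = \<zero>\<^bsub>?T\<^esub>"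
      by (rule p(3)) (use A in \<open>unfold ext_scalars_rels_def Let_def, blast\<close>)
    then show "?e (x \<oplus>\<^bsub>M\<^esub> y) = ?e x \<oplus>\<^bsub>?T\<^esub> ?e y"
      using A by (subst (asm) pm) (auto simp: d lin_maps_add[OF p(1)] p(2) T.minus_add_eq_zero_iff cl)
  next
    fix a x assume A: "a \<in> carrier k" "x \<in> carrier M"
    have "p (?d (a \<odot>\<^bsub>M\<^esub> x) \<ominus>\<^bsub>?F\<^esub> \<phi> a \<odot>\<^bsub>?F\<^esub> ?d x) = \<zero>\<^bsub>?T\<^esub>"
      by (rule p(3)) (use A in \<open>unfold ext_scalars_rels_def Let_def, blast\<close>)
    then show "?e (a \<odot>\<^bsub>M\<^esub> x) = \<phi> a \<odot>\<^bsub>?T\<^esub> ?e x"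
      using A
      by (subst (asm) pm)
        (auto simp: d lin_maps_smult[OF p(1)] p(2) T.minus_eq_zero_iff cl ring_hom_closed[OF \<phi>])
  qed (rule cl)
qed

lemma ext_scalars_lift:
  assumes "module R N" "semilinear k \<phi> M N v"
  shows "\<exists>h \<in> lin_maps R (ext_scalars k R \<phi> M) N. \<forall>x \<in> carrier M. h (ext_scalars_elt k R \<phi> M x) = v x"
  unfolding ext_scalars_def ext_scalars_elt_def
proof (rule pres_mod_lift[OF R ext_scalars_rels_closed assms(1)])
  interpret N: module R N by fact
  note d = free_gen_closed[OF R.ring_axioms]
  note b = semilinearD[OF assms(2)]
  show "v \<in> carrier M \<rightarrow> carrier N" using b(1) by auto
  fix L q
  assume L: "L \<in> lin_maps R (free_mod R (carrier M)) N"
    "\<And>x. x \<in> carrier M \<Longrightarrow> L (free_gen R (carrier M) x) = v x" and q: "q \<in> ext_scalars_rels k R \<phi> M"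
  note Lm = lin_maps_minus[OF F.module_axioms assms(1) L(1)]
  from q show "L q = \<zero>\<^bsub>N\<^esub>"
    unfolding ext_scalars_rels_def Let_def
    by (elim UnE CollectE exE conjE)
      (simp_all add: Lm d lin_maps_add[OF L(1)] lin_maps_smult[OF L(1)] L(2) b N.minus_eq_zero_iff
        ring_hom_closed[OF \<phi>])
qed

end


section \<open>Endomorphisms\<close>

lemma end_mod_simps:
  "carrier (end_mod R M) = lin_maps R M M" "\<zero>\<^bsub>end_mod R M\<^esub> = (\<lambda>x\<in>carrier M. \<zero>\<^bsub>M\<^esub>)"
  "X \<oplus>\<^bsub>end_mod R M\<^esub> Y = (\<lambda>x\<in>carrier M. X x \<oplus>\<^bsub>M\<^esub> Y x)"
  "a \<odot>\<^bsub>end_mod R M\<^esub> X = (\<lambda>x\<in>carrier M. a \<odot>\<^bsub>M\<^esub> X x)"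
  by (simp_all add: end_mod_def)

lemma end_mod_module:
  assumes "module R M"
  shows "module R (end_mod R M)"
proof -
  interpret M: module R M by fact
  have add: "(\<lambda>x\<in>carrier M. X x \<oplus>\<^bsub>M\<^esub> Y x) \<in> lin_maps R M M"
    if X: "X \<in> lin_maps R M M" and Y: "Y \<in> lin_maps R M M" for X Y
    by (rule restrict_lin_mapsI[OF assms])
      (auto simp: lin_maps_closed[OF X] lin_maps_closed[OF Y] lin_maps_add[OF X] lin_maps_add[OF Y]
        lin_maps_smult[OF X] lin_maps_smult[OF Y] M.M.a_ac M.smult_r_distr)
  have smult: "(\<lambda>x\<in>carrier M. a \<odot>\<^bsub>M\<^esub> X x) \<in> lin_maps R M M"
    if X: "X \<in> lin_maps R M M" and a: "a \<in> carrier R" for X a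
    by (rule restrict_lin_mapsI[OF assms])
      (auto simp: lin_maps_closed[OF X] lin_maps_add[OF X] a M.smult_r_distr
        lin_maps_smult[OF X] M.smult_assoc1[symmetric] M.R.m_comm)
  have neg: "\<exists>Y\<in>lin_maps R M M. (\<lambda>x\<in>carrier M. X x \<oplus>\<^bsub>M\<^esub> Y x) = (\<lambda>x\<in>carrier M. \<zero>\<^bsub>M\<^esub>)"
    if X: "X \<in> lin_maps R M M" for X
    by (rule bexI[of _ "\<lambda>x\<in>carrier M. (\<ominus>\<^bsub>R\<^esub> \<one>\<^bsub>R\<^esub>) \<odot>\<^bsub>M\<^esub> X x"])
      (auto intro!: smult X restrict_ext simp: M.smult_minus_1 lin_maps_closed[OF X] M.M.r_neg)
  have ext: "restrict X (carrier M) = X" if "X \<in> lin_maps R M M" for X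
    using that by (simp add: lin_maps_def extensional_restrict)
  note cl = lin_maps_closed
  show ?thesis
    apply (rule module_criteria)
              apply (rule M.cring_axioms)
             apply (simp add: end_mod_simps zero_lin_maps[OF assms assms])
            apply (simp add: end_mod_simps add)
           apply (simp add: end_mod_simps neg)
          apply (simp add: end_mod_simps smult)
         apply (auto simp: end_mod_simps cl M.M.a_comm intro!: restrict_ext)[1]
        apply (auto simp: end_mod_simps cl M.M.a_assoc intro!: restrict_ext)[1]
       apply (clarsimp simp: end_mod_simps, rule trans[OF restrict_ext ext], simp add: cl, assumption)
      apply (auto simp: end_mod_simps cl M.smult_assoc1 intro!: restrict_ext)[1]
     apply (clarsimp simp: end_mod_simps, rule trans[OF restrict_ext ext], simp add: cl, assumption)
    apply (auto simp: end_mod_simps cl M.smult_l_distr intro!: restrict_ext)[1]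
    apply (auto simp: end_mod_simps cl M.smult_r_distr intro!: restrict_ext)[1]
    done
qed

section \<open>Modules with a finite basis\<close>

text \<open>The ring as a module over itself, the common target of coordinate functionals,
  determinants and matrix coefficients.\<close>

definition self_mod :: "'a ring \<Rightarrow> ('a, 'a) module" where
  "self_mod R = \<lparr>carrier = carrier R, mult = mult R, one = one R, zero = zero R, add = add R,
     smult = mult R\<rparr>"

lemma self_mod_simps [simp]:
  "carrier (self_mod R) = carrier R" "\<zero>\<^bsub>self_mod R\<^esub> = \<zero>\<^bsub>R\<^esub>" "add (self_mod R) = add R"
  "smult (self_mod R) = mult R"
  by (simp_all add: self_mod_def)

lemma self_mod_module:
  assumes "cring R"
  shows "module R (self_mod R)"
proof -
  interpret cring R by fact
  have "\<exists>y\<in>carrier R. x \<oplus>\<^bsub>R\<^esub> y = \<zero>\<^bsub>R\<^esub>" if "x \<in> carrier R" for x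
    using that r_neg by (intro bexI[of _ "\<ominus>\<^bsub>R\<^esub> x"]) auto
  then show ?thesis
    by (intro module_criteria) (auto simp: a_ac m_ac l_distr r_distr intro: cring_axioms)
qed

text \<open>A free module of finite rank, with independence encoded by dual functionals
  \<open>co\<close> instead of by linear combinations. In this form a basis passes directly to a
  base change, and the locale can be used over \<open>k\<close> and over a test algebra.\<close>

locale based_module = module R W
  for R :: "'a ring" and W :: "('a, 'b) module" +
  fixes n :: nat and e :: "nat \<Rightarrow> 'b" and co :: "nat \<Rightarrow> 'b \<Rightarrow> 'a"
  assumes e_closed: "i < n \<Longrightarrow> e i \<in> carrier W"
    and e_generates: "generates R W (e ` {..<n})"
    and co_lin: "i < n \<Longrightarrow> co i \<in> lin_maps R W (self_mod R)"
    and co_e: "i < n \<Longrightarrow> j < n \<Longrightarrow> co i (e j) = (if i = j then \<one>\<^bsub>R\<^esub> else \<zero>\<^bsub>R\<^esub>)"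
begin

lemma mod: "module R W" by (rule module_axioms)

lemma self: "module R (self_mod R)" by (rule self_mod_module[OF R.cring_axioms])

lemma co_closed: "i < n \<Longrightarrow> x \<in> carrier W \<Longrightarrow> co i x \<in> carrier R"
  using lin_maps_closed[OF co_lin] by simp

lemma co_add: "i < n \<Longrightarrow> x \<in> carrier W \<Longrightarrow> y \<in> carrier W \<Longrightarrow> co i (x \<oplus>\<^bsub>W\<^esub> y) = co i x \<oplus>\<^bsub>R\<^esub> co i y"
  using lin_maps_add[OF co_lin] by simp

lemma co_smult: "i < n \<Longrightarrow> a \<in> carrier R \<Longrightarrow> x \<in> carrier W \<Longrightarrow> co i (a \<odot>\<^bsub>W\<^esub> x) = a \<otimes>\<^bsub>R\<^esub> co i x"
  using lin_maps_smult[OF co_lin] by simp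

lemma co_zero: "i < n \<Longrightarrow> co i \<zero>\<^bsub>W\<^esub> = \<zero>\<^bsub>R\<^esub>"
  using lin_maps_zero[OF mod self co_lin] by simp

definition lmap :: "(nat \<Rightarrow> 'b) \<Rightarrow> 'b \<Rightarrow> 'b" where
  "lmap v = (\<lambda>x\<in>carrier W. \<Oplus>\<^bsub>W\<^esub>i\<in>{..<n}. co i x \<odot>\<^bsub>W\<^esub> v i)"

lemma lmap_lin:
  assumes "\<And>i. i < n \<Longrightarrow> v i \<in> carrier W"
  shows "lmap v \<in> lin_maps R W W"
  unfolding lmap_def
proof (rule restrict_lin_mapsI[OF mod])
  fix x assume x: "x \<in> carrier W"
  show "(\<Oplus>\<^bsub>W\<^esub>i\<in>{..<n}. co i x \<odot>\<^bsub>W\<^esub> v i) \<in> carrier W"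
    by (rule M.finsum_closed) (auto simp: assms co_closed x)
  fix y assume y: "y \<in> carrier W"
  have "(\<Oplus>\<^bsub>W\<^esub>i\<in>{..<n}. co i (x \<oplus>\<^bsub>W\<^esub> y) \<odot>\<^bsub>W\<^esub> v i) =
      (\<Oplus>\<^bsub>W\<^esub>i\<in>{..<n}. co i x \<odot>\<^bsub>W\<^esub> v i \<oplus>\<^bsub>W\<^esub> co i y \<odot>\<^bsub>W\<^esub> v i)"
    by (rule M.finsum_cong'[OF refl]) (auto simp: assms co_closed x y co_add smult_l_distr)
  also have "\<dots> = (\<Oplus>\<^bsub>W\<^esub>i\<in>{..<n}. co i x \<odot>\<^bsub>W\<^esub> v i) \<oplus>\<^bsub>W\<^esub> (\<Oplus>\<^bsub>W\<^esub>i\<in>{..<n}. co i y \<odot>\<^bsub>W\<^esub> v i)"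
    by (rule M.finsum_addf) (auto simp: assms co_closed x y)
  finally show "(\<Oplus>\<^bsub>W\<^esub>i\<in>{..<n}. co i (x \<oplus>\<^bsub>W\<^esub> y) \<odot>\<^bsub>W\<^esub> v i) =
    (\<Oplus>\<^bsub>W\<^esub>i\<in>{..<n}. co i x \<odot>\<^bsub>W\<^esub> v i) \<oplus>\<^bsub>W\<^esub> (\<Oplus>\<^bsub>W\<^esub>i\<in>{..<n}. co i y \<odot>\<^bsub>W\<^esub> v i)" .
next
  fix a x assume a: "a \<in> carrier R" and x: "x \<in> carrier W"
  have "(\<Oplus>\<^bsub>W\<^esub>i\<in>{..<n}. co i (a \<odot>\<^bsub>W\<^esub> x) \<odot>\<^bsub>W\<^esub> v i) = (\<Oplus>\<^bsub>W\<^esub>i\<in>{..<n}. a \<odot>\<^bsub>W\<^esub> (co i x \<odot>\<^bsub>W\<^esub> v i))"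
    by (rule M.finsum_cong'[OF refl]) (auto simp: assms co_closed x a co_smult smult_assoc1)
  also have "\<dots> = a \<odot>\<^bsub>W\<^esub> (\<Oplus>\<^bsub>W\<^esub>i\<in>{..<n}. co i x \<odot>\<^bsub>W\<^esub> v i)"
    by (rule finsum_smult_ldistr[symmetric]) (auto simp: assms co_closed x a)
  finally show "(\<Oplus>\<^bsub>W\<^esub>i\<in>{..<n}. co i (a \<odot>\<^bsub>W\<^esub> x) \<odot>\<^bsub>W\<^esub> v i) =
    a \<odot>\<^bsub>W\<^esub> (\<Oplus>\<^bsub>W\<^esub>i\<in>{..<n}. co i x \<odot>\<^bsub>W\<^esub> v i)" .
qed

lemma lmap_e:
  assumes "\<And>i. i < n \<Longrightarrow> v i \<in> carrier W" "j < n"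
  shows "lmap v (e j) = v j"
proof -
  have "lmap v (e j) = (\<Oplus>\<^bsub>W\<^esub>i\<in>{..<n}. if j = i then v i else \<zero>\<^bsub>W\<^esub>)"
    unfolding lmap_def using assms e_closed co_e
    by (simp, intro M.finsum_cong'[OF refl]) (auto simp: co_closed)
  also have "\<dots> = v j" by (rule M.finsum_singleton) (use assms in auto)
  finally show ?thesis .
qed

lemma lin_maps_eq_on_basis:
  assumes "module R N" "h \<in> lin_maps R W N" "h' \<in> lin_maps R W N" "\<And>i. i < n \<Longrightarrow> h (e i) = h' (e i)"
  shows "h = h'"
  by (rule lin_maps_eq_on_generators[OF mod assms(1) e_generates assms(2,3)]) (use assms(4) in auto)

lemma id_lin: "(\<lambda>x\<in>carrier W. x) \<in> lin_maps R W W"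
  by (rule restrict_lin_mapsI[OF mod]) auto

text \<open>The map \<open>lmap e\<close> is the identity, since it is so on the basis; hence an
  element is rebuilt from its coordinates.\<close>

lemma co_eqI:
  assumes "x \<in> carrier W" "y \<in> carrier W" "\<And>i. i < n \<Longrightarrow> co i x = co i y"
  shows "x = y"
proof -
  have "lmap e = (\<lambda>x\<in>carrier W. x)"
    by (rule lin_maps_eq_on_basis[OF mod lmap_lin id_lin]) (auto simp: e_closed lmap_e)
  then have "x = lmap e x" "y = lmap e y" using assms by (auto simp: fun_eq_iff)
  moreover have "lmap e x = lmap e y"
    unfolding lmap_def using assms(1,2)
    by (simp, intro M.finsum_cong'[OF refl]) (auto simp: assms(3) co_closed e_closed)
  ultimately show ?thesis by simp
qed

lemma lin_maps_co_eqI: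
  assumes "X \<in> lin_maps R W W" "Y \<in> lin_maps R W W"
    "\<And>i j. i < n \<Longrightarrow> j < n \<Longrightarrow> co i (X (e j)) = co i (Y (e j))"
  shows "X = Y"
proof (rule lin_maps_eq_on_basis[OF mod assms(1,2)])
  show "X (e j) = Y (e j)" if j: "j < n" for j
    by (rule co_eqI[OF lin_maps_closed[OF assms(1) e_closed[OF j]] lin_maps_closed[OF assms(2) e_closed[OF j]]])
      (rule assms(3)[OF _ j])
qed

text \<open>Identifies a row of the matrix of \<open>g\<close>, as a functional, from its values on
  the basis.\<close>

lemma co_comp:
  assumes "g \<in> lin_maps R W W" "h \<in> lin_maps R W (self_mod R)" "c < n"
    and "\<And>j. j < n \<Longrightarrow> co c (g (e j)) = h (e j)" and "x \<in> carrier W"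
  shows "co c (g x) = h x"
proof -
  have "compose (carrier W) (co c) g = h"
    by (rule lin_maps_eq_on_basis[OF self lin_maps_compose[OF mod assms(1) co_lin[OF assms(3)]] assms(2)])
      (use assms(4) e_closed in \<open>simp add: compose_eq\<close>)
  then show ?thesis using assms(5) by (metis compose_eq)
qed


section \<open>Determinants\<close>

definition det_term :: "'b list \<Rightarrow> (nat \<Rightarrow> nat) \<Rightarrow> 'a" where
  "det_term xs \<sigma> = (\<Otimes>\<^bsub>R\<^esub>i\<in>{..<n}. co (\<sigma> i) (xs ! i))"

text \<open>The Leibniz expansion. It serves to read off the coefficient of the wedge of the basis
  in the top exterior power.\<close>

definition det_form :: "'b list \<Rightarrow> 'a" where
  "det_form xs = (\<Oplus>\<^bsub>R\<^esub>\<sigma>\<in>{\<sigma>. \<sigma> permutes {..<n}}.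
     (if evenperm \<sigma> then \<one>\<^bsub>R\<^esub> else \<ominus>\<^bsub>R\<^esub> \<one>\<^bsub>R\<^esub>) \<otimes>\<^bsub>R\<^esub> det_term xs \<sigma>)"

lemma permutes_less: "\<sigma> permutes {..<n} \<Longrightarrow> i < n \<Longrightarrow> \<sigma> i < n"
  using permutes_in_image[of \<sigma> "{..<n}" i] by simp

lemma det_term_closed:
  "xs \<in> words W n \<Longrightarrow> \<sigma> permutes {..<n} \<Longrightarrow> det_term xs \<sigma> \<in> carrier R"
  unfolding det_term_def by (rule R.finprod_closed) (simp add: co_closed permutes_less words_nth[of xs W n])

lemma det_term_update:
  assumes "xs \<in> words W n" "\<sigma> permutes {..<n}" "i < n" "x \<in> carrier W"
  shows "det_term (xs[i := x]) \<sigma> =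
    co (\<sigma> i) x \<otimes>\<^bsub>R\<^esub> (\<Otimes>\<^bsub>R\<^esub>j\<in>{..<n} - {i}. co (\<sigma> j) (xs ! j))"
    and "(\<Otimes>\<^bsub>R\<^esub>j\<in>{..<n} - {i}. co (\<sigma> j) (xs ! j)) \<in> carrier R"
proof -
  have len: "length xs = n" using assms(1) by (simp add: words_def)
  have c: "\<And>j. j < n \<Longrightarrow> co (\<sigma> j) (xs ! j) \<in> carrier R"
    by (rule co_closed[OF permutes_less[OF assms(2)] words_nth[OF assms(1)]])
  have "{..<n} = insert i ({..<n} - {i})" using assms(3) by auto
  then have "det_term (xs[i := x]) \<sigma> = (\<Otimes>\<^bsub>R\<^esub>j\<in>insert i ({..<n} - {i}). co (\<sigma> j) (xs[i := x] ! j))"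
    unfolding det_term_def by simp
  also have "\<dots> = co (\<sigma> i) x \<otimes>\<^bsub>R\<^esub> (\<Otimes>\<^bsub>R\<^esub>j\<in>{..<n} - {i}. co (\<sigma> j) (xs[i := x] ! j))"
    by (subst R.finprod_insert)
      (use assms c len permutes_less[OF assms(2)] in \<open>auto simp: co_closed\<close>)
  also have "(\<Otimes>\<^bsub>R\<^esub>j\<in>{..<n} - {i}. co (\<sigma> j) (xs[i := x] ! j)) = (\<Otimes>\<^bsub>R\<^esub>j\<in>{..<n} - {i}. co (\<sigma> j) (xs ! j))"
    by (rule R.finprod_cong'[OF refl]) (use c in auto)
  finally show "det_term (xs[i := x]) \<sigma> =
    co (\<sigma> i) x \<otimes>\<^bsub>R\<^esub> (\<Otimes>\<^bsub>R\<^esub>j\<in>{..<n} - {i}. co (\<sigma> j) (xs ! j))" .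
  show "(\<Otimes>\<^bsub>R\<^esub>j\<in>{..<n} - {i}. co (\<sigma> j) (xs ! j)) \<in> carrier R"
    by (rule R.finprod_closed) (use c in auto)
qed

lemma det_form_multilinear: "multilinear R n W (self_mod R) det_form"
proof (rule multilinearI)
  let ?P = "{\<sigma>. \<sigma> permutes {..<n}}"
  let ?s = "\<lambda>\<sigma>. if evenperm \<sigma> then \<one>\<^bsub>R\<^esub> else \<ominus>\<^bsub>R\<^esub> \<one>\<^bsub>R\<^esub>"
  have fin: "finite ?P" by (simp add: finite_permutations)
  fix xs assume xs: "xs \<in> words W n"
  show "det_form xs \<in> carrier (self_mod R)"
    unfolding det_form_def self_mod_simps
    by (rule R.finsum_closed) (auto simp: det_term_closed xs)
  fix i x assume i: "i < n" and x: "x \<in> carrier W"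
  note u = det_term_update[OF xs _ i]
  {
    fix y assume y: "y \<in> carrier W"
    have "det_form (xs[i := x \<oplus>\<^bsub>W\<^esub> y]) =
      (\<Oplus>\<^bsub>R\<^esub>\<sigma>\<in>?P. ?s \<sigma> \<otimes>\<^bsub>R\<^esub> det_term (xs[i := x]) \<sigma> \<oplus>\<^bsub>R\<^esub> ?s \<sigma> \<otimes>\<^bsub>R\<^esub> det_term (xs[i := y]) \<sigma>)"
      unfolding det_form_def
    proof (rule R.finsum_cong'[OF refl])
      fix \<sigma> assume s: "\<sigma> \<in> ?P"
      then show "?s \<sigma> \<otimes>\<^bsub>R\<^esub> det_term (xs[i := x \<oplus>\<^bsub>W\<^esub> y]) \<sigma> =
        ?s \<sigma> \<otimes>\<^bsub>R\<^esub> det_term (xs[i := x]) \<sigma> \<oplus>\<^bsub>R\<^esub> ?s \<sigma> \<otimes>\<^bsub>R\<^esub> det_term (xs[i := y]) \<sigma>"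
        using u[of \<sigma>] x y permutes_less[of \<sigma> i] i
        by (simp add: co_add co_closed R.l_distr R.r_distr R.minus_add R.l_minus)
    qed (auto simp: det_term_closed xs x y words_update)
    also have "\<dots> = det_form (xs[i := x]) \<oplus>\<^bsub>R\<^esub> det_form (xs[i := y])"
      unfolding det_form_def
      by (rule R.finsum_addf) (auto simp: det_term_closed xs x y words_update)
    finally show "det_form (xs[i := x \<oplus>\<^bsub>W\<^esub> y]) =
      det_form (xs[i := x]) \<oplus>\<^bsub>self_mod R\<^esub> det_form (xs[i := y])" by simp
  }
  fix a assume a: "a \<in> carrier R"
  have "det_form (xs[i := a \<odot>\<^bsub>W\<^esub> x]) = (\<Oplus>\<^bsub>R\<^esub>\<sigma>\<in>?P. a \<otimes>\<^bsub>R\<^esub> (?s \<sigma> \<otimes>\<^bsub>R\<^esub> det_term (xs[i := x]) \<sigma>))"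
    unfolding det_form_def
  proof (rule R.finsum_cong'[OF refl])
    fix \<sigma> assume s: "\<sigma> \<in> ?P"
    then show "?s \<sigma> \<otimes>\<^bsub>R\<^esub> det_term (xs[i := a \<odot>\<^bsub>W\<^esub> x]) \<sigma> = a \<otimes>\<^bsub>R\<^esub> (?s \<sigma> \<otimes>\<^bsub>R\<^esub> det_term (xs[i := x]) \<sigma>)"
      using u[of \<sigma>] x a permutes_less[of \<sigma> i] i
      by (simp add: co_smult co_closed R.m_assoc R.l_minus R.r_minus)
  qed (auto simp: det_term_closed xs x a words_update)
  also have "\<dots> = a \<otimes>\<^bsub>R\<^esub> det_form (xs[i := x])"
    unfolding det_form_def
    by (rule R.finsum_rdistr[symmetric]) (auto simp: fin a det_term_closed xs x words_update)
  finally show "det_form (xs[i := a \<odot>\<^bsub>W\<^esub> x]) = a \<odot>\<^bsub>self_mod R\<^esub> det_form (xs[i := x])" by simp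
qed

text \<open>The term of an even \<sigma> cancels against that of \<sigma> composed with the
  transposition of two equal entries. Pairing terms, rather than deriving that the sum equals its
  own negative, is valid in every commutative ring.\<close>

lemma det_form_alternating: "alternating n W (self_mod R) det_form"
  unfolding alternating_def
proof (intro ballI impI)
  fix xs assume xs: "xs \<in> words W n" "\<not> distinct xs"
  then obtain i j where ij: "i < n" "j < n" "i \<noteq> j" "xs ! i = xs ! j"
    by (auto simp: distinct_conv_nth words_def)
  let ?t = "transpose i j"
  let ?P = "{\<sigma>. \<sigma> permutes {..<n}}"
  let ?E = "{\<sigma>. \<sigma> permutes {..<n} \<and> evenperm \<sigma>}" and ?O = "{\<sigma>. \<sigma> permutes {..<n} \<and> \<not> evenperm \<sigma>}"
  let ?s = "\<lambda>\<sigma>. if evenperm \<sigma> then \<one>\<^bsub>R\<^esub> else \<ominus>\<^bsub>R\<^esub> \<one>\<^bsub>R\<^esub>"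
  have t: "?t permutes {..<n}" using ij by (intro permutes_swap_id) auto
  have tev: "evenperm (\<sigma> \<circ> ?t) \<longleftrightarrow> \<not> evenperm \<sigma>" if "\<sigma> permutes {..<n}" for \<sigma>
    using that t ij(3) permutation_permutes finite_lessThan
    by (subst evenperm_comp) (auto simp: evenperm_swap)
  have fin: "finite ?P" by (simp add: finite_permutations)
  have PEO: "?P = ?E \<union> ?O" by auto
  have O: "?O = (\<lambda>\<sigma>. \<sigma> \<circ> ?t) ` ?E"
  proof (intro equalityI subsetI)
    fix \<sigma> assume "\<sigma> \<in> ?O"
    then have "\<sigma> \<circ> ?t \<in> ?E" "\<sigma> = (\<sigma> \<circ> ?t) \<circ> ?t"
      using t tev by (auto intro: permutes_compose simp: comp_assoc)
    then show "\<sigma> \<in> (\<lambda>\<sigma>. \<sigma> \<circ> ?t) ` ?E" by blast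
  qed (use t tev in \<open>auto intro: permutes_compose\<close>)
  have inj: "inj_on (\<lambda>\<sigma>. \<sigma> \<circ> ?t) ?E"
    by (rule inj_onI) (metis comp_assoc comp_id transpose_comp_involutory)
  note c = det_term_closed[OF xs(1)]
  \<comment> \<open>Reindexing the product by the transposition exchanges the factors at
    \<open>i\<close> and \<open>j\<close>, and the entries there agree.\<close>
  have sw: "det_term xs (\<sigma> \<circ> ?t) = det_term xs \<sigma>" if s: "\<sigma> permutes {..<n}" for \<sigma>
  proof -
    have cc: "co (\<sigma> m) (xs ! m') \<in> carrier R" if "m < n" "m' < n" for m m'
      using co_closed[OF permutes_less[OF s that(1)] words_nth[OF xs(1) that(2)]] .
    note tl = permutes_less[OF t]
    have "det_term xs \<sigma> = (\<Otimes>\<^bsub>R\<^esub>m\<in>?t ` {..<n}. co (\<sigma> m) (xs ! m))"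
      unfolding det_term_def permutes_image[OF t] ..
    also have "\<dots> = (\<Otimes>\<^bsub>R\<^esub>m\<in>{..<n}. co (\<sigma> (?t m)) (xs ! ?t m))"
      by (rule R.finprod_reindex)
        (auto simp: permutes_image[OF t] permutes_inj_on[OF t] cc)
    also have "\<dots> = det_term xs (\<sigma> \<circ> ?t)"
      unfolding det_term_def
      by (rule R.finprod_cong'[OF refl])
        (use ij in \<open>auto simp: cc tl transpose_def\<close>)
    finally show ?thesis by simp
  qed
  have "det_form xs = (\<Oplus>\<^bsub>R\<^esub>\<sigma>\<in>?E. ?s \<sigma> \<otimes>\<^bsub>R\<^esub> det_term xs \<sigma>) \<oplus>\<^bsub>R\<^esub> (\<Oplus>\<^bsub>R\<^esub>\<sigma>\<in>?O. ?s \<sigma> \<otimes>\<^bsub>R\<^esub> det_term xs \<sigma>)"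
    unfolding det_form_def PEO
    by (rule R.finsum_Un_disjoint) (use fin c in auto)
  also have "(\<Oplus>\<^bsub>R\<^esub>\<sigma>\<in>?O. ?s \<sigma> \<otimes>\<^bsub>R\<^esub> det_term xs \<sigma>) =
      (\<Oplus>\<^bsub>R\<^esub>\<sigma>\<in>?E. ?s (\<sigma> \<circ> ?t) \<otimes>\<^bsub>R\<^esub> det_term xs (\<sigma> \<circ> ?t))"
    unfolding O by (rule R.finsum_reindex[OF _ inj]) (auto simp: c permutes_compose[OF t])
  also have "(\<Oplus>\<^bsub>R\<^esub>\<sigma>\<in>?E. ?s \<sigma> \<otimes>\<^bsub>R\<^esub> det_term xs \<sigma>) \<oplus>\<^bsub>R\<^esub> \<dots> =
      (\<Oplus>\<^bsub>R\<^esub>\<sigma>\<in>?E. ?s \<sigma> \<otimes>\<^bsub>R\<^esub> det_term xs \<sigma> \<oplus>\<^bsub>R\<^esub> ?s (\<sigma> \<circ> ?t) \<otimes>\<^bsub>R\<^esub> det_term xs (\<sigma> \<circ> ?t))"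
    by (rule R.finsum_addf[symmetric]) (auto simp: c permutes_compose[OF t])
  also have "\<dots> = (\<Oplus>\<^bsub>R\<^esub>\<sigma>\<in>?E. \<zero>\<^bsub>R\<^esub>)"
    by (rule R.finsum_cong'[OF refl]) (auto simp: c sw tev R.l_minus R.r_neg)
  finally show "det_form xs = \<zero>\<^bsub>self_mod R\<^esub>" by simp
qed

abbreviation basis_word :: "'b list" where "basis_word \<equiv> map e [0..<n]"

lemma basis_word_words: "basis_word \<in> words W n"
  using e_closed by (auto simp: words_def)

lemma det_form_basis: "det_form basis_word = \<one>\<^bsub>R\<^esub>"
proof -
  let ?P = "{\<sigma>. \<sigma> permutes {..<n}}"
  note c = det_term_closed[OF basis_word_words]
  have "det_term basis_word \<sigma> = \<zero>\<^bsub>R\<^esub>" if s: "\<sigma> permutes {..<n}" "\<sigma> \<noteq> id" for \<sigma>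
  proof -
    obtain i where i: "\<sigma> i \<noteq> i" using s(2) by (auto simp: fun_eq_iff)
    then have "i < n" using s(1) by (auto simp: permutes_def)
    \<comment> \<open>Writing the word as an update at \<open>i\<close> lets
      \<open>det_term_update\<close> isolate the factor at \<open>i\<close>, an off-diagonal
      coordinate and hence zero.\<close>
    have "basis_word[i := e i] = basis_word" using \<open>i < n\<close>
      using list_update_id[of basis_word i] by simp
    then show ?thesis
      using det_term_update[OF basis_word_words s(1) \<open>i < n\<close> e_closed[OF \<open>i < n\<close>]] i \<open>i < n\<close>
        permutes_less[OF s(1) \<open>i < n\<close>] by (simp add: co_e)
  qed
  moreover have "det_term basis_word id = \<one>\<^bsub>R\<^esub>"
    unfolding det_term_def by (rule R.finprod_one_eqI) (simp add: co_e)
  ultimately have "det_form basis_word = (\<Oplus>\<^bsub>R\<^esub>\<sigma>\<in>?P. if id = \<sigma> then \<one>\<^bsub>R\<^esub> else \<zero>\<^bsub>R\<^esub>)"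
    unfolding det_form_def by (intro R.finsum_cong'[OF refl]) (auto simp: evenperm_id)
  also have "\<dots> = \<one>\<^bsub>R\<^esub>"
    by (rule R.finsum_singleton) (auto simp: finite_permutations permutes_id)
  finally show ?thesis .
qed

end

section \<open>Points of the general linear group and conjugation of endomorphisms\<close>

lemma lin_maps_ball_closed: "h \<in> lin_maps R M N \<Longrightarrow> h ` carrier M \<subseteq> carrier N"
  unfolding lin_maps_def module_hom_def by auto

lemma GL_points_inv:
  assumes "g \<in> GL_points R W" "y \<in> carrier W"
  shows "inv_into (carrier W) g y \<in> carrier W" "g (inv_into (carrier W) g y) = y"
  using assms unfolding GL_points_def bij_betw_def
  by (auto intro: inv_into_into f_inv_into_f)

lemma GL_points_inv_f:
  assumes "g \<in> GL_points R W" "x \<in> carrier W"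
  shows "inv_into (carrier W) g (g x) = x"
  using assms unfolding GL_points_def bij_betw_def by auto

definition conj_act :: "('t, 'w) module \<Rightarrow> ('w \<Rightarrow> 'w) \<Rightarrow> ('w \<Rightarrow> 'w) \<Rightarrow> 'w \<Rightarrow> 'w" where
  "conj_act W g X = (\<lambda>y\<in>carrier W. g (X (inv_into (carrier W) g y)))"

lemma conj_act_semilinear:
  assumes W: "module R W" and g: "g \<in> GL_points R W"
  shows "semilinear R id (end_mod R W) (end_mod R W) (conj_act W g)"
proof -
  interpret module R W by (rule W)
  have gl: "g \<in> lin_maps R W W" using g by (simp add: GL_points_def)
  note gi = GL_points_inv[OF g]
  have inj: "x = y" if "g x = g y" "x \<in> carrier W" "y \<in> carrier W" for x y
    using that GL_points_inv_f[OF g] by metis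
  \<comment> \<open>Linearity of the inverse is checked after applying the injective map
    \<open>g\<close>.\<close>
  have inv_add: "inv_into (carrier W) g (x \<oplus>\<^bsub>W\<^esub> y) =
      inv_into (carrier W) g x \<oplus>\<^bsub>W\<^esub> inv_into (carrier W) g y"
    if "x \<in> carrier W" "y \<in> carrier W" for x y
    by (rule inj) (use that in \<open>simp_all add: gi lin_maps_add[OF gl]\<close>)
  have inv_smult: "inv_into (carrier W) g (a \<odot>\<^bsub>W\<^esub> x) = a \<odot>\<^bsub>W\<^esub> inv_into (carrier W) g x"
    if "a \<in> carrier R" "x \<in> carrier W" for a x
    by (rule inj) (use that in \<open>simp_all add: gi lin_maps_smult[OF gl]\<close>)
  have cl: "conj_act W g X \<in> lin_maps R W W" if X: "X \<in> lin_maps R W W" for X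
    unfolding conj_act_def
    by (rule restrict_lin_mapsI[OF W])
      (simp_all add: gi inv_add inv_smult lin_maps_add[OF gl] lin_maps_add[OF X]
        lin_maps_smult[OF gl] lin_maps_smult[OF X] lin_maps_closed[OF gl] lin_maps_closed[OF X])
  show ?thesis
    unfolding semilinear_def
  proof (intro conjI ballI)
    fix X Y assume "X \<in> carrier (end_mod R W)" "Y \<in> carrier (end_mod R W)"
    then have X: "X \<in> lin_maps R W W" and Y: "Y \<in> lin_maps R W W" by (simp_all add: end_mod_simps)
    show "conj_act W g (X \<oplus>\<^bsub>end_mod R W\<^esub> Y) = conj_act W g X \<oplus>\<^bsub>end_mod R W\<^esub> conj_act W g Y"
      unfolding end_mod_simps conj_act_def
      by (rule restrict_ext)
        (simp add: gi lin_maps_closed[OF X] lin_maps_closed[OF Y] lin_maps_add[OF gl])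
  next
    fix a X assume a: "a \<in> carrier R" and "X \<in> carrier (end_mod R W)"
    then have X: "X \<in> lin_maps R W W" by (simp add: end_mod_simps)
    show "conj_act W g (a \<odot>\<^bsub>end_mod R W\<^esub> X) = id a \<odot>\<^bsub>end_mod R W\<^esub> conj_act W g X"
      unfolding end_mod_simps conj_act_def
      by (rule restrict_ext) (simp add: gi lin_maps_closed[OF X] lin_maps_smult[OF gl] a)
  qed (simp add: end_mod_simps cl)
qed

lemma ring_hom_id: "id \<in> ring_hom R R"
  by (auto intro!: ring_hom_memI)

section \<open>Matrix coefficients on endomorphisms tensored with the top exterior power\<close>

context based_module
begin

abbreviation "Lam \<equiv> ext_power R n W"
abbreviation "Tgt \<equiv> tensor_mod R (end_mod R W) Lam"
abbreviation "vol \<equiv> wedge R n W basis_word"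
abbreviation "tens \<equiv> tensor_elt R (end_mod R W) Lam"

lemma Lam: "module R Lam" by (rule ext_power_module[OF mod])
lemma Tgt: "module R Tgt" by (rule tensor_mod_module[OF end_mod_module[OF mod] Lam])

lemma vol_closed: "vol \<in> carrier Lam"
  by (rule multilinear_closed[OF wedge_multilinear[OF mod] basis_word_words])

text \<open>Permuting the entries changes a wedge by a sign, and submodules are closed under signs.
  Asking only for membership avoids keeping track of the parity of \<sigma>.\<close>

lemma wedge_permute_mem:
  assumes "LinearCombinations.submodule R N Lam" "\<sigma> permutes {..<n}"
    "xs \<in> words W n" "wedge R n W xs \<in> N"
  shows "wedge R n W (permute_list \<sigma> xs) \<in> N"
proof -
  interpret N: LinearCombinations.submodule R N Lam by (rule assms(1))
  interpret L: module R Lam by (rule Lam)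
  have "\<forall>xs. xs \<in> words W n \<longrightarrow> wedge R n W xs \<in> N \<longrightarrow> wedge R n W (permute_list \<sigma> xs) \<in> N"
    using assms(2) finite_lessThan
  proof (induct rule: permutes_induct)
    case id
    then show ?case by simp
  next
    case (swap a b p)
    show ?case
    proof (intro allI impI)
      fix xs assume xs: "xs \<in> words W n" and N: "wedge R n W xs \<in> N"
      have len: "length xs = n" using xs by (simp add: words_def)
      have ab: "a < n" "b < n" "a \<noteq> b" using swap by auto
      let ?ys = "xs[a := xs ! b, b := xs ! a]"
      have "permute_list (transpose a b) xs = ?ys"
        using ab len by (intro nth_equalityI) (auto simp: permute_list_def nth_list_update transpose_def)
      moreover have "?ys \<in> words W n" using xs ab by (intro words_update) (auto simp: words_nth)
      moreover have "wedge R n W ?ys \<in> N"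
      proof -
        have "wedge R n W ?ys = \<ominus>\<^bsub>Lam\<^esub> wedge R n W xs"
          by (rule alternating_swap[OF mod Lam wedge_multilinear[OF mod] wedge_alternating[OF mod] xs ab])
        also have "\<dots> = (\<ominus>\<^bsub>R\<^esub> \<one>\<^bsub>R\<^esub>) \<odot>\<^bsub>Lam\<^esub> wedge R n W xs"
          using N N.subset by (simp add: L.smult_minus_1 subset_iff)
        finally show ?thesis using N by simp
      qed
      ultimately show "wedge R n W (permute_list (transpose a b \<circ> p) xs) \<in> N"
        using swap(4) swap(5) len by (simp add: permute_list_compose)
    qed
  qed
  then show ?thesis using assms by blast
qed

text \<open>Wedges of basis words generate. One with a repeated factor is zero; any other uses each
  basis vector exactly once and is a permutation of \<open>basis_word\<close>.\<close>

lemma vol_generates: "generates R Lam {vol}"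
proof (rule generates_trans[OF Lam multilinear_generates[OF mod Lam wedge_multilinear[OF mod]
        wedge_generates[OF mod] e_generates]])
  show "{vol} \<subseteq> carrier Lam" using vol_closed by simp
  fix N assume N: "LinearCombinations.submodule R N Lam" "{vol} \<subseteq> N"
  interpret N: LinearCombinations.submodule R N Lam by (rule N(1))
  show "wedge R n W ` {xs. length xs = n \<and> set xs \<subseteq> e ` {..<n}} \<subseteq> N"
  proof (rule image_subsetI)
    fix xs assume "xs \<in> {xs. length xs = n \<and> set xs \<subseteq> e ` {..<n}}"
    then have xs: "length xs = n" "set xs \<subseteq> e ` {..<n}" by auto
    then have "xs \<in> map e ` lists {..<n}" by (simp add: lists_image[symmetric] in_lists_conv_set subset_iff)
    then obtain v where v: "xs = map e v" "set v \<subseteq> {..<n}" by (auto simp: in_lists_conv_set)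
    have w: "xs \<in> words W n" using xs v e_closed by (auto simp: words_def)
    show "wedge R n W xs \<in> N"
    proof (cases "distinct xs")
      case False
      then show ?thesis using wedge_alternating[OF mod] w unfolding alternating_def by simp
    next
      case True
      then have d: "distinct v" using v by (simp add: distinct_map)
      have "set v = {..<n}" using d v xs by (intro card_subset_eq) (auto simp: distinct_card)
      then have "mset v = mset [0..<n]"
        using set_eq_iff_mset_eq_distinct[OF d, of "[0..<n]"] by (simp add: atLeast0LessThan)
      then obtain \<sigma> where \<sigma>: "\<sigma> permutes {..<length [0..<n]}" "permute_list \<sigma> [0..<n] = v"
        by (rule mset_eq_permutation)
      then have "xs = permute_list \<sigma> basis_word" using v by (simp add: permute_list_map)
      then show ?thesis using wedge_permute_mem[OF N(1) _ basis_word_words] \<sigma> N(2) by simp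
    qed
  qed
qed

lemma Lam_multiple:
  assumes "\<eta> \<in> carrier Lam"
  shows "\<exists>c\<in>carrier R. \<eta> = c \<odot>\<^bsub>Lam\<^esub> vol"
proof -
  interpret L: module R Lam by (rule Lam)
  show ?thesis
    using Lam vol_generates assms
  proof (induct rule: generates_induct)
    case zero
    show ?case by (rule bexI[of _ "\<zero>\<^bsub>R\<^esub>"]) (simp_all add: vol_closed)
  next
    case (add x y)
    then show ?case using vol_closed L.smult_l_distr[symmetric] by (metis R.add.m_closed)
  next
    case (smult a x)
    then show ?case using vol_closed L.smult_assoc1[symmetric] by (metis R.m_closed)
  next
    case (gen x)
    then show ?case by (intro bexI[of _ "\<one>\<^bsub>R\<^esub>"]) (simp_all add: vol_closed)
  qed
qed

lemma tens_zero: "tens (\<lambda>x\<in>carrier W. \<zero>\<^bsub>W\<^esub>) vol = \<zero>\<^bsub>Tgt\<^esub>"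
proof -
  interpret E: module R "end_mod R W" by (rule end_mod_module[OF mod])
  interpret T: module R Tgt by (rule Tgt)
  note b = bilinearD[OF tensor_elt_bilinear[OF E.module_axioms Lam]]
  have "tens (\<zero>\<^bsub>R\<^esub> \<odot>\<^bsub>end_mod R W\<^esub> \<zero>\<^bsub>end_mod R W\<^esub>) vol = \<zero>\<^bsub>R\<^esub> \<odot>\<^bsub>Tgt\<^esub> tens \<zero>\<^bsub>end_mod R W\<^esub> vol"
    by (rule b) (auto simp: vol_closed)
  then have "tens \<zero>\<^bsub>end_mod R W\<^esub> vol = \<zero>\<^bsub>Tgt\<^esub>" using b(1)[OF E.M.zero_closed vol_closed] by simp
  then show ?thesis by (simp only: end_mod_simps(2))
qed

text \<open>The second tensor factor is a multiple of \<open>vol\<close>, and the scalar can be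
  moved into the endomorphism.\<close>

lemma Tgt_elt:
  assumes "\<tau> \<in> carrier Tgt"
  shows "\<exists>X\<in>lin_maps R W W. \<tau> = tens X vol"
proof -
  interpret E: module R "end_mod R W" by (rule end_mod_module[OF mod])
  note b = bilinearD[OF tensor_elt_bilinear[OF E.module_axioms Lam]]
  have "\<exists>X\<in>carrier (end_mod R W). \<tau> = tens X vol"
    using Tgt tensor_elt_generates[OF E.module_axioms Lam] assms
  proof (induct rule: generates_induct)
    case zero
    have "tens \<zero>\<^bsub>end_mod R W\<^esub> vol = \<zero>\<^bsub>Tgt\<^esub>" using tens_zero by (simp only: end_mod_simps(2))
    then show ?case using E.M.zero_closed by metis
  next
    case (add x y)
    then show ?case using b(2)[OF _ _ vol_closed] by (metis E.M.add.m_closed)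
  next
    case (smult a x)
    then show ?case using b(4)[OF _ _ vol_closed] by (metis E.smult_closed)
  next
    case (gen \<tau>)
    then obtain X \<eta> where X: "X \<in> carrier (end_mod R W)" "\<eta> \<in> carrier Lam" "\<tau> = tens X \<eta>" by auto
    obtain c where c: "c \<in> carrier R" "\<eta> = c \<odot>\<^bsub>Lam\<^esub> vol" using Lam_multiple[OF X(2)] by blast
    have "\<tau> = tens (c \<odot>\<^bsub>end_mod R W\<^esub> X) vol"
      using X(3) c b(4)[OF c(1) X(1) vol_closed] b(5)[OF c(1) X(1) vol_closed] by simp
    then show ?case using E.smult_closed[OF c(1) X(1)] by blast
  qed
  then show ?thesis by (simp add: end_mod_simps(1))
qed

text \<open>The matrix entry in row \<open>a\<close> and column \<open>b\<close>, once
  \<open>vol\<close> is used to identify the tensor product with the endomorphisms. The two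
  properties in the choice determine the functional, because every element has the form
  \<open>tens X vol\<close>.\<close>

definition coef :: "nat \<Rightarrow> nat \<Rightarrow> (('b \<Rightarrow> 'b) \<times> ('b list \<Rightarrow> 'a) set set \<Rightarrow> 'a) set \<Rightarrow> 'a" where
  "coef a b = (SOME h. h \<in> lin_maps R Tgt (self_mod R) \<and>
     (\<forall>X\<in>lin_maps R W W. h (tens X vol) = co a (X (e b))))"

text \<open>The functional is induced by multiplying the matrix entry of the endomorphism by the
  determinant \<open>D\<close> of the second factor. As \<open>D\<close> is one on
  \<open>vol\<close>, it returns the bare entry; this also shows that \<open>tens X vol\<close>
  remembers \<open>X\<close>.\<close>

lemma coef_exists:
  assumes "a < n" "b < n"
  shows "\<exists>h. h \<in> lin_maps R Tgt (self_mod R) \<and>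
     (\<forall>X\<in>lin_maps R W W. h (tens X vol) = co a (X (e b)))"
proof -
  obtain D where D: "D \<in> lin_maps R Lam (self_mod R)"
    "\<And>xs. xs \<in> words W n \<Longrightarrow> D (wedge R n W xs) = det_form xs"
    using ext_power_lift[OF mod self det_form_multilinear det_form_alternating] by blast
  have X: "X (e b) \<in> carrier W" if "X \<in> lin_maps R W W" for X
    using lin_maps_closed[OF that e_closed[OF assms(2)]] .
  have "bilinear R (end_mod R W) Lam (self_mod R) (\<lambda>X \<eta>. co a (X (e b)) \<otimes>\<^bsub>R\<^esub> D \<eta>)"
    unfolding bilinear_def
    using assms e_closed lin_maps_closed[OF D(1)] lin_maps_add[OF D(1)] lin_maps_smult[OF D(1)]
    by (auto simp: end_mod_simps co_closed X co_add co_smult R.l_distr R.r_distr R.m_ac)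
  from tensor_mod_lift[OF end_mod_module[OF mod] Lam self this]
  obtain h where h: "h \<in> lin_maps R Tgt (self_mod R)"
    "\<And>X \<eta>. X \<in> lin_maps R W W \<Longrightarrow> \<eta> \<in> carrier Lam \<Longrightarrow> h (tens X \<eta>) = co a (X (e b)) \<otimes>\<^bsub>R\<^esub> D \<eta>"
    by (auto simp: end_mod_simps(1))
  show ?thesis
    by (rule exI[of _ h])
      (simp add: h vol_closed D(2)[OF basis_word_words] det_form_basis co_closed[OF assms(1)] X)
qed

lemma coef:
  assumes "a < n" "b < n"
  shows "coef a b \<in> lin_maps R Tgt (self_mod R)"
    "X \<in> lin_maps R W W \<Longrightarrow> coef a b (tens X vol) = co a (X (e b))"
  using someI_ex[OF coef_exists[OF assms], folded coef_def] by auto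

lemma Tgt_eq_zeroI:
  assumes "\<tau> \<in> carrier Tgt" "\<And>a b. a < n \<Longrightarrow> b < n \<Longrightarrow> coef a b \<tau> = \<zero>\<^bsub>R\<^esub>"
  shows "\<tau> = \<zero>\<^bsub>Tgt\<^esub>"
proof -
  obtain X where X: "X \<in> lin_maps R W W" "\<tau> = tens X vol" using Tgt_elt[OF assms(1)] by blast
  have "X = (\<lambda>x\<in>carrier W. \<zero>\<^bsub>W\<^esub>)"
    by (rule lin_maps_co_eqI[OF X(1) zero_lin_maps[OF mod mod]])
      (use assms(2) coef(2)[OF _ _ X(1)] X(2) in \<open>simp add: e_closed co_zero\<close>)
  then show ?thesis using X(2) tens_zero by simp
qed


section \<open>Some elements of the general linear group\<close>

text \<open>The action of the representation on the target, written for a module with a basis so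
  that the core argument need not mention \<open>gl_rep\<close>. The two are matched by
  \<open>end_det_act_eq\<close>.\<close>

definition act_Tgt where
  "act_Tgt g = tensor_map R R id (end_mod R W) Lam (end_mod R W) Lam (conj_act W g)
     (ext_power_map R R id n W W g)"

lemma GL_pointsI:
  assumes "g \<in> lin_maps R W W" "g' \<in> lin_maps R W W"
    "\<And>j. j < n \<Longrightarrow> g (g' (e j)) = e j" "\<And>j. j < n \<Longrightarrow> g' (g (e j)) = e j"
  shows "g \<in> GL_points R W" "x \<in> carrier W \<Longrightarrow> inv_into (carrier W) g x = g' x"
proof -
  have "compose (carrier W) g g' = (\<lambda>x\<in>carrier W. x)" "compose (carrier W) g' g = (\<lambda>x\<in>carrier W. x)"
    by (rule lin_maps_eq_on_basis[OF mod lin_maps_compose[OF mod] id_lin];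
        use assms e_closed in \<open>simp add: compose_eq\<close>)+
  then have gg': "g (g' x) = x" "g' (g x) = x" if "x \<in> carrier W" for x
    using that by (metis compose_eq restrict_apply')+
  have bij: "bij_betw g (carrier W) (carrier W)"
    by (rule bij_betw_byWitness[of _ g'])
      (simp_all add: gg' lin_maps_ball_closed[OF assms(1)] lin_maps_ball_closed[OF assms(2)])
  then show "g \<in> GL_points R W" using assms(1) by (simp add: GL_points_def)
  show "inv_into (carrier W) g x = g' x" if "x \<in> carrier W"
    by (rule inv_into_f_eq)
      (use bij that gg' lin_maps_closed[OF assms(2)] in \<open>auto simp: bij_betw_def\<close>)
qed

text \<open>The scalar \<open>s\<close> is the determinant of \<open>g\<close>, met here as its
  effect on \<open>vol\<close>. The inverse is passed as an explicit linear map \<open>g'\<close>,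
  which is easier to evaluate on basis vectors than \<open>inv_into\<close>.\<close>

lemma coef_act:
  assumes "g \<in> lin_maps R W W" "g' \<in> lin_maps R W W"
    "\<And>j. j < n \<Longrightarrow> g (g' (e j)) = e j" "\<And>j. j < n \<Longrightarrow> g' (g (e j)) = e j"
    and s: "s \<in> carrier R" "wedge R n W (map g basis_word) = s \<odot>\<^bsub>Lam\<^esub> vol"
    and X: "X \<in> lin_maps R W W" and a: "a < n"
  shows "coef a a (act_Tgt g (tens X vol)) = s \<otimes>\<^bsub>R\<^esub> co a (g (X (g' (e a))))"
proof -
  interpret E: module R "end_mod R W" by (rule end_mod_module[OF mod])
  have gl: "g \<in> GL_points R W" "\<And>x. x \<in> carrier W \<Longrightarrow> inv_into (carrier W) g x = g' x"
    using GL_pointsI[of g g'] assms(1-4) by simp_all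
  note b = bilinearD[OF tensor_elt_bilinear[OF E.module_axioms Lam]]
  let ?Y = "conj_act W g X"
  have Y: "?Y \<in> carrier (end_mod R W)"
    using semilinearD(1)[OF conj_act_semilinear[OF mod gl(1)]] X by (simp add: end_mod_simps(1))
  have "act_Tgt g (tens X vol) = tens ?Y (ext_power_map R R id n W W g vol)"
    unfolding act_Tgt_def
    by (rule tensor_map(2)[OF E.module_axioms Lam E.module_axioms Lam ring_hom_id
          conj_act_semilinear[OF mod gl(1)]
          ext_power_map(1)[OF mod mod ring_hom_id lin_maps_semilinear_id[OF assms(1)]]])
      (use X vol_closed in \<open>simp_all add: end_mod_simps(1)\<close>)
  also have "\<dots> = tens ?Y (s \<odot>\<^bsub>Lam\<^esub> vol)"
    using ext_power_map(2)[OF mod mod ring_hom_id lin_maps_semilinear_id[OF assms(1)] basis_word_words]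
      s(2) by simp
  also have "\<dots> = s \<odot>\<^bsub>Tgt\<^esub> tens ?Y vol" by (rule b(5)[OF s(1) Y vol_closed])
  finally have "coef a a (act_Tgt g (tens X vol)) = s \<otimes>\<^bsub>R\<^esub> coef a a (tens ?Y vol)"
    using lin_maps_smult[OF coef(1)[OF a a] s(1) b(1)[OF Y vol_closed]] by simp
  also have "coef a a (tens ?Y vol) = co a (?Y (e a))"
    using coef(2)[OF a a] Y by (simp add: end_mod_simps(1))
  also have "?Y (e a) = g (X (g' (e a)))"
    using gl(2)[OF e_closed[OF a]] e_closed[OF a] by (simp add: conj_act_def)
  finally show ?thesis .
qed

lemma minus_one_sq:
  assumes "c \<in> carrier R"
  shows "(\<ominus>\<^bsub>R\<^esub> \<one>\<^bsub>R\<^esub>) \<otimes>\<^bsub>R\<^esub> ((\<ominus>\<^bsub>R\<^esub> \<one>\<^bsub>R\<^esub>) \<otimes>\<^bsub>R\<^esub> c) = c"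
  using assms by (simp add: R.l_minus R.r_minus)

definition reflection :: "nat \<Rightarrow> 'b \<Rightarrow> 'b" where
  "reflection b = lmap (\<lambda>i. if i = b then (\<ominus>\<^bsub>R\<^esub> \<one>\<^bsub>R\<^esub>) \<odot>\<^bsub>W\<^esub> e i else e i)"

text \<open>A diagonal matrix of signs does not change diagonal entries under conjugation, so only
  its determinant, minus one, is left.\<close>

lemma reflection:
  assumes b: "b < n"
  shows "reflection b \<in> lin_maps R W W" "reflection b \<in> GL_points R W"
    "j < n \<Longrightarrow> j \<noteq> b \<Longrightarrow> reflection b (e j) = e j"
    "a < n \<Longrightarrow> \<tau> \<in> carrier Tgt \<Longrightarrow> coef a a (act_Tgt (reflection b) \<tau>) = \<ominus>\<^bsub>R\<^esub> coef a a \<tau>"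
proof -
  let ?g = "reflection b" and ?m = "\<ominus>\<^bsub>R\<^esub> \<one>\<^bsub>R\<^esub>"
  have vc: "(if i = b then ?m \<odot>\<^bsub>W\<^esub> e i else e i) \<in> carrier W" if "i < n" for i
    using e_closed that b by simp
  show g: "?g \<in> lin_maps R W W" unfolding reflection_def by (rule lmap_lin[OF vc])
  have ge: "?g (e j) = (if j = b then ?m \<odot>\<^bsub>W\<^esub> e j else e j)" if "j < n" for j
    unfolding reflection_def by (rule lmap_e[OF vc that])
  show "reflection b (e j) = e j" if "j < n" "j \<noteq> b" using ge that by simp
  have gg: "?g (?g (e j)) = e j" if "j < n" for j
  proof (cases "j = b")
    case True
    have "?g (?g (e b)) = ?m \<odot>\<^bsub>W\<^esub> (?m \<odot>\<^bsub>W\<^esub> e b)"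
      using ge[OF b] lin_maps_smult[OF g _ e_closed[OF b], of ?m] by simp
    also have "\<dots> = (?m \<otimes>\<^bsub>R\<^esub> ?m) \<odot>\<^bsub>W\<^esub> e b" using b e_closed by (simp add: smult_assoc1)
    also have "\<dots> = e b" using b e_closed by (simp add: R.l_minus R.r_minus)
    finally show ?thesis using True by simp
  qed (use that ge in simp)
  show "?g \<in> GL_points R W" by (rule GL_pointsI(1)[OF g g gg gg])
  have "map ?g basis_word = basis_word[b := ?m \<odot>\<^bsub>W\<^esub> e b]"
    using b by (intro nth_equalityI) (auto simp: ge nth_list_update)
  then have "wedge R n W (map ?g basis_word) = ?m \<odot>\<^bsub>Lam\<^esub> wedge R n W (basis_word[b := e b])"
    using multilinear_smult[OF wedge_multilinear[OF mod] basis_word_words b _ e_closed[OF b], of ?m] by simp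
  moreover have "basis_word[b := e b] = basis_word" using b list_update_id[of basis_word b] by simp
  ultimately have w: "wedge R n W (map ?g basis_word) = ?m \<odot>\<^bsub>Lam\<^esub> vol" by simp
  assume a: "a < n" and "\<tau> \<in> carrier Tgt"
  then obtain X where X: "X \<in> lin_maps R W W" "\<tau> = tens X vol" using Tgt_elt by blast
  \<comment> \<open>The eigenvalue of the reflection at \<open>e a\<close>. It enters once through
    the inverse and once through the row functional, and its square is one; this covers
    \<open>a = b\<close> as well.\<close>
  define s where "s = (if a = b then ?m else \<one>\<^bsub>R\<^esub>)"
  have s: "s \<in> carrier R" "\<And>c. c \<in> carrier R \<Longrightarrow> s \<otimes>\<^bsub>R\<^esub> (s \<otimes>\<^bsub>R\<^esub> c) = c"
    by (simp_all add: s_def minus_one_sq)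
  have Xe: "X (e a) \<in> carrier W" using lin_maps_closed[OF X(1) e_closed[OF a]] .
  have 1: "?g (e a) = s \<odot>\<^bsub>W\<^esub> e a" using ge[OF a] e_closed[OF a] by (simp add: s_def)
  have 2: "co a (?g x) = s \<otimes>\<^bsub>R\<^esub> co a x" if x: "x \<in> carrier W" for x
  proof -
    have L: "(\<lambda>x\<in>carrier W. s \<otimes>\<^bsub>R\<^esub> co a x) \<in> lin_maps R W (self_mod R)"
      by (rule restrict_lin_mapsI[OF mod])
        (simp_all add: s(1) a co_closed co_add co_smult R.r_distr R.m_lcomm)
    have "co a (?g (e j)) = (\<lambda>x\<in>carrier W. s \<otimes>\<^bsub>R\<^esub> co a x) (e j)" if "j < n" for j
      using that a by (simp add: ge e_closed co_smult co_e s_def)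
    from co_comp[OF g L a this x] x show ?thesis by simp
  qed
  have "coef a a (act_Tgt ?g \<tau>) = ?m \<otimes>\<^bsub>R\<^esub> co a (?g (X (?g (e a))))"
    unfolding X(2) by (rule coef_act[OF g g gg gg _ w X(1) a]) simp_all
  also have "co a (?g (X (?g (e a)))) = co a (X (e a))"
    using Xe by (simp add: 1 lin_maps_smult[OF X(1) s(1) e_closed[OF a]] 2 s(1) co_smult[OF a] s(2) co_closed[OF a])
  also have "\<dots> = coef a a \<tau>" using coef(2)[OF a a X(1)] X(2) by simp
  also have "?m \<otimes>\<^bsub>R\<^esub> coef a a \<tau> = \<ominus>\<^bsub>R\<^esub> coef a a \<tau>"
    using coef(2)[OF a a X(1)] X(2) co_closed[OF a Xe] by (simp add: R.l_minus)
  finally show "coef a a (act_Tgt ?g \<tau>) = \<ominus>\<^bsub>R\<^esub> coef a a \<tau>" .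
qed

definition swap_map :: "nat \<Rightarrow> nat \<Rightarrow> 'b \<Rightarrow> 'b" where
  "swap_map p q = lmap (\<lambda>i. e (transpose p q i))"

text \<open>With \<open>a\<close> different from \<open>p\<close> and \<open>q\<close>, both
  \<open>e a\<close> and its coordinate functional are fixed, so the diagonal entry only picks up
  the determinant, minus one.\<close>

lemma swap_map:
  assumes pq: "p < n" "q < n" "p \<noteq> q"
  shows "swap_map p q \<in> lin_maps R W W" "swap_map p q \<in> GL_points R W"
    "j < n \<Longrightarrow> swap_map p q (e j) = e (transpose p q j)"
    "a < n \<Longrightarrow> a \<noteq> p \<Longrightarrow> a \<noteq> q \<Longrightarrow> \<tau> \<in> carrier Tgt \<Longrightarrow>
      coef a a (act_Tgt (swap_map p q) \<tau>) = \<ominus>\<^bsub>R\<^esub> coef a a \<tau>"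
proof -
  let ?g = "swap_map p q" and ?m = "\<ominus>\<^bsub>R\<^esub> \<one>\<^bsub>R\<^esub>"
  interpret L: module R Lam by (rule Lam)
  have tl: "transpose p q i < n" if "i < n" for i using that pq by (auto simp: transpose_def)
  have vc: "e (transpose p q i) \<in> carrier W" if "i < n" for i
    using e_closed[OF tl[OF that]] .
  show g: "?g \<in> lin_maps R W W" unfolding swap_map_def by (rule lmap_lin[OF vc])
  show ge: "?g (e j) = e (transpose p q j)" if "j < n" for j
    unfolding swap_map_def by (rule lmap_e[OF vc that])
  have gg: "?g (?g (e j)) = e j" if "j < n" for j using that tl ge by simp
  show "?g \<in> GL_points R W" by (rule GL_pointsI(1)[OF g g gg gg])
  have "map ?g basis_word = basis_word[p := basis_word ! q, q := basis_word ! p]"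
    using pq by (intro nth_equalityI) (auto simp: ge nth_list_update transpose_def)
  then have "wedge R n W (map ?g basis_word) = \<ominus>\<^bsub>Lam\<^esub> vol"
    using alternating_swap[OF mod Lam wedge_multilinear[OF mod] wedge_alternating[OF mod]
        basis_word_words pq] by simp
  then have w: "wedge R n W (map ?g basis_word) = ?m \<odot>\<^bsub>Lam\<^esub> vol"
    by (simp add: L.smult_minus_1 vol_closed)
  assume a: "a < n" "a \<noteq> p" "a \<noteq> q" and "\<tau> \<in> carrier Tgt"
  then obtain X where X: "X \<in> lin_maps R W W" "\<tau> = tens X vol" using Tgt_elt by blast
  have Xe: "X (e a) \<in> carrier W" using lin_maps_closed[OF X(1) e_closed[OF a(1)]] .
  have 1: "?g (e a) = e a" using ge[OF a(1)] a by (simp add: transpose_def)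
  have 2: "co a (?g x) = co a x" if x: "x \<in> carrier W" for x
  proof -
    have "co a (?g (e j)) = co a (e j)" if "j < n" for j
      using that a tl[OF that] by (auto simp: ge co_e transpose_def)
    from co_comp[OF g co_lin[OF a(1)] a(1) this x] show ?thesis .
  qed
  have "coef a a (act_Tgt ?g \<tau>) = ?m \<otimes>\<^bsub>R\<^esub> co a (?g (X (?g (e a))))"
    unfolding X(2) by (rule coef_act[OF g g gg gg _ w X(1) a(1)]) simp_all
  also have "\<dots> = \<ominus>\<^bsub>R\<^esub> co a (X (e a))"
    using Xe by (simp add: 1 2 R.l_minus co_closed[OF a(1)])
  finally show "coef a a (act_Tgt ?g \<tau>) = \<ominus>\<^bsub>R\<^esub> coef a a \<tau>"
    using coef(2)[OF a(1) a(1) X(1)] X(2) by simp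
qed

text \<open>The coefficient \<open>c\<close> is a parameter because the inverse of the transvection
  with coefficient one has coefficient minus one.\<close>

definition transvection :: "nat \<Rightarrow> nat \<Rightarrow> 'a \<Rightarrow> 'b \<Rightarrow> 'b" where
  "transvection a b c = lmap (\<lambda>i. if i = a then e a \<oplus>\<^bsub>W\<^esub> c \<odot>\<^bsub>W\<^esub> e b else e i)"

text \<open>The inverse fixes \<open>e b\<close>, the row functional at \<open>b\<close> becomes the
  sum of those at \<open>b\<close> and \<open>a\<close>, and the determinant is one. A diagonal
  entry of the conjugate thus exposes an off-diagonal entry of the original.\<close>

lemma transvection:
  assumes ab: "a < n" "b < n" "a \<noteq> b"
  shows "transvection a b \<one>\<^bsub>R\<^esub> \<in> GL_points R W"
    "\<tau> \<in> carrier Tgt \<Longrightarrow> coef b b (act_Tgt (transvection a b \<one>\<^bsub>R\<^esub>) \<tau>) = coef b b \<tau> \<oplus>\<^bsub>R\<^esub> coef a b \<tau>"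
proof -
  interpret L: module R Lam by (rule Lam)
  let ?m = "\<ominus>\<^bsub>R\<^esub> \<one>\<^bsub>R\<^esub>"
  have vc: "(if i = a then e a \<oplus>\<^bsub>W\<^esub> c \<odot>\<^bsub>W\<^esub> e b else e i) \<in> carrier W" if "i < n" "c \<in> carrier R" for i c
    using that e_closed ab by simp
  have g: "transvection a b c \<in> lin_maps R W W" if "c \<in> carrier R" for c
    unfolding transvection_def by (rule lmap_lin[OF vc[OF _ that]])
  have ge: "transvection a b c (e j) = (if j = a then e a \<oplus>\<^bsub>W\<^esub> c \<odot>\<^bsub>W\<^esub> e b else e j)"
    if "c \<in> carrier R" "j < n" for j c
    unfolding transvection_def by (rule lmap_e[OF vc[OF _ that(1)] that(2)])
  have gg: "transvection a b c (transvection a b c' (e j)) = e j"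
    if "j < n" "c \<in> carrier R" "c' \<in> carrier R" "c \<oplus>\<^bsub>R\<^esub> c' = \<zero>\<^bsub>R\<^esub>" for j c c'
  proof -
    have "(e a \<oplus>\<^bsub>W\<^esub> c \<odot>\<^bsub>W\<^esub> e b) \<oplus>\<^bsub>W\<^esub> c' \<odot>\<^bsub>W\<^esub> e b = e a \<oplus>\<^bsub>W\<^esub> (c \<oplus>\<^bsub>R\<^esub> c') \<odot>\<^bsub>W\<^esub> e b"
      using that(2,3) ab e_closed by (simp add: smult_l_distr M.a_assoc)
    then show ?thesis
      using that ab e_closed
      by (simp add: ge lin_maps_add[OF g[OF that(2)]] lin_maps_smult[OF g[OF that(2)]])
  qed
  have m: "?m \<in> carrier R" "\<one>\<^bsub>R\<^esub> \<oplus>\<^bsub>R\<^esub> ?m = \<zero>\<^bsub>R\<^esub>" "?m \<oplus>\<^bsub>R\<^esub> \<one>\<^bsub>R\<^esub> = \<zero>\<^bsub>R\<^esub>"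
    by (simp_all add: R.r_neg R.l_neg)
  let ?g = "transvection a b \<one>\<^bsub>R\<^esub>" and ?g' = "transvection a b ?m"
  note G = g[OF R.one_closed] g[OF m(1)] gg[OF _ R.one_closed m(1,2)] gg[OF _ m(1) R.one_closed m(3)]
  show "?g \<in> GL_points R W" by (rule GL_pointsI(1)[OF G])
  have "map ?g basis_word = basis_word[a := e a \<oplus>\<^bsub>W\<^esub> e b]"
    using ab e_closed by (intro nth_equalityI) (auto simp: ge nth_list_update)
  then have "wedge R n W (map ?g basis_word) =
      wedge R n W (basis_word[a := e a]) \<oplus>\<^bsub>Lam\<^esub> wedge R n W (basis_word[a := e b])"
    using multilinear_add[OF wedge_multilinear[OF mod] basis_word_words ab(1) e_closed[OF ab(1)] e_closed[OF ab(2)]]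
    by simp
  \<comment> \<open>The vector \<open>e b\<close> also stands at its own position \<open>b\<close>,
    so the extra term has a repeated factor.\<close>
  moreover have "wedge R n W (basis_word[a := e b]) = \<zero>\<^bsub>Lam\<^esub>"
  proof -
    have "\<not> distinct (basis_word[a := e b])"
      using nth_eq_iff_index_eq[of "basis_word[a := e b]" a b] ab by auto
    then show ?thesis
      using wedge_alternating[OF mod] words_update[OF basis_word_words e_closed[OF ab(2)]]
      unfolding alternating_def by simp
  qed
  moreover have "basis_word[a := e a] = basis_word" using ab list_update_id[of basis_word a] by simp
  ultimately have w: "wedge R n W (map ?g basis_word) = \<one>\<^bsub>R\<^esub> \<odot>\<^bsub>Lam\<^esub> vol"
    by (simp add: vol_closed)
  assume "\<tau> \<in> carrier Tgt"
  then obtain X where X: "X \<in> lin_maps R W W" "\<tau> = tens X vol" using Tgt_elt by blast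
  have Xe: "X (e b) \<in> carrier W" using lin_maps_closed[OF X(1) e_closed[OF ab(2)]] .
  have 1: "?g' (e b) = e b" using ge[OF m(1) ab(2)] ab by simp
  have 2: "co b (?g x) = co b x \<oplus>\<^bsub>R\<^esub> co a x" if x: "x \<in> carrier W" for x
  proof -
    have L: "(\<lambda>x\<in>carrier W. co b x \<oplus>\<^bsub>R\<^esub> co a x) \<in> lin_maps R W (self_mod R)"
      by (rule restrict_lin_mapsI[OF mod])
        (simp_all add: ab co_closed co_add co_smult R.r_distr R.a_ac)
    have "co b (?g (e j)) = (\<lambda>x\<in>carrier W. co b x \<oplus>\<^bsub>R\<^esub> co a x) (e j)" if "j < n" for j
      using that ab by (simp add: ge e_closed co_add co_smult co_e)
    from co_comp[OF G(1) L ab(2) this x] x show ?thesis by simp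
  qed
  have "coef b b (act_Tgt ?g \<tau>) = \<one>\<^bsub>R\<^esub> \<otimes>\<^bsub>R\<^esub> co b (?g (X (?g' (e b))))"
    unfolding X(2) by (rule coef_act[OF G _ w X(1) ab(2)]) simp_all
  also have "\<dots> = co b (X (e b)) \<oplus>\<^bsub>R\<^esub> co a (X (e b))"
    using Xe by (simp add: 1 2 co_closed ab)
  finally show "coef b b (act_Tgt ?g \<tau>) = coef b b \<tau> \<oplus>\<^bsub>R\<^esub> coef a b \<tau>"
    using coef(2)[OF _ _ X(1)] X(2) ab by simp
qed

end

section \<open>Equivariant maps vanish\<close>

text \<open>The first \<open>t\<close> of the transpositions that exchange \<open>u\<close> with
  \<open>v\<close> entry by entry. The partial products are kept because signs are collected one
  transposition at a time.\<close>

primrec swaps :: "'x list \<Rightarrow> 'x list \<Rightarrow> nat \<Rightarrow> 'x \<Rightarrow> 'x" where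
  "swaps u v 0 = id"
| "swaps u v (Suc t) = transpose (u ! t) (v ! t) \<circ> swaps u v t"

text \<open>The entries of \<open>u\<close> and \<open>v\<close> are all different, so the
  transpositions are disjoint and each pair is affected at exactly one stage.\<close>

lemma swaps_nth:
  assumes "distinct (u @ v)" "length u = r" "length v = r" "t \<le> r" "s < r"
  shows "swaps u v t (u ! s) = (if s < t then v ! s else u ! s)"
    "swaps u v t (v ! s) = (if s < t then u ! s else v ! s)"
proof -
  have ne: "u ! s \<noteq> v ! s'" if "s < r" "s' < r" for s s'
    using assms(1-3) that by (metis disjoint_iff distinct_append nth_mem)
  have inj: "u ! s = u ! s' \<longleftrightarrow> s = s'" "v ! s = v ! s' \<longleftrightarrow> s = s'" if "s < r" "s' < r" for s s'
    using assms(1-3) that by (simp_all add: nth_eq_iff_index_eq)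
  have "swaps u v t (u ! s) = (if s < t then v ! s else u ! s) \<and>
      swaps u v t (v ! s) = (if s < t then u ! s else v ! s)"
    using assms(4)
  proof (induct t)
    case (Suc t)
    have "t < r" using Suc by simp
    note ne = ne[OF \<open>s < r\<close> \<open>t < r\<close>] ne[OF \<open>t < r\<close> \<open>s < r\<close>] and inj = inj[OF \<open>s < r\<close> \<open>t < r\<close>]
    show ?case
    proof (cases "s = t")
      case True
      then show ?thesis using Suc by simp
    next
      case False
      then show ?thesis using Suc ne inj by (auto simp: transpose_def less_Suc_eq)
    qed
  qed simp
  then show "swaps u v t (u ! s) = (if s < t then v ! s else u ! s)"
    "swaps u v t (v ! s) = (if s < t then u ! s else v ! s)" by auto
qed

lemma swaps_other:
  assumes "length u = r" "length v = r" "t \<le> r" "x \<notin> set u" "x \<notin> set v"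
  shows "swaps u v t x = x"
  using assms(3)
proof (induct t)
  case (Suc t)
  then have "u ! t \<in> set u" "v ! t \<in> set v" using assms by auto
  then have "x \<noteq> u ! t" "x \<noteq> v ! t" using assms by auto
  then show ?case using Suc by (simp add: transpose_def)
qed simp

lemma swaps_in:
  assumes "length u = r" "length v = r" "t \<le> r" "set u \<subseteq> A" "set v \<subseteq> A" "x \<in> A"
  shows "swaps u v t x \<in> A"
  using assms(3)
proof (induct t)
  case (Suc t)
  then have "u ! t \<in> A" "v ! t \<in> A" using assms by (auto simp: subset_iff)
  then show ?case using Suc by (simp add: transpose_def)
qed (use assms in simp)

lemma distinct_concat_nth_disjoint:
  assumes "distinct (concat w)" "i < length w" "j < length w" "i \<noteq> j"
  shows "set (w ! i) \<inter> set (w ! j) = {}"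
proof -
  have *: "set (w ! i) \<inter> set (w ! j) = {}" if ij: "i < j" "j < length w" for i j
  proof -
    \<comment> \<open>Cutting the list at \<open>j\<close> puts block \<open>i\<close> in the front
      part and block \<open>j\<close> in the rear part of a distinct list.\<close>
    have "w = take j w @ drop j w" by simp
    then have "concat w = concat (take j w) @ concat (drop j w)" by (metis concat_append)
    then have "set (concat (take j w)) \<inter> set (concat (drop j w)) = {}"
      using assms(1) by (metis distinct_append)
    moreover have "w ! i \<in> set (take j w)" using ij by (auto simp: in_set_conv_nth intro!: exI[of _ i])
    moreover have "w ! j \<in> set (drop j w)" using ij by (metis Cons_nth_drop_Suc list.set_intros(1))
    ultimately show ?thesis by auto
  qed
  show ?thesis using *[of i j] *[of j i] assms by (cases "i < j") auto
qed

text \<open>Renaming indices turns into moving whole blocks: each block is carried onto the other in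
  the given order of its entries, so no reordering within a wedge, and no sign, arises.\<close>

lemma map_swaps_blocks:
  assumes w: "distinct (concat w)" "\<And>v. v \<in> set w \<Longrightarrow> length v = r"
    and ij: "i < length w" "j < length w" "i \<noteq> j"
  shows "map (map (swaps (w ! i) (w ! j) r)) w = permute_list (transpose i j) w"
proof (rule nth_equalityI)
  let ?u = "w ! i" and ?v = "w ! j"
  have len: "length ?u = r" "length ?v = r" using w(2) ij by auto
  have "distinct ?u" "distinct ?v"
    using w(1) ij by (auto simp: distinct_concat_iff)
  then have d: "distinct (?u @ ?v)" using distinct_concat_nth_disjoint[OF w(1) ij] by simp
  fix m assume "m < length (map (map (swaps ?u ?v r)) w)"
  then have m: "m < length w" by simp
  have "map (swaps ?u ?v r) (w ! m) = w ! transpose i j m"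
  proof -
    consider "m = i" | "m = j" | "m \<noteq> i" "m \<noteq> j" by blast
    then show ?thesis
    proof cases
      case 1
      show ?thesis
        unfolding 1 transpose_apply_first
        by (rule nth_equalityI) (simp_all add: len swaps_nth(1)[OF d len order.refl])
    next
      case 2
      show ?thesis
        unfolding 2 transpose_apply_second
        by (rule nth_equalityI) (simp_all add: len swaps_nth(2)[OF d len order.refl])
    next
      case 3
      have "set (w ! m) \<inter> set ?u = {}" "set (w ! m) \<inter> set ?v = {}"
        using distinct_concat_nth_disjoint[OF w(1)] m ij 3 by auto
      then have "map (swaps ?u ?v r) (w ! m) = w ! m"
        using swaps_other[OF len order.refl] by (intro map_idI) blast
      then show ?thesis using 3 by (simp add: transpose_def)
    qed
  qed
  then show "map (map (swaps ?u ?v r)) w ! m = permute_list (transpose i j) w ! m"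
    using m by (simp add: permute_list_def)
qed simp

section \<open>Monomials in wedges of basis vectors\<close>

context based_module
begin

definition mono :: "nat \<Rightarrow> nat \<Rightarrow> nat list list \<Rightarrow>
    ((('b list \<Rightarrow> 'a) set set) list \<Rightarrow> 'a) set set" where
  "mono r d w = sym_prod R d (ext_power R r W) (map (\<lambda>v. wedge R r W (map e v)) w)"

text \<open>Blocks are neither sorted nor assumed distinct, so renaming indices inside the range
  stays in this set without signs. The monomials only need to generate.\<close>

definition idx :: "nat \<Rightarrow> nat \<Rightarrow> nat list list set" where
  "idx r d = {w. length w = d \<and> (\<forall>v \<in> set w. length v = r \<and> set v \<subseteq> {..<n})}"

definition act_Sym where
  "act_Sym r d g = sym_power_map R R id d (ext_power R r W) (ext_power R r W)
     (ext_power_map R R id r W W g)"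

lemma wedge_idx_closed:
  assumes "length v = r" "set v \<subseteq> {..<n}"
  shows "map e v \<in> words W r" "wedge R r W (map e v) \<in> carrier (ext_power R r W)"
proof -
  show "map e v \<in> words W r" using assms e_closed by (auto simp: words_def)
  then show "wedge R r W (map e v) \<in> carrier (ext_power R r W)"
    by (rule multilinear_closed[OF wedge_multilinear[OF mod]])
qed

lemma mono_word:
  "w \<in> idx r d \<Longrightarrow> map (\<lambda>v. wedge R r W (map e v)) w \<in> words (ext_power R r W) d"
  using wedge_idx_closed(2) by (auto simp: idx_def words_def)

lemma mono_closed:
  "w \<in> idx r d \<Longrightarrow> mono r d w \<in> carrier (sym_power R d (ext_power R r W))"
  unfolding mono_def
  by (rule multilinear_closed[OF sym_prod_multilinear[OF ext_power_module[OF mod]] mono_word])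

text \<open>\<open>multilinear_generates\<close> is applied twice, for the exterior power and for
  the symmetric power built on it; the rest rewrites generators as images of index words.\<close>

lemma mono_generates:
  "generates R (sym_power R d (ext_power R r W)) (mono r d ` idx r d)"
proof (rule generates_trans)
  let ?P = "ext_power R r W"
  let ?B = "wedge R r W ` {xs. length xs = r \<and> set xs \<subseteq> e ` {..<n}}"
  note P = ext_power_module[OF mod, of r]
  show "module R (sym_power R d ?P)" by (rule sym_power_module[OF P])
  have "generates R ?P ?B"
    by (rule multilinear_generates[OF mod P wedge_multilinear[OF mod] wedge_generates[OF mod] e_generates])
  then show "generates R (sym_power R d ?P) (sym_prod R d ?P ` {xs. length xs = d \<and> set xs \<subseteq> ?B})"
    by (rule multilinear_generates[OF P sym_power_module[OF P] sym_prod_multilinear[OF P] sym_prod_generates[OF P]])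
  show "mono r d ` idx r d \<subseteq> carrier (sym_power R d ?P)" using mono_closed by auto
  fix N assume N: "mono r d ` idx r d \<subseteq> N"
  show "sym_prod R d ?P ` {xs. length xs = d \<and> set xs \<subseteq> ?B} \<subseteq> N"
  proof (rule image_subsetI)
    fix xs assume "xs \<in> {xs. length xs = d \<and> set xs \<subseteq> ?B}"
    then have xs: "length xs = d" "set xs \<subseteq> ?B" by auto
    let ?A = "{v. length v = r \<and> set v \<subseteq> {..<n}}"
    have "?B \<subseteq> (\<lambda>v. wedge R r W (map e v)) ` ?A"
    proof (rule image_subsetI)
      fix ys assume "ys \<in> {xs. length xs = r \<and> set xs \<subseteq> e ` {..<n}}"
      then have ys: "length ys = r" "ys \<in> map e ` lists {..<n}"
        by (auto simp: lists_image[symmetric] in_lists_conv_set)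
      then obtain v where "ys = map e v" "set v \<subseteq> {..<n}" by (auto simp: in_lists_conv_set)
      then show "wedge R r W ys \<in> (\<lambda>v. wedge R r W (map e v)) ` ?A" using ys by auto
    qed
    then have "xs \<in> lists ((\<lambda>v. wedge R r W (map e v)) ` ?A)"
      using xs by (auto simp: in_lists_conv_set)
    then obtain w where w: "xs = map (\<lambda>v. wedge R r W (map e v)) w" "w \<in> lists ?A"
      unfolding lists_image by blast
    then have "w \<in> idx r d" using xs by (auto simp: idx_def in_lists_conv_set)
    then show "sym_prod R d ?P xs \<in> N" using N w unfolding mono_def by auto
  qed
qed

text \<open>The values of \<open>g\<close> matter only on basis vectors occurring in
  \<open>w\<close>. Thus a reflection at a missing index is covered, with the identity as
  \<pi>.\<close>

lemma act_mono:
  assumes g: "g \<in> lin_maps R W W" and w: "w \<in> idx r d"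
    and \<pi>: "\<And>v j. v \<in> set w \<Longrightarrow> j \<in> set v \<Longrightarrow> g (e j) = e (\<pi> j)"
  shows "act_Sym r d g (mono r d w) = mono r d (map (map \<pi>) w)"
proof -
  note P = ext_power_module[OF mod, of r]
  note E = ext_power_map[OF mod mod ring_hom_id lin_maps_semilinear_id[OF g]]
  have "act_Sym r d g (mono r d w) = sym_prod R d (ext_power R r W)
      (map (ext_power_map R R id r W W g) (map (\<lambda>v. wedge R r W (map e v)) w))"
    unfolding act_Sym_def mono_def
    by (rule sym_power_map(2)[OF P P ring_hom_id E(1) mono_word[OF w]])
  also have "map (ext_power_map R R id r W W g) (map (\<lambda>v. wedge R r W (map e v)) w) =
      map (\<lambda>v. wedge R r W (map e v)) (map (map \<pi>) w)"
    using w \<pi> by (auto simp: idx_def E(2) wedge_idx_closed(1) intro!: arg_cong[of _ _ "wedge R r W"])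
  finally show ?thesis by (simp add: mono_def)
qed

lemma mono_transpose:
  assumes "w \<in> idx r d" "i < d" "j < d"
  shows "mono r d (permute_list (transpose i j) w) = mono r d w"
proof -
  have t: "transpose i j permutes {..<d}" using assms by (intro permutes_swap_id) auto
  have "length w = d" using assms by (simp add: idx_def)
  then have "map (\<lambda>v. wedge R r W (map e v)) (permute_list (transpose i j) w) =
    permute_list (transpose i j) (map (\<lambda>v. wedge R r W (map e v)) w)"
    using t by (simp add: permute_list_map)
  then show ?thesis
    using sym_prod_permute[OF ext_power_module[OF mod] mono_word[OF assms(1)] t] by (simp add: mono_def)
qed

section \<open>Vanishing of equivariant maps over a ring without 2-torsion\<close>

context
  fixes r d F
  assumes n_eq: "n = r * d" and r: "odd r" and d: "3 \<le> d"
    and two: "\<And>c. c \<in> carrier R \<Longrightarrow> c = \<ominus>\<^bsub>R\<^esub> c \<Longrightarrow> c = \<zero>\<^bsub>R\<^esub>"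
    and F: "F \<in> lin_maps R (sym_power R d (ext_power R r W)) Tgt"
    and equivariant: "\<And>g y. g \<in> GL_points R W \<Longrightarrow> y \<in> carrier (sym_power R d (ext_power R r W)) \<Longrightarrow>
      F (act_Sym r d g y) = act_Tgt g (F y)"
begin

lemma F_mono_closed: "w \<in> idx r d \<Longrightarrow> F (mono r d w) \<in> carrier Tgt"
  by (rule lin_maps_closed[OF F mono_closed])

lemma coef_F_closed: "w \<in> idx r d \<Longrightarrow> a < n \<Longrightarrow> coef a a (F (mono r d w)) \<in> carrier R"
  using lin_maps_closed[OF coef(1) F_mono_closed] by simp

text \<open>By \<open>two\<close> it is enough to find group elements that together return the
  monomial to itself while the coefficient changes sign.\<close>

lemma diag_coef_mono:
  assumes w: "w \<in> idx r d" and a: "a < n"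
  shows "coef a a (F (mono r d w)) = \<zero>\<^bsub>R\<^esub>"
proof (rule two[OF coef_F_closed[OF w a]])
  have len: "length w = d" "\<And>v. v \<in> set w \<Longrightarrow> length v = r" "\<And>v. v \<in> set w \<Longrightarrow> set v \<subseteq> {..<n}"
    using w by (auto simp: idx_def)
  show "coef a a (F (mono r d w)) = \<ominus>\<^bsub>R\<^esub> coef a a (F (mono r d w))"
  \<comment> \<open>The word has \<open>n\<close> letters in total, so a repetition forces a missing
    index. The second case is left with words that use each index exactly once.\<close>
  proof (cases "\<exists>b<n. b \<notin> set (concat w)")
    case True
    then obtain b where b: "b < n" "b \<notin> set (concat w)" by blast
    have "act_Sym r d (reflection b) (mono r d w) = mono r d (map (map id) w)"
    proof (rule act_mono[OF reflection(1)[OF b(1)] w])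
      fix v j assume "v \<in> set w" "j \<in> set v"
      then have "j < n" "j \<noteq> b" using len(3) b(2) by auto
      then show "reflection b (e j) = e (id j)" using reflection(3)[OF b(1)] by simp
    qed
    then have "F (mono r d w) = act_Tgt (reflection b) (F (mono r d w))"
      using equivariant[OF reflection(2)[OF b(1)] mono_closed[OF w]] by simp
    then show ?thesis using reflection(4)[OF b(1) a F_mono_closed[OF w]] by simp
  next
    case False
    then have "set (concat w) = {..<n}" using len(3) by auto
    moreover have "map length w = replicate d r"
      using len by (intro replicate_eqI) auto
    then have "length (concat w) = n" by (simp add: length_concat sum_list_replicate n_eq)
    ultimately have dist: "distinct (concat w)" by (intro card_distinct) simp
    have uniq: "i = j" if "i < d" "j < d" "a \<in> set (w ! i)" "a \<in> set (w ! j)" for i j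
      using distinct_concat_nth_disjoint[OF dist, of i j] that len(1) by auto
    \<comment> \<open>At most one of the blocks 0, 1, 2 contains \<open>a\<close>, so two of them
      are free for the exchange.\<close>
    have "\<exists>i j. i < d \<and> j < d \<and> i \<noteq> j \<and> a \<notin> set (w ! i) \<and> a \<notin> set (w ! j)"
    proof -
      have *: "0 < d" "1 < d" "2 < d" using d by auto
      consider "a \<in> set (w ! 0)" | "a \<in> set (w ! 1)" | "a \<notin> set (w ! 0)" "a \<notin> set (w ! 1)" by blast
      then show ?thesis
      proof cases
        case 1
        then have "1 < d \<and> 2 < d \<and> (1::nat) \<noteq> 2 \<and> a \<notin> set (w ! 1) \<and> a \<notin> set (w ! 2)"
          using uniq[of 0 1] uniq[of 0 2] * by auto
        then show ?thesis by blast
      next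
        case 2
        then have "0 < d \<and> 2 < d \<and> (0::nat) \<noteq> 2 \<and> a \<notin> set (w ! 0) \<and> a \<notin> set (w ! 2)"
          using uniq[of 1 0] uniq[of 1 2] * by auto
        then show ?thesis by blast
      next
        case 3
        then have "0 < d \<and> 1 < d \<and> (0::nat) \<noteq> 1 \<and> a \<notin> set (w ! 0) \<and> a \<notin> set (w ! 1)"
          using * by simp
        then show ?thesis by blast
      qed
    qed
    then obtain i j where ij: "i < d" "j < d" "i \<noteq> j" "a \<notin> set (w ! i)" "a \<notin> set (w ! j)" by blast
    define u v where "u = w ! i" and "v = w ! j"
    have uv: "length u = r" "length v = r" "set u \<subseteq> {..<n}" "set v \<subseteq> {..<n}" "a \<notin> set u" "a \<notin> set v"
      using len ij by (simp_all add: u_def v_def)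
    have disj: "set u \<inter> set v = {}"
      using distinct_concat_nth_disjoint[OF dist, of i j] ij len(1) by (simp add: u_def v_def)
    \<comment> \<open>The word after \<open>t\<close> of the \<open>r\<close> transpositions. The
      intermediate monomials may differ from the original one; only the last stage returns to
      it.\<close>
    let ?w = "\<lambda>t. map (map (swaps u v t)) w"
    have wt: "?w t \<in> idx r d" if "t \<le> r" for t
      using len swaps_in[OF uv(1,2) that uv(3,4)] by (auto simp: idx_def)
    \<comment> \<open>Equivariance under each \<open>swap_map\<close> negates the coefficient, since
      neither swapped index equals \<open>a\<close>.\<close>
    have step: "coef a a (F (mono r d (?w t))) =
        (if even t then coef a a (F (mono r d w)) else \<ominus>\<^bsub>R\<^esub> coef a a (F (mono r d w)))" if "t \<le> r" for t
      using that
    proof (induct t)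
      case 0
      then show ?case by simp
    next
      case (Suc t)
      then have t: "t < r" "t \<le> r" by auto
      let ?p = "u ! t" and ?q = "v ! t"
      have m: "?p \<in> set u" "?q \<in> set v" using t uv by auto
      have pq: "?p < n" "?q < n" "?p \<noteq> ?q" "a \<noteq> ?p" "a \<noteq> ?q" using m uv disj by auto
      have "act_Sym r d (swap_map ?p ?q) (mono r d (?w t)) = mono r d (map (map (transpose ?p ?q)) (?w t))"
      proof (rule act_mono[OF swap_map(1)[OF pq(1-3)] wt[OF t(2)]])
        fix v' j assume "v' \<in> set (?w t)" "j \<in> set v'"
        moreover have "\<forall>v'\<in>set (?w t). set v' \<subseteq> {..<n}" using wt[OF t(2)] unfolding idx_def by blast
        ultimately have "j < n" by blast
        then show "swap_map ?p ?q (e j) = e (transpose ?p ?q j)" by (rule swap_map(3)[OF pq(1-3)])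
      qed
      also have "map (map (transpose ?p ?q)) (?w t) = ?w (Suc t)" by simp
      finally have "F (mono r d (?w (Suc t))) = act_Tgt (swap_map ?p ?q) (F (mono r d (?w t)))"
        using equivariant[OF swap_map(2)[OF pq(1-3)] mono_closed[OF wt[OF t(2)]]] by simp
      then have "coef a a (F (mono r d (?w (Suc t)))) = \<ominus>\<^bsub>R\<^esub> coef a a (F (mono r d (?w t)))"
        using swap_map(4)[OF pq(1-3) a pq(4,5) F_mono_closed[OF wt[OF t(2)]]] by simp
      then show ?case
        unfolding Suc(1)[OF t(2)] using coef_F_closed[OF w a] by (simp del: swaps.simps)
    qed
    \<comment> \<open>After all \<open>r\<close> transpositions the two blocks have traded places,
      which the symmetric product does not see; as \<open>r\<close> is odd, the coefficient has been
      negated.\<close>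
    have "?w r = permute_list (transpose i j) w"
      unfolding u_def v_def by (rule map_swaps_blocks[OF dist len(2)]) (use ij len(1) in auto)
    then have "mono r d (?w r) = mono r d w" using mono_transpose[OF w ij(1,2)] by simp
    then show ?thesis using step[OF order.refl] r by simp
  qed
qed

text \<open>Vanishing on monomials extends by linearity. All \<open>y\<close> are needed here: a
  transvection turns a monomial into a sum of monomials.\<close>

lemma diag_coef_zero:
  assumes y: "y \<in> carrier (sym_power R d (ext_power R r W))" and a: "a < n"
  shows "coef a a (F y) = \<zero>\<^bsub>R\<^esub>"
proof -
  note S = sym_power_module[OF ext_power_module[OF mod], of d r]
  note C = lin_maps_compose[OF S F coef(1)[OF a a]]
  have "compose (carrier (sym_power R d (ext_power R r W))) (coef a a) F =
      (\<lambda>x\<in>carrier (sym_power R d (ext_power R r W)). \<zero>\<^bsub>self_mod R\<^esub>)"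
    by (rule lin_maps_eq_on_generators[OF S self mono_generates C zero_lin_maps[OF S self]])
      (use diag_coef_mono a mono_closed in \<open>auto simp: compose_eq\<close>)
  from fun_cong[OF this, of y] y show ?thesis by (simp add: compose_eq)
qed

text \<open>The diagonal vanishes at \<open>y\<close> and also at its translate under the
  transvection. By equivariance the latter diagonal entry is the sum of a diagonal and an
  off-diagonal entry at \<open>y\<close>.\<close>

lemma equivariant_map_zero:
  assumes y: "y \<in> carrier (sym_power R d (ext_power R r W))"
  shows "F y = \<zero>\<^bsub>Tgt\<^esub>"
proof (rule Tgt_eq_zeroI[OF lin_maps_closed[OF F y]])
  fix a b assume ab: "a < n" "b < n"
  note P = ext_power_module[OF mod, of r]
  show "coef a b (F y) = \<zero>\<^bsub>R\<^esub>"
  proof (cases "a = b")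
    case True
    then show ?thesis using diag_coef_zero[OF y] ab by simp
  next
    case False
    let ?g = "transvection a b \<one>\<^bsub>R\<^esub>"
    have g: "?g \<in> GL_points R W" by (rule transvection(1)[OF ab False])
    then have gl: "?g \<in> lin_maps R W W" by (simp add: GL_points_def)
    have "act_Sym r d ?g y \<in> carrier (sym_power R d (ext_power R r W))"
      unfolding act_Sym_def
      by (rule semilinearD(1)[OF sym_power_map(1)[OF P P ring_hom_id
              ext_power_map(1)[OF mod mod ring_hom_id lin_maps_semilinear_id[OF gl]]] y])
    then have "coef b b (act_Tgt ?g (F y)) = \<zero>\<^bsub>R\<^esub>"
      using diag_coef_zero[OF _ ab(2)] equivariant[OF g y] by metis
    then have "coef b b (F y) \<oplus>\<^bsub>R\<^esub> coef a b (F y) = \<zero>\<^bsub>R\<^esub>"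
      using transvection(2)[OF ab False lin_maps_closed[OF F y]] by simp
    then show ?thesis
      using diag_coef_zero[OF y ab(2)] lin_maps_closed[OF coef(1)[OF ab] lin_maps_closed[OF F y]] by simp
  qed
qed

end

end

section \<open>Representations\<close>

text \<open>The base change of an endomorphism of V, that is, \<open>rep_can\<close> of the
  endomorphism representation for the standard one.\<close>

definition end_can where
  "end_can k R \<phi> V X = the_lin R (ext_scalars k R \<phi> V) (ext_scalars k R \<phi> V)
     {(ext_scalars_elt k R \<phi> V x, ext_scalars_elt k R \<phi> V (X x)) | x. x \<in> carrier V}"

context
  fixes k :: "'a ring" and R :: "'t ring" and \<phi> :: "'a \<Rightarrow> 't" and V :: "('a, 'v) module"
  assumes V: "module k V" and R: "cring R" and \<phi>: "\<phi> \<in> ring_hom k R"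
begin

abbreviation (input) "W \<equiv> ext_scalars k R \<phi> V"
abbreviation (input) "can \<equiv> ext_scalars_elt k R \<phi> V"

lemmas W = ext_scalars_module[OF V R \<phi>]
lemmas can = ext_scalars_elt_semilinear[OF V R \<phi>]

lemma end_can:
  assumes X: "X \<in> lin_maps k V V"
  shows "end_can k R \<phi> V X \<in> lin_maps R W W" "x \<in> carrier V \<Longrightarrow> end_can k R \<phi> V X (can x) = can (X x)"
proof -
  have "semilinear k \<phi> V W (\<lambda>x. can (X x))"
    unfolding semilinear_def
    by (simp add: semilinearD[OF can] lin_maps_closed[OF X] lin_maps_add[OF X] lin_maps_smult[OF X])
  from ext_scalars_lift[OF V R \<phi> W this]
  obtain h where h: "h \<in> lin_maps R W W" "\<And>x. x \<in> carrier V \<Longrightarrow> h (can x) = can (X x)" by blast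
  have "end_can k R \<phi> V X = h"
    unfolding end_can_def
  proof (rule the_lin_eq[OF W W h(1)])
    have "fst ` {(can x, can (X x)) | x. x \<in> carrier V} = can ` carrier V" by force
    then show "generates R W (fst ` {(can x, can (X x)) | x. x \<in> carrier V})"
      using ext_scalars_generates[OF V R \<phi>] by simp
  qed (use h(2) in auto)
  then show "end_can k R \<phi> V X \<in> lin_maps R W W" "x \<in> carrier V \<Longrightarrow> end_can k R \<phi> V X (can x) = can (X x)"
    using h by auto
qed

text \<open>Both sides of each identity are linear over \<open>R\<close>, hence it can be checked on
  the elements \<open>can x\<close>.\<close>

lemma end_can_semilinear:
  "semilinear k \<phi> (end_mod k V) (end_mod R W) (end_can k R \<phi> V)"
proof -
  interpret V: module k V by (rule V)
  interpret E: module k "end_mod k V" by (rule end_mod_module[OF V])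
  interpret E': module R "end_mod R W" by (rule end_mod_module[OF W])
  note g = ext_scalars_generates[OF V R \<phi>]
  show ?thesis
    unfolding semilinear_def
  proof (intro conjI ballI)
    fix X Y assume XY: "X \<in> carrier (end_mod k V)" "Y \<in> carrier (end_mod k V)"
    then have X: "X \<in> lin_maps k V V" and Y: "Y \<in> lin_maps k V V" by (simp_all add: end_mod_simps(1))
    have XY': "X \<oplus>\<^bsub>end_mod k V\<^esub> Y \<in> lin_maps k V V"
      using E.M.add.m_closed[OF XY] by (simp only: end_mod_simps(1))
    have "end_can k R \<phi> V X \<oplus>\<^bsub>end_mod R W\<^esub> end_can k R \<phi> V Y \<in> lin_maps R W W"
      using E'.M.add.m_closed[of "end_can k R \<phi> V X" "end_can k R \<phi> V Y"] end_can(1)[OF X] end_can(1)[OF Y]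
      by (simp only: end_mod_simps(1))
    then show "end_can k R \<phi> V (X \<oplus>\<^bsub>end_mod k V\<^esub> Y) = end_can k R \<phi> V X \<oplus>\<^bsub>end_mod R W\<^esub> end_can k R \<phi> V Y"
    proof (rule lin_maps_eq_on_generators[OF W W g end_can(1)[OF XY']])
      fix z assume "z \<in> can ` carrier V"
      then obtain x where x: "x \<in> carrier V" "z = can x" by blast
      show "end_can k R \<phi> V (X \<oplus>\<^bsub>end_mod k V\<^esub> Y) z =
          (end_can k R \<phi> V X \<oplus>\<^bsub>end_mod R W\<^esub> end_can k R \<phi> V Y) z"
        unfolding x(2) end_can(2)[OF XY' x(1)]
        using x(1) by (simp add: end_can(2)[OF X] end_can(2)[OF Y] end_mod_simps(3)
            semilinearD[OF can] lin_maps_closed[OF X] lin_maps_closed[OF Y])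
    qed
  next
    fix a X assume a: "a \<in> carrier k" and X0: "X \<in> carrier (end_mod k V)"
    then have X: "X \<in> lin_maps k V V" by (simp add: end_mod_simps(1))
    have aX: "a \<odot>\<^bsub>end_mod k V\<^esub> X \<in> lin_maps k V V"
      using E.smult_closed[OF a X0] by (simp only: end_mod_simps(1))
    have "\<phi> a \<odot>\<^bsub>end_mod R W\<^esub> end_can k R \<phi> V X \<in> lin_maps R W W"
      using E'.smult_closed[OF ring_hom_closed[OF \<phi> a], of "end_can k R \<phi> V X"] end_can(1)[OF X]
      by (simp only: end_mod_simps(1))
    then show "end_can k R \<phi> V (a \<odot>\<^bsub>end_mod k V\<^esub> X) = \<phi> a \<odot>\<^bsub>end_mod R W\<^esub> end_can k R \<phi> V X"
    proof (rule lin_maps_eq_on_generators[OF W W g end_can(1)[OF aX]])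
      fix z assume "z \<in> can ` carrier V"
      then obtain x where x: "x \<in> carrier V" "z = can x" by blast
      show "end_can k R \<phi> V (a \<odot>\<^bsub>end_mod k V\<^esub> X) z = (\<phi> a \<odot>\<^bsub>end_mod R W\<^esub> end_can k R \<phi> V X) z"
        unfolding x(2) end_can(2)[OF aX x(1)]
        using x(1) a by (simp add: end_can(2)[OF X] end_mod_simps(4)
            semilinearD[OF can] lin_maps_closed[OF X])
    qed
  qed (simp add: end_mod_simps(1) end_can(1))
qed

lemma sym_ext_can_semilinear:
  fixes r d :: nat
  defines "\<rho> \<equiv> sym_rep k d (ext_rep k r (std_rep k V))"
  shows "semilinear k \<phi> (rep_mod \<rho>) (rep_ext \<rho> R \<phi>) (rep_can \<rho> R \<phi>)"
  using sym_power_map(1)[OF ext_power_module[OF V] ext_power_module[OF W] \<phi> ext_power_map(1)[OF V W \<phi> can]]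
  by (simp add: \<rho>_def sym_rep_def ext_rep_def std_rep_def)

lemma end_det_can:
  defines "\<sigma> \<equiv> tensor_rep k (end_rep k (std_rep k V)) (det_rep k V)"
    and "n \<equiv> vectorspace.dim k V"
  shows "semilinear k \<phi> (rep_mod \<sigma>) (rep_ext \<sigma> R \<phi>) (rep_can \<sigma> R \<phi>)"
    and "X \<in> lin_maps k V V \<Longrightarrow> xs \<in> words V n \<Longrightarrow>
      rep_can \<sigma> R \<phi> (tensor_elt k (end_mod k V) (ext_power k n V) X (wedge k n V xs)) =
      tensor_elt R (end_mod R W) (ext_power R n W) (end_can k R \<phi> V X) (wedge R n W (map can xs))"
proof -
  have eq: "rep_can \<sigma> R \<phi> = tensor_map k R \<phi> (end_mod k V) (ext_power k n V) (end_mod R W) (ext_power R n W)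
      (end_can k R \<phi> V) (ext_power_map k R \<phi> n V W can)"
    by (simp add: \<sigma>_def n_def tensor_rep_def end_rep_def det_rep_def ext_rep_def std_rep_def
        end_can_def[abs_def])
  note T = tensor_map[OF end_mod_module[OF V] ext_power_module[OF V] end_mod_module[OF W]
      ext_power_module[OF W] \<phi> end_can_semilinear ext_power_map(1)[OF V W \<phi> can]]
  show "semilinear k \<phi> (rep_mod \<sigma>) (rep_ext \<sigma> R \<phi>) (rep_can \<sigma> R \<phi>)"
    unfolding eq using T(1)[of n]
    by (simp add: \<sigma>_def n_def tensor_rep_def end_rep_def det_rep_def ext_rep_def std_rep_def)
  assume X: "X \<in> lin_maps k V V" and xs: "xs \<in> words V n"
  then show "rep_can \<sigma> R \<phi> (tensor_elt k (end_mod k V) (ext_power k n V) X (wedge k n V xs)) =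
      tensor_elt R (end_mod R W) (ext_power R n W) (end_can k R \<phi> V X) (wedge R n W (map can xs))"
    unfolding eq
    by (simp add: T(2) end_mod_simps(1) multilinear_closed[OF wedge_multilinear[OF V]]
        ext_power_map(2)[OF V W \<phi> can])
qed

lemma sym_ext_act:
  fixes r d :: nat
  assumes "g \<in> GL_points R W"
  defines "\<rho> \<equiv> sym_rep k d (ext_rep k r (std_rep k V))"
  shows "semilinear R id (rep_ext \<rho> R \<phi>) (rep_ext \<rho> R \<phi>) (rep_act \<rho> R \<phi> g)"
proof -
  have "semilinear R id W W g" using assms by (auto simp: GL_points_def intro: lin_maps_semilinear_id)
  then show ?thesis
    using sym_power_map(1)[OF ext_power_module[OF W] ext_power_module[OF W] ring_hom_id
        ext_power_map(1)[OF W W ring_hom_id]]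
    by (simp add: \<rho>_def sym_rep_def ext_rep_def std_rep_def)
qed

text \<open>Rewrites the action of the target representation as the tensor product of conjugation
  with the induced map on the top exterior power, the shape used in \<open>act_Tgt\<close>.\<close>

lemma end_det_act_eq:
  defines "\<sigma> \<equiv> tensor_rep k (end_rep k (std_rep k V)) (det_rep k V)"
    and "n \<equiv> vectorspace.dim k V"
  shows "rep_act \<sigma> R \<phi> g = tensor_map R R id (end_mod R W) (ext_power R n W) (end_mod R W) (ext_power R n W)
      (conj_act W g) (ext_power_map R R id n W W g)"
  by (simp add: \<sigma>_def n_def tensor_rep_def end_rep_def det_rep_def ext_rep_def std_rep_def
      conj_act_def[abs_def])

lemma end_det_act:
  assumes g: "g \<in> GL_points R W"
  defines "\<sigma> \<equiv> tensor_rep k (end_rep k (std_rep k V)) (det_rep k V)"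
  shows "semilinear R id (rep_ext \<sigma> R \<phi>) (rep_ext \<sigma> R \<phi>) (rep_act \<sigma> R \<phi> g)"
proof -
  let ?n = "vectorspace.dim k V"
  have g': "semilinear R id W W g" using g by (auto simp: GL_points_def intro: lin_maps_semilinear_id)
  show ?thesis
    using tensor_map(1)[OF end_mod_module[OF W] ext_power_module[OF W] end_mod_module[OF W]
      ext_power_module[OF W] ring_hom_id conj_act_semilinear[OF W g] ext_power_map(1)[OF W W ring_hom_id g'],
      of ?n]
    unfolding \<sigma>_def end_det_act_eq
    by (simp add: tensor_rep_def end_rep_def det_rep_def ext_rep_def std_rep_def)
qed

text \<open>The composite of a coordinate with \<phi> is semilinear, so it extends to the base
  change and is dual to the images of the basis vectors. The second property links coordinates
  before and after base change, for use in the descent.\<close>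

lemma based_module_ext_scalars:
  assumes "based_module k V n e co"
  obtains co' where "based_module R W n (\<lambda>i. can (e i)) co'"
    "\<And>i x. i < n \<Longrightarrow> x \<in> carrier V \<Longrightarrow> co' i (can x) = \<phi> (co i x)"
proof -
  interpret based_module k V n e co by fact
  interpret W: module R W by (rule W)
  have ex: "\<exists>h \<in> lin_maps R W (self_mod R). \<forall>x \<in> carrier V. h (can x) = \<phi> (co i x)" if "i < n" for i
    by (rule ext_scalars_lift[OF V R \<phi> self_mod_module[OF R]])
      (simp add: semilinear_def co_closed co_add co_smult that ring_hom_closed[OF \<phi>]
        ring_hom_add[OF \<phi>] ring_hom_mult[OF \<phi>])
  then obtain co' where co': "\<And>i. i < n \<Longrightarrow> co' i \<in> lin_maps R W (self_mod R)"
    "\<And>i x. i < n \<Longrightarrow> x \<in> carrier V \<Longrightarrow> co' i (can x) = \<phi> (co i x)"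
    by metis
  have "generates R W ((\<lambda>i. can (e i)) ` {..<n})"
  proof (rule generates_trans[OF W ext_scalars_generates[OF V R \<phi>]])
    show "(\<lambda>i. can (e i)) ` {..<n} \<subseteq> carrier W" using e_closed semilinearD(1)[OF can] by auto
    fix N assume N: "LinearCombinations.submodule R N W" "(\<lambda>i. can (e i)) ` {..<n} \<subseteq> N"
    interpret N: LinearCombinations.submodule R N W by (rule N(1))
    have "can x \<in> N" if "x \<in> carrier V" for x
      using V e_generates that
    proof (induct rule: generates_induct)
      case zero
      show ?case using semilinear_zero[OF V W \<phi> can] by simp
    next
      case (add x y)
      then show ?case by (simp add: semilinearD[OF can])
    next
      case (smult a x)
      then show ?case by (simp add: semilinearD[OF can] ring_hom_closed[OF \<phi>])
    next
      case (gen x)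
      then show ?case using N(2) by auto
    qed
    then show "can ` carrier V \<subseteq> N" by auto
  qed
  then have "based_module R W n (\<lambda>i. can (e i)) co'"
    by (unfold_locales)
      (auto simp: e_closed semilinearD(1)[OF can] co' co_e ring_hom_one[OF \<phi>]
        ring_hom_zero[OF \<phi> ring_axioms W.R.ring_axioms])
  then show thesis using that co'(2) by blast
qed

end

text \<open>The coefficients \<open>a x\<close> of a vector are merely chosen; linear independence
  makes them unique on \<open>B\<close>, and uniqueness makes them linear in
  \<open>x\<close>.\<close>

lemma based_module_exists:
  fixes k :: "'a ring" and V :: "('a, 'v) module"
  assumes "vectorspace k V" "vectorspace.fin_dim k V"
  obtains e co where "based_module k V (vectorspace.dim k V) e co"
proof -
  interpret vectorspace k V by fact
  obtain B where B: "finite B" "basis B" using finite_basis_exists[OF assms(2)] by blast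
  then have B': "B \<subseteq> carrier V" "span B = carrier V" "lin_indpt B" by (auto simp: basis_def)
  have card: "card B = dim" using dim_basis[OF B] by simp
  obtain e where e: "bij_betw e {..<dim} B"
    using ex_bij_betw_nat_finite[OF B(1)] card by (auto simp: atLeast0LessThan)
  have "\<exists>a. a \<in> B \<rightarrow> carrier k \<and> lincomb a B = x" if "x \<in> carrier V" for x
    using finite_in_span[OF B(1) B'(1)] that B'(2) by blast
  then obtain a where a: "\<And>x. x \<in> carrier V \<Longrightarrow> a x \<in> B \<rightarrow> carrier k"
    "\<And>x. x \<in> carrier V \<Longrightarrow> lincomb (a x) B = x" by metis
  have uniq: "b v = c v" if "b \<in> B \<rightarrow> carrier k" "c \<in> B \<rightarrow> carrier k" "lincomb b B = lincomb c B" "v \<in> B" for b c v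
  proof -
    have "lincomb (\<lambda>v. b v \<ominus>\<^bsub>k\<^esub> c v) B = \<zero>\<^bsub>V\<^esub>"
      using lincomb_diff[OF B(1) B'(1) that(1,2)] that(3) lincomb_closed[OF B'(1) that(2)]
      by (simp add: a_minus_def M.r_neg)
    then have "b v \<ominus>\<^bsub>k\<^esub> c v = \<zero>\<^bsub>k\<^esub>"
      using not_lindepD[OF B'(3) B(1) order.refl, of "\<lambda>v. b v \<ominus>\<^bsub>k\<^esub> c v"] that(1,2,4) by (auto simp: Pi_def)
    then show ?thesis using that by (simp add: Pi_def)
  qed
  have eB: "e i \<in> B" "e i \<in> carrier V" if "i < dim" for i
    using e that B'(1) by (auto simp: bij_betw_def)
  have co_lin: "(\<lambda>x\<in>carrier V. a x (e i)) \<in> lin_maps k V (self_mod k)" if i: "i < dim" for i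
  proof (rule restrict_lin_mapsI[OF module_axioms])
    fix x assume x: "x \<in> carrier V"
    show "a x (e i) \<in> carrier (self_mod k)" using a(1)[OF x] eB[OF i] by auto
    {
      fix y assume y: "y \<in> carrier V"
      have "lincomb (a (x \<oplus>\<^bsub>V\<^esub> y)) B = lincomb (\<lambda>v. a x v \<oplus>\<^bsub>k\<^esub> a y v) B"
        using lincomb_sum[OF B(1) B'(1) a(1)[OF x] a(1)[OF y]] a(2) x y by simp
      then show "a (x \<oplus>\<^bsub>V\<^esub> y) (e i) = a x (e i) \<oplus>\<^bsub>self_mod k\<^esub> a y (e i)"
        using uniq[OF _ _ _ eB(1)[OF i], of "a (x \<oplus>\<^bsub>V\<^esub> y)" "\<lambda>v. a x v \<oplus>\<^bsub>k\<^esub> a y v"] a(1) x y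
        by (auto simp: Pi_def)
    }
    fix c assume c: "c \<in> carrier k"
    have "lincomb (a (c \<odot>\<^bsub>V\<^esub> x)) B = lincomb (\<lambda>v. c \<otimes>\<^bsub>k\<^esub> a x v) B"
      using lincomb_smult[OF B'(1) a(1)[OF x] c] a(2) x c by simp
    then show "a (c \<odot>\<^bsub>V\<^esub> x) (e i) = c \<odot>\<^bsub>self_mod k\<^esub> a x (e i)"
      using uniq[OF _ _ _ eB(1)[OF i], of "a (c \<odot>\<^bsub>V\<^esub> x)" "\<lambda>v. c \<otimes>\<^bsub>k\<^esub> a x v"] a(1) x c
      by (auto simp: Pi_def)
  qed
  have co_e: "a (e j) (e i) = (if i = j then \<one>\<^bsub>k\<^esub> else \<zero>\<^bsub>k\<^esub>)" if ij: "i < dim" "j < dim" for i j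
  proof -
    have "lincomb (\<lambda>v. if e j = v then \<one>\<^bsub>k\<^esub> else \<zero>\<^bsub>k\<^esub>) B =
        (\<Oplus>\<^bsub>V\<^esub>v\<in>B. if e j = v then v else \<zero>\<^bsub>V\<^esub>)"
      unfolding lincomb_def by (rule M.finsum_cong'[OF refl]) (use B'(1) in auto)
    also have "\<dots> = e j"
      by (rule M.finsum_singleton[OF eB(1)[OF ij(2)] B(1)]) (use B'(1) in auto)
    finally have "lincomb (a (e j)) B = lincomb (\<lambda>v. if e j = v then \<one>\<^bsub>k\<^esub> else \<zero>\<^bsub>k\<^esub>) B"
      using a(2)[OF eB(2)[OF ij(2)]] by simp
    then have "a (e j) (e i) = (if e j = e i then \<one>\<^bsub>k\<^esub> else \<zero>\<^bsub>k\<^esub>)"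
      by (intro uniq[OF a(1)[OF eB(2)[OF ij(2)]] _ _ eB(1)[OF ij(1)]]) auto
    moreover have "e j = e i \<longleftrightarrow> i = j" using e ij by (auto simp: bij_betw_def inj_on_def)
    ultimately show ?thesis by simp
  qed
  have gen: "generates k V (e ` {..<dim})"
    unfolding generates_def
    using span_is_subset[of B] B' e by (auto simp: bij_betw_def)
  have "based_module k V dim e (\<lambda>i. \<lambda>x\<in>carrier V. a x (e i))"
    by unfold_locales (use eB gen co_lin co_e in auto)
  then show thesis by (rule that)
qed

text \<open>A nonzero \<open>c\<close> equal to its negative forces one plus one to be zero. The
  integers annihilating one are then exactly the even ones, and their \<open>Gcd\<close> is
  two.\<close>

lemma (in field) two_torsion_free:
  assumes "ring_char R \<noteq> 2" "c \<in> carrier R" "c = \<ominus>\<^bsub>R\<^esub> c"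
  shows "c = \<zero>\<^bsub>R\<^esub>"
proof (rule ccontr)
  assume c0: "c \<noteq> \<zero>\<^bsub>R\<^esub>"
  have "(\<one>\<^bsub>R\<^esub> \<oplus>\<^bsub>R\<^esub> \<one>\<^bsub>R\<^esub>) \<otimes>\<^bsub>R\<^esub> c = c \<oplus>\<^bsub>R\<^esub> c" using assms(2) by (simp add: l_distr)
  also have "\<dots> = \<zero>\<^bsub>R\<^esub>" using assms(2,3) r_neg by metis
  finally have two: "\<one>\<^bsub>R\<^esub> \<oplus>\<^bsub>R\<^esub> \<one>\<^bsub>R\<^esub> = \<zero>\<^bsub>R\<^esub>" using c0 assms(2) integral_iff by auto
  let ?S = "{n :: nat. [n] \<cdot>\<^bsub>R\<^esub> \<one>\<^bsub>R\<^esub> = \<zero>\<^bsub>R\<^esub>}"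
  have even: "[(2 * m)] \<cdot>\<^bsub>R\<^esub> \<one>\<^bsub>R\<^esub> = \<zero>\<^bsub>R\<^esub>" for m :: nat
  proof (induct m)
    case (Suc m)
    have "[(2 * Suc m)] \<cdot>\<^bsub>R\<^esub> \<one>\<^bsub>R\<^esub> = [(2 * m)] \<cdot>\<^bsub>R\<^esub> \<one>\<^bsub>R\<^esub> \<oplus>\<^bsub>R\<^esub> (\<one>\<^bsub>R\<^esub> \<oplus>\<^bsub>R\<^esub> \<one>\<^bsub>R\<^esub>)"
      by (simp add: a_assoc)
    then show ?case using Suc two by simp
  qed simp
  have "2 dvd n" if "n \<in> ?S" for n
  proof (rule ccontr)
    assume "\<not> 2 dvd n"
    then obtain m where "n = Suc (2 * m)" by (metis oddE Suc_eq_plus1)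
    then show False using that even[of m] by simp
  qed
  then have "2 dvd Gcd ?S" by (rule Gcd_greatest)
  moreover have "Gcd ?S dvd 2" using even[of 1] by (intro Gcd_dvd) simp
  ultimately show False using assms(1) unfolding ring_char_def by (simp add: dvd_antisym)
qed

text \<open>The zero map is its own base change. It is compatible with \<open>rep_can\<close> and
  with the action because both preserve zero; this is the reason for the semilinearity
  assumptions.\<close>

lemma zero_map_Hom_GL:
  fixes k :: "'a ring" and V :: "('a, 'v) module"
  assumes "module k (rep_mod \<rho>)" "module k (rep_mod \<sigma>)"
    and "\<And>R \<phi>. cring R \<Longrightarrow> \<phi> \<in> ring_hom k R \<Longrightarrow> module R (rep_ext \<rho> R \<phi>) \<and> module R (rep_ext \<sigma> R \<phi>)"
    and "\<And>R \<phi>. cring R \<Longrightarrow> \<phi> \<in> ring_hom k R \<Longrightarrow>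
      semilinear k \<phi> (rep_mod \<rho>) (rep_ext \<rho> R \<phi>) (rep_can \<rho> R \<phi>) \<and>
      semilinear k \<phi> (rep_mod \<sigma>) (rep_ext \<sigma> R \<phi>) (rep_can \<sigma> R \<phi>)"
    and "\<And>R \<phi> g. cring R \<Longrightarrow> \<phi> \<in> ring_hom k R \<Longrightarrow> g \<in> GL_points R (ext_scalars k R \<phi> V) \<Longrightarrow>
      semilinear R id (rep_ext \<rho> R \<phi>) (rep_ext \<rho> R \<phi>) (rep_act \<rho> R \<phi> g) \<and>
      semilinear R id (rep_ext \<sigma> R \<phi>) (rep_ext \<sigma> R \<phi>) (rep_act \<sigma> R \<phi> g)"
  shows "(\<lambda>x\<in>carrier (rep_mod \<rho>). \<zero>\<^bsub>rep_mod \<sigma>\<^esub>) \<in> Hom_GL k V \<rho> \<sigma>"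
  unfolding Hom_GL_def
proof (intro CollectI conjI allI impI zero_lin_maps[OF assms(1,2)])
  fix R :: "'a test_alg ring" and \<phi> assume "cring R \<and> \<phi> \<in> ring_hom k R"
  then have R: "cring R" "\<phi> \<in> ring_hom k R" by auto
  have M: "module R (rep_ext \<rho> R \<phi>)" "module R (rep_ext \<sigma> R \<phi>)" using assms(3)[OF R] by auto
  have c: "semilinear k \<phi> (rep_mod \<rho>) (rep_ext \<rho> R \<phi>) (rep_can \<rho> R \<phi>)"
    "semilinear k \<phi> (rep_mod \<sigma>) (rep_ext \<sigma> R \<phi>) (rep_can \<sigma> R \<phi>)" using assms(4)[OF R] by auto
  show "\<exists>F\<in>lin_maps R (rep_ext \<rho> R \<phi>) (rep_ext \<sigma> R \<phi>).
     (\<forall>x\<in>carrier (rep_mod \<rho>). F (rep_can \<rho> R \<phi> x) =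
        rep_can \<sigma> R \<phi> ((\<lambda>x\<in>carrier (rep_mod \<rho>). \<zero>\<^bsub>rep_mod \<sigma>\<^esub>) x)) \<and>
     (\<forall>g\<in>GL_points R (ext_scalars k R \<phi> V). \<forall>y\<in>carrier (rep_ext \<rho> R \<phi>).
        F (rep_act \<rho> R \<phi> g y) = rep_act \<sigma> R \<phi> g (F y))"
  proof (rule bexI[OF _ zero_lin_maps[OF M]], intro conjI ballI)
    fix x assume "x \<in> carrier (rep_mod \<rho>)"
    then show "(\<lambda>y\<in>carrier (rep_ext \<rho> R \<phi>). \<zero>\<^bsub>rep_ext \<sigma> R \<phi>\<^esub>) (rep_can \<rho> R \<phi> x) =
        rep_can \<sigma> R \<phi> ((\<lambda>x\<in>carrier (rep_mod \<rho>). \<zero>\<^bsub>rep_mod \<sigma>\<^esub>) x)"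
      using semilinearD(1)[OF c(1)] semilinear_zero[OF assms(2) M(2) R(2) c(2)] by simp
  next
    fix g y assume g: "g \<in> GL_points R (ext_scalars k R \<phi> V)" and y: "y \<in> carrier (rep_ext \<rho> R \<phi>)"
    have a: "semilinear R id (rep_ext \<rho> R \<phi>) (rep_ext \<rho> R \<phi>) (rep_act \<rho> R \<phi> g)"
      "semilinear R id (rep_ext \<sigma> R \<phi>) (rep_ext \<sigma> R \<phi>) (rep_act \<sigma> R \<phi> g)"
      using assms(5)[OF R g] by auto
    show "(\<lambda>y\<in>carrier (rep_ext \<rho> R \<phi>). \<zero>\<^bsub>rep_ext \<sigma> R \<phi>\<^esub>) (rep_act \<rho> R \<phi> g y) =
        rep_act \<sigma> R \<phi> g ((\<lambda>y\<in>carrier (rep_ext \<rho> R \<phi>). \<zero>\<^bsub>rep_ext \<sigma> R \<phi>\<^esub>) y)"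
      using y semilinearD(1)[OF a(1) y] semilinear_zero[OF M(2,2) ring_hom_id a(2)] by simp
  qed
qed

text \<open>An injection of the elements of \<open>k\<close> into the type of test algebras. Its
  values need not be cosets in a polynomial ring, as the ring structure is transported along
  it.\<close>

definition const_test_alg :: "'a \<Rightarrow> 'a test_alg" where
  "const_test_alg c = {\<lambda>_. c}"

lemma inj_const_test_alg: "inj_on const_test_alg A"
  by (rule inj_onI) (auto simp: const_test_alg_def fun_eq_iff)

text \<open>A single test algebra is used, a copy of \<open>k\<close>. Over it the base change of
  \<open>f\<close> vanishes, and since the structure map is injective no information about
  \<open>f\<close> is lost.\<close>

lemma Hom_GL_sym_ext_end_det_zero:
  fixes k :: "'a ring" and V :: "('a, 'v) module" and r d :: nat
  assumes k: "field k" "ring_char k \<noteq> 2" and r: "odd r" and d: "3 \<le> d"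
    and V: "vectorspace k V" "vectorspace.fin_dim k V" "vectorspace.dim k V = r * d"
    and f: "f \<in> Hom_GL k V (sym_rep k d (ext_rep k r (std_rep k V)))
      (tensor_rep k (end_rep k (std_rep k V)) (det_rep k V))"
    and x: "x \<in> carrier (sym_power k d (ext_power k r V))"
  shows "f x = \<zero>\<^bsub>tensor_mod k (end_mod k V) (ext_power k (vectorspace.dim k V) V)\<^esub>"
proof -
  interpret field k by (rule k(1))
  let ?n = "vectorspace.dim k V"
  let ?\<rho> = "sym_rep k d (ext_rep k r (std_rep k V)) ::
    ('a, 'a test_alg, ('v \<Rightarrow> 'a test_alg) set, _, _) gl_rep"
  let ?\<sigma> = "tensor_rep k (end_rep k (std_rep k V)) (det_rep k V) ::
    ('a, 'a test_alg, ('v \<Rightarrow> 'a test_alg) set, _, _) gl_rep"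
  define \<phi> where "\<phi> = (const_test_alg :: 'a \<Rightarrow> 'a test_alg)"
  define R where "R = image_ring \<phi> k"
  have inj: "inj_on \<phi> (carrier k)" by (simp add: \<phi>_def inj_const_test_alg)
  interpret R: field R unfolding R_def by (rule inj_imp_image_ring_is_field[OF inj])
  have \<phi>: "\<phi> \<in> ring_hom k R"
    using inj_imp_image_ring_iso[OF inj] by (simp add: R_def ring_iso_def)
  have surj: "carrier R = \<phi> ` carrier k" by (simp add: R_def image_ring_carrier)
  have \<phi>0: "\<phi> \<zero>\<^bsub>k\<^esub> = \<zero>\<^bsub>R\<^esub>" by (rule ring_hom_zero[OF \<phi> ring_axioms R.ring_axioms])
  have R: "cring R" by (rule R.is_cring)
  \<comment> \<open>The absence of 2-torsion is carried from \<open>k\<close> to its copy through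
    the injective homomorphism \<phi>.\<close>
  have two: "c = \<zero>\<^bsub>R\<^esub>" if c: "c \<in> carrier R" "c = \<ominus>\<^bsub>R\<^esub> c" for c
  proof -
    obtain b where b: "b \<in> carrier k" "c = \<phi> b" using c(1) surj by blast
    have "\<phi> (b \<oplus>\<^bsub>k\<^esub> b) = c \<oplus>\<^bsub>R\<^esub> c" using ring_hom_add[OF \<phi> b(1) b(1)] b(2) by simp
    also have "\<dots> = \<zero>\<^bsub>R\<^esub>" using c R.r_neg by metis
    finally have "\<phi> (b \<oplus>\<^bsub>k\<^esub> b) = \<phi> \<zero>\<^bsub>k\<^esub>" using \<phi>0 by simp
    then have "b \<oplus>\<^bsub>k\<^esub> b = \<zero>\<^bsub>k\<^esub>" using b(1) inj by (auto dest: inj_onD)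
    then have "b = \<ominus>\<^bsub>k\<^esub> b" using b(1) minus_equality by metis
    then show ?thesis using two_torsion_free[OF k(2) b(1)] b(2) \<phi>0 by simp
  qed
  have mV: "module k V" using V(1) by (simp add: vectorspace_def)
  obtain e co where B: "based_module k V ?n e co" using based_module_exists[OF V(1,2)] by blast
  obtain co' where B': "based_module R (ext_scalars k R \<phi> V) ?n (\<lambda>i. ext_scalars_elt k R \<phi> V (e i)) co'"
    and co': "\<And>i x. i < ?n \<Longrightarrow> x \<in> carrier V \<Longrightarrow> co' i (ext_scalars_elt k R \<phi> V x) = \<phi> (co i x)"
    using based_module_ext_scalars[OF mV R \<phi> B] by blast
  interpret B: based_module k V ?n e co by (rule B)
  interpret B': based_module R "ext_scalars k R \<phi> V" ?n "\<lambda>i. ext_scalars_elt k R \<phi> V (e i)" co'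
    by (rule B')
  have simps: "rep_mod ?\<rho> = sym_power k d (ext_power k r V)" "rep_mod ?\<sigma> = B.Tgt"
    "rep_ext ?\<rho> R \<phi> = sym_power R d (ext_power R r (ext_scalars k R \<phi> V))"
    "rep_ext ?\<sigma> R \<phi> = B'.Tgt" "rep_act ?\<rho> R \<phi> g = B'.act_Sym r d g" for g
    by (simp_all add: sym_rep_def ext_rep_def std_rep_def tensor_rep_def end_rep_def det_rep_def
        B'.act_Sym_def)
  have act: "rep_act ?\<sigma> R \<phi> g = B'.act_Tgt g" for g
    unfolding B'.act_Tgt_def by (rule end_det_act_eq[OF mV R \<phi>])
  obtain F where F: "F \<in> lin_maps R (rep_ext ?\<rho> R \<phi>) (rep_ext ?\<sigma> R \<phi>)"
    "\<And>x. x \<in> carrier (rep_mod ?\<rho>) \<Longrightarrow> F (rep_can ?\<rho> R \<phi> x) = rep_can ?\<sigma> R \<phi> (f x)"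
    "\<And>g y. g \<in> GL_points R (ext_scalars k R \<phi> V) \<Longrightarrow> y \<in> carrier (rep_ext ?\<rho> R \<phi>) \<Longrightarrow>
      F (rep_act ?\<rho> R \<phi> g y) = rep_act ?\<sigma> R \<phi> g (F y)"
    using f R \<phi> unfolding Hom_GL_def by blast
  have F0: "F y = \<zero>\<^bsub>B'.Tgt\<^esub>" if "y \<in> carrier (sym_power R d (ext_power R r (ext_scalars k R \<phi> V)))" for y
    by (rule B'.equivariant_map_zero[OF V(3) r d two _ _ that]) (use F(1,3) in \<open>simp_all add: simps act\<close>)
  have "rep_can ?\<rho> R \<phi> x \<in> carrier (rep_ext ?\<rho> R \<phi>)"
    by (rule semilinearD(1)[OF sym_ext_can_semilinear[OF mV R \<phi>]]) (simp add: simps x)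
  then have can_zero: "rep_can ?\<sigma> R \<phi> (f x) = \<zero>\<^bsub>B'.Tgt\<^esub>"
    using F(2)[of x] F0 x by (simp add: simps)
  have "f \<in> lin_maps k (sym_power k d (ext_power k r V)) B.Tgt"
    using f by (simp add: Hom_GL_def simps)
  then have fx: "f x \<in> carrier B.Tgt" using x by (rule lin_maps_closed)
  then obtain X where X: "X \<in> lin_maps k V V" "f x = B.tens X B.vol" using B.Tgt_elt by blast
  note E = end_can[OF mV R \<phi> X(1)]
  have "B'.tens (end_can k R \<phi> V X) B'.vol = \<zero>\<^bsub>B'.Tgt\<^esub>"
    using can_zero end_det_can(2)[OF mV R \<phi> X(1) B.basis_word_words] X(2) by (simp add: comp_def)
  \<comment> \<open>By \<open>coef\<close>, vanishing of \<open>tens\<close> of the base-changed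
    endomorphism with the volume element means that all its matrix entries vanish.\<close>
  then have *: "co' a (end_can k R \<phi> V X (ext_scalars_elt k R \<phi> V (e b))) = \<zero>\<^bsub>R\<^esub>" if "a < ?n" "b < ?n" for a b
    using B'.coef(2)[OF that E(1)] lin_maps_zero[OF B'.Tgt B'.self B'.coef(1)[OF that]] by simp
  show "f x = \<zero>\<^bsub>B.Tgt\<^esub>"
  proof (rule B.Tgt_eq_zeroI[OF fx])
    fix a b assume ab: "a < ?n" "b < ?n"
    have Xe: "X (e b) \<in> carrier V" by (rule lin_maps_closed[OF X(1) B.e_closed[OF ab(2)]])
    \<comment> \<open>Matrix entries of the base change are the images under \<phi> of the entries
      over \<open>k\<close>, so injectivity brings the vanishing back to \<open>f x\<close>.\<close>
    have "\<phi> (co a (X (e b))) = \<phi> \<zero>\<^bsub>k\<^esub>"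
      using *[OF ab] E(2)[OF B.e_closed[OF ab(2)]] co'[OF ab(1) Xe] \<phi>0 by simp
    then have "co a (X (e b)) = \<zero>\<^bsub>k\<^esub>"
      using inj B.co_closed[OF ab(1) Xe] by (auto dest: inj_onD)
    then show "B.coef a b (f x) = \<zero>\<^bsub>k\<^esub>" using B.coef(2)[OF ab X(1)] X(2) by simp
  qed
qed

theorem theorem1p1:
  fixes k :: "'a ring" and V :: "('a, 'v) module" and r d :: nat
  assumes "field k" and "ring_char k \<noteq> 2"
    and "r \<ge> 3" and "odd r" and "d \<ge> 3"
    and "vectorspace k V" and "vectorspace.fin_dim k V" and "vectorspace.dim k V = r * d"
  shows "Hom_GL k V (sym_rep k d (ext_rep k r (std_rep k V)))
           (tensor_rep k (end_rep k (std_rep k V)) (det_rep k V)) =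
         {\<lambda>x\<in>carrier (sym_power k d (ext_power k r V)).
            \<zero>\<^bsub>tensor_mod k (end_mod k V) (ext_power k (vectorspace.dim k V) V)\<^esub>}"
proof -
  let ?\<rho> = "sym_rep k d (ext_rep k r (std_rep k V)) ::
    ('a, 'a test_alg, ('v \<Rightarrow> 'a test_alg) set, _, _) gl_rep"
  let ?\<sigma> = "tensor_rep k (end_rep k (std_rep k V)) (det_rep k V) ::
    ('a, 'a test_alg, ('v \<Rightarrow> 'a test_alg) set, _, _) gl_rep"
  let ?S = "sym_power k d (ext_power k r V)"
  let ?T = "tensor_mod k (end_mod k V) (ext_power k (vectorspace.dim k V) V)"
  have V: "module k V" using assms(6) by (simp add: vectorspace_def)
  have mods: "rep_mod ?\<rho> = ?S" "rep_mod ?\<sigma> = ?T"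
    by (simp_all add: sym_rep_def ext_rep_def std_rep_def tensor_rep_def end_rep_def det_rep_def)
  have mk: "module k ?S" "module k ?T"
    by (intro sym_power_module ext_power_module tensor_mod_module end_mod_module V)+
  show ?thesis
  proof (intro equalityI subsetI)
    fix f assume f: "f \<in> Hom_GL k V ?\<rho> ?\<sigma>"
    then have "f \<in> lin_maps k ?S ?T" by (simp add: Hom_GL_def mods)
    then have "f = (\<lambda>x\<in>carrier ?S. \<zero>\<^bsub>?T\<^esub>)"
      by (rule lin_maps_eqI[OF _ zero_lin_maps[OF mk]])
        (use Hom_GL_sym_ext_end_det_zero[OF assms(1,2,4-8) f] in simp)
    then show "f \<in> {\<lambda>x\<in>carrier ?S. \<zero>\<^bsub>?T\<^esub>}" by simp
  next
    fix f assume "f \<in> {\<lambda>x\<in>carrier ?S. \<zero>\<^bsub>?T\<^esub>}"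
    \<comment> \<open>The set is claimed to equal the singleton of the zero map, so that map must be
      shown to be equivariant over every test algebra, not just over the copy of
      \<open>k\<close>.\<close>
    moreover have "(\<lambda>x\<in>carrier (rep_mod ?\<rho>). \<zero>\<^bsub>rep_mod ?\<sigma>\<^esub>) \<in> Hom_GL k V ?\<rho> ?\<sigma>"
    proof (rule zero_map_Hom_GL)
      show "module k (rep_mod ?\<rho>)" "module k (rep_mod ?\<sigma>)" using mk by (simp_all add: mods)
      fix R :: "'a test_alg ring" and \<phi> assume R: "cring R" "\<phi> \<in> ring_hom k R"
      have W: "module R (ext_scalars k R \<phi> V)" by (rule ext_scalars_module[OF V R])
      show "module R (rep_ext ?\<rho> R \<phi>) \<and> module R (rep_ext ?\<sigma> R \<phi>)"
        by (simp add: sym_rep_def ext_rep_def std_rep_def tensor_rep_def end_rep_def det_rep_def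
            sym_power_module ext_power_module tensor_mod_module end_mod_module W)
      show "semilinear k \<phi> (rep_mod ?\<rho>) (rep_ext ?\<rho> R \<phi>) (rep_can ?\<rho> R \<phi>) \<and>
          semilinear k \<phi> (rep_mod ?\<sigma>) (rep_ext ?\<sigma> R \<phi>) (rep_can ?\<sigma> R \<phi>)"
        using sym_ext_can_semilinear[OF V R] end_det_can(1)[OF V R] by blast
      fix g assume g: "g \<in> GL_points R (ext_scalars k R \<phi> V)"
      show "semilinear R id (rep_ext ?\<rho> R \<phi>) (rep_ext ?\<rho> R \<phi>) (rep_act ?\<rho> R \<phi> g) \<and>
          semilinear R id (rep_ext ?\<sigma> R \<phi>) (rep_ext ?\<sigma> R \<phi>) (rep_act ?\<sigma> R \<phi> g)"
        using sym_ext_act[OF V R g] end_det_act[OF V R g] by blast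
    qed
    ultimately show "f \<in> Hom_GL k V ?\<rho> ?\<sigma>" by (simp add: mods)
  qed
qed

end
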